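(* Let $G_1$ and $G_2$ be connected graphs that are not quantum isomorphic. If $G_1$ and $G_2$ have no quantum symmetry, then their disjoint union $G_1\cup G_2$ has no nonlocal symmetry.
   Context: Graphs are finite and simple, with adjacency matrix $A_G$. For a graph $G$, $C(\mathrm{Qut}(G))$ is the universal unital $C^*$-algebra generated by $u_{ij}$, $i,j\in V(G)$, subject to $u_{ij}=u_{ij}^*=u_{ij}^2$, $\sum_ku_{ik}=\mathbf 1=\sum_ku_{ki}$ and $UA_G=A_GU$, where $U=(u_{ij})$. $G$ has no quantum symmetry if $C(\mathrm{Qut}(G))$ is commutative. For graphs $G,H$ with $|V(G)|=|V(H)|$, in the $(G,H)$-isomorphism game Alice and Bob receive $g,g'\in V(G)$ and answer $h,h'\in V(H)$ (without communicating), and win iff $\mathrm{rel}(g,g')=\mathrm{rel}(h,h')$, where $\mathrm{rel}$ records whether two vertices are equal, distinct and adjacent, or distinct and non-adjacent. A correlation is a function $p(h,h'|g,g')\in[0,1]$ with $\sum_{h,h'}p(h,h'|g,g')=1$; it is winning if it vanishes whenever the answers lose. A quantum correlation is one of the form $p(h,h'|g,g')=\psi^*M_{gh}N_{g'h'}\psi$ with $\psi$ a unit vector in a Hilbert space and $M_{gh},N_{g'h'}$ positive semidefinite bounded operators with $\sum_hM_{gh}=\mathbf 1=\sum_{h'}N_{g'h'}$ and $M_{gh}N_{g'h'}=N_{g'h'}M_{gh}$. $G$ and $H$ are quantum isomorphic if $|V(G)|=|V(H)|$ and there is a winning quantum correlation for the $(G,H)$-isomorphism game. (Known equivalent form: winning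 quantum correlations are exactly $p(h,h'|g,g')=\tau(u_{gh}u_{g'h'})$ for a tracial state $\tau$ on a unital $C^*$-algebra and a $V(G)\times V(H)$ matrix $U=(u_{gh})$ of projections over that algebra whose rows and columns sum to $\mathbf 1$ and with $A_GU=UA_H$.) The $G$-automorphism game is the $(G,G)$-isomorphism game; its winning classical correlations are the convex combinations of the $p_\pi$, $\pi\in\mathrm{Aut}(G)$, with $p_\pi(l,k|i,j)=1$ if $l=\pi(i),k=\pi(j)$ and $0$ otherwise. $G$ has nonlocal symmetry if there is a winning quantum correlation for the $G$-automorphism game that is not classical. It is known that the winning quantum correlations of this game are exactly $p(l,k|i,j)=\tau(u_{il}u_{jk})$ for tracial states $\tau$ on $C(\mathrm{Qut}(G))$. *)

theory Defs
  imports
    Complex_Main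
    "HOL-Library.Nonpos_Ints"
    "HOL-Combinatorics.Permutations"
    "HOL-Algebra.Module"
    "HOL-Algebra.Algebraic_Closure_Type"
    "Graph_Theory.Pair_Digraph"
    "Graph_Theory.Digraph_Component"
begin

section \<open>Graphs\<close>

text \<open>
  A finite simple graph is a \<^const>\<open>pair_pre_digraph.pverts\<close>/\<^const>\<open>pair_pre_digraph.parcs\<close> record
  satisfying \<^const>\<open>pair_graph\<close>: finite, loop-free, and with a symmetric set of arcs, an edge being a
  pair of opposite arcs.
\<close>

definition disjoint_union ::
    "'a pair_pre_digraph \<Rightarrow> 'b pair_pre_digraph \<Rightarrow> ('a + 'b) pair_pre_digraph" where
  "disjoint_union G H =
    \<lparr> pverts = pverts G <+> pverts H,
      parcs = {(Inl u, Inl v) | u v. (u, v) \<in> parcs G} \<union> {(Inr u, Inr v) | u v. (u, v) \<in> parcs H} \<rparr>"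

definition adj_matrix :: "'a pair_pre_digraph \<Rightarrow> 'a \<Rightarrow> 'a \<Rightarrow> complex" where
  "adj_matrix G i j = (if (i, j) \<in> parcs G then 1 else 0)"

definition graph_automorphisms :: "'a pair_pre_digraph \<Rightarrow> ('a \<Rightarrow> 'a) set" where
  "graph_automorphisms G =
    {\<pi>. \<pi> permutes pverts G \<and>
        (\<forall>i\<in>pverts G. \<forall>j\<in>pverts G. (\<pi> i, \<pi> j) \<in> parcs G \<longleftrightarrow> (i, j) \<in> parcs G)}"

datatype vertex_relation = Equal | Adjacent | Distinct_Nonadjacent

definition rel :: "'a pair_pre_digraph \<Rightarrow> 'a \<Rightarrow> 'a \<Rightarrow> vertex_relation" where
  "rel G g g' =
    (if g = g' then Equal else if (g, g') \<in> parcs G then Adjacent else Distinct_Nonadjacent)"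


section \<open>Hilbert spaces and C*-algebras\<close>

text \<open>
  Both are structures on a carrier set inside an arbitrary type, so that one can quantify over them
  in a formula. The linear structure is that of a module over the ring of complex numbers; the
  multiplicative fields which the record \<^typ>\<open>('r, 'a) module\<close> inherits from rings are unused for
  Hilbert spaces.
\<close>

abbreviation complex_ring :: "complex ring" where
  "complex_ring \<equiv> ring_of_type_algebra"

definition complete_wrt :: "'a set \<Rightarrow> ('a \<Rightarrow> 'a \<Rightarrow> real) \<Rightarrow> bool" where
  "complete_wrt S d \<longleftrightarrow>
    (\<forall>s :: nat \<Rightarrow> 'a. range s \<subseteq> S \<longrightarrow>
      (\<forall>e>0. \<exists>K. \<forall>m\<ge>K. \<forall>n\<ge>K. d (s m) (s n) < e) \<longrightarrow>
      (\<exists>x\<in>S. (\<lambda>n. d (s n) x) \<longlonglongrightarrow> 0))"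

record 'h hilbert = "(complex, 'h) module" +
  inner_prod :: "'h \<Rightarrow> 'h \<Rightarrow> complex"

definition hilbert_norm :: "'h hilbert \<Rightarrow> 'h \<Rightarrow> real" where
  "hilbert_norm H x = sqrt (Re (inner_prod H x x))"

text \<open>
  The inner product is linear in the second argument, so that \<open>inner_prod H x (T x)\<close> is
  \<open>x\<^sup>* T x\<close>.
\<close>

locale hilbert_space = module complex_ring H for H :: "'h hilbert" (structure) +
  assumes inner_prod_add:
      "\<lbrakk>x \<in> carrier H; y \<in> carrier H; z \<in> carrier H\<rbrakk> \<Longrightarrow>
        inner_prod H x (y \<oplus>\<^bsub>H\<^esub> z) = inner_prod H x y + inner_prod H x z"
    and inner_prod_smult:
      "\<lbrakk>x \<in> carrier H; y \<in> carrier H\<rbrakk> \<Longrightarrow>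
        inner_prod H x (c \<odot>\<^bsub>H\<^esub> y) = c * inner_prod H x y"
    and inner_prod_cnj:
      "\<lbrakk>x \<in> carrier H; y \<in> carrier H\<rbrakk> \<Longrightarrow> inner_prod H y x = cnj (inner_prod H x y)"
    and inner_prod_pos:
      "\<lbrakk>x \<in> carrier H; x \<noteq> \<zero>\<^bsub>H\<^esub>\<rbrakk> \<Longrightarrow> Re (inner_prod H x x) > 0"
    and hilbert_complete:
      "complete_wrt (carrier H) (\<lambda>x y. hilbert_norm H (x \<ominus>\<^bsub>H\<^esub> y))"

definition bounded_operator :: "'h hilbert \<Rightarrow> ('h \<Rightarrow> 'h) \<Rightarrow> bool" where
  "bounded_operator H T \<longleftrightarrow>
    T \<in> carrier H \<rightarrow> carrier H \<and>
    (\<forall>x\<in>carrier H. \<forall>y\<in>carrier H. T (x \<oplus>\<^bsub>H\<^esub> y) = T x \<oplus>\<^bsub>H\<^esub> T y) \<and>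
    (\<forall>c. \<forall>x\<in>carrier H. T (c \<odot>\<^bsub>H\<^esub> x) = c \<odot>\<^bsub>H\<^esub> T x) \<and>
    (\<exists>B. \<forall>x\<in>carrier H. hilbert_norm H (T x) \<le> B * hilbert_norm H x)"

definition psd_operator :: "'h hilbert \<Rightarrow> ('h \<Rightarrow> 'h) \<Rightarrow> bool" where
  "psd_operator H T \<longleftrightarrow>
    bounded_operator H T \<and> (\<forall>x\<in>carrier H. inner_prod H x (T x) \<in> \<real>\<^sub>\<ge>\<^sub>0)"

record 'c cstar = "(complex, 'c) module" +
  star :: "'c \<Rightarrow> 'c"
  cnorm :: "'c \<Rightarrow> real"

text \<open>Unital C*-algebras; the zero algebra is included.\<close>

locale cstar_algebra = ring A + module complex_ring A for A :: "'c cstar" (structure) +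
  assumes smult_mult_left:
      "\<lbrakk>x \<in> carrier A; y \<in> carrier A\<rbrakk> \<Longrightarrow> (c \<odot>\<^bsub>A\<^esub> x) \<otimes>\<^bsub>A\<^esub> y = c \<odot>\<^bsub>A\<^esub> (x \<otimes>\<^bsub>A\<^esub> y)"
    and smult_mult_right:
      "\<lbrakk>x \<in> carrier A; y \<in> carrier A\<rbrakk> \<Longrightarrow> x \<otimes>\<^bsub>A\<^esub> (c \<odot>\<^bsub>A\<^esub> y) = c \<odot>\<^bsub>A\<^esub> (x \<otimes>\<^bsub>A\<^esub> y)"
    and star_closed: "x \<in> carrier A \<Longrightarrow> star A x \<in> carrier A"
    and star_star: "x \<in> carrier A \<Longrightarrow> star A (star A x) = x"
    and star_add:
      "\<lbrakk>x \<in> carrier A; y \<in> carrier A\<rbrakk> \<Longrightarrow> star A (x \<oplus>\<^bsub>A\<^esub> y) = star A x \<oplus>\<^bsub>A\<^esub> star A y"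
    and star_smult: "x \<in> carrier A \<Longrightarrow> star A (c \<odot>\<^bsub>A\<^esub> x) = cnj c \<odot>\<^bsub>A\<^esub> star A x"
    and star_mult:
      "\<lbrakk>x \<in> carrier A; y \<in> carrier A\<rbrakk> \<Longrightarrow> star A (x \<otimes>\<^bsub>A\<^esub> y) = star A y \<otimes>\<^bsub>A\<^esub> star A x"
    and cnorm_nonneg: "x \<in> carrier A \<Longrightarrow> cnorm A x \<ge> 0"
    and cnorm_eq_zero: "x \<in> carrier A \<Longrightarrow> cnorm A x = 0 \<longleftrightarrow> x = \<zero>\<^bsub>A\<^esub>"
    and cnorm_triangle:
      "\<lbrakk>x \<in> carrier A; y \<in> carrier A\<rbrakk> \<Longrightarrow> cnorm A (x \<oplus>\<^bsub>A\<^esub> y) \<le> cnorm A x + cnorm A y"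
    and cnorm_smult: "x \<in> carrier A \<Longrightarrow> cnorm A (c \<odot>\<^bsub>A\<^esub> x) = cmod c * cnorm A x"
    and cnorm_mult:
      "\<lbrakk>x \<in> carrier A; y \<in> carrier A\<rbrakk> \<Longrightarrow> cnorm A (x \<otimes>\<^bsub>A\<^esub> y) \<le> cnorm A x * cnorm A y"
    and cnorm_cstar: "x \<in> carrier A \<Longrightarrow> cnorm A (star A x \<otimes>\<^bsub>A\<^esub> x) = (cnorm A x)\<^sup>2"
    and cstar_complete: "complete_wrt (carrier A) (\<lambda>x y. cnorm A (x \<ominus>\<^bsub>A\<^esub> y))"

definition cstar_subalgebra :: "'c set \<Rightarrow> 'c cstar \<Rightarrow> bool" where
  "cstar_subalgebra S A \<longleftrightarrow>
    S \<subseteq> carrier A \<and> \<one>\<^bsub>A\<^esub> \<in> S \<and>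
    (\<forall>x\<in>S. \<forall>y\<in>S. x \<oplus>\<^bsub>A\<^esub> y \<in> S \<and> x \<otimes>\<^bsub>A\<^esub> y \<in> S) \<and>
    (\<forall>c. \<forall>x\<in>S. c \<odot>\<^bsub>A\<^esub> x \<in> S) \<and>
    (\<forall>x\<in>S. star A x \<in> S) \<and>
    (\<forall>s :: nat \<Rightarrow> 'c. \<forall>x\<in>carrier A.
      range s \<subseteq> S \<longrightarrow> (\<lambda>n. cnorm A (s n \<ominus>\<^bsub>A\<^esub> x)) \<longlonglongrightarrow> 0 \<longrightarrow> x \<in> S)"

definition cstar_generated_by :: "'c cstar \<Rightarrow> 'c set \<Rightarrow> bool" where
  "cstar_generated_by A U \<longleftrightarrow>
    U \<subseteq> carrier A \<and> (\<forall>S. cstar_subalgebra S A \<longrightarrow> U \<subseteq> S \<longrightarrow> S = carrier A)"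

definition star_hom :: "'c cstar \<Rightarrow> 'd cstar \<Rightarrow> ('c \<Rightarrow> 'd) set" where
  "star_hom A B =
    {\<phi> \<in> ring_hom A B.
      (\<forall>c. \<forall>x\<in>carrier A. \<phi> (c \<odot>\<^bsub>A\<^esub> x) = c \<odot>\<^bsub>B\<^esub> \<phi> x) \<and>
      (\<forall>x\<in>carrier A. \<phi> (star A x) = star B (\<phi> x))}"


section \<open>Quantum symmetry\<close>

definition qut_relations :: "'v pair_pre_digraph \<Rightarrow> 'c cstar \<Rightarrow> ('v \<Rightarrow> 'v \<Rightarrow> 'c) \<Rightarrow> bool" where
  "qut_relations G A u \<longleftrightarrow>
    (\<forall>i\<in>pverts G. \<forall>j\<in>pverts G.
      u i j \<in> carrier A \<and> star A (u i j) = u i j \<and> u i j \<otimes>\<^bsub>A\<^esub> u i j = u i j) \<and>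
    (\<forall>i\<in>pverts G. (\<Oplus>\<^bsub>A\<^esub>k\<in>pverts G. u i k) = \<one>\<^bsub>A\<^esub> \<and> (\<Oplus>\<^bsub>A\<^esub>k\<in>pverts G. u k i) = \<one>\<^bsub>A\<^esub>) \<and>
    (\<forall>i\<in>pverts G. \<forall>j\<in>pverts G.
      (\<Oplus>\<^bsub>A\<^esub>k\<in>pverts G. adj_matrix G k j \<odot>\<^bsub>A\<^esub> u i k) =
      (\<Oplus>\<^bsub>A\<^esub>k\<in>pverts G. adj_matrix G i k \<odot>\<^bsub>A\<^esub> u k j))"

text \<open>
  \<open>is_C_Qut G A u\<close>: the pair of \<open>A\<close> and \<open>u\<close> is (a copy of) \<open>C(Qut(G))\<close> with its canonical generators.
  The algebras \<open>B\<close> tested in the universal property have their carriers in the type \<open>'c\<close> of \<open>A\<close>. For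
  \<open>'c\<close> of cardinality at least that of the continuum this is the usual universal property: only the
  subalgebra generated by the images of the generators matters, and a finitely generated
  C*-algebra is separable, hence of cardinality at most that of the continuum.
\<close>

definition is_C_Qut :: "'v pair_pre_digraph \<Rightarrow> 'c cstar \<Rightarrow> ('v \<Rightarrow> 'v \<Rightarrow> 'c) \<Rightarrow> bool" where
  "is_C_Qut G A u \<longleftrightarrow>
    cstar_algebra A \<and> qut_relations G A u \<and>
    cstar_generated_by A {u i j | i j. i \<in> pverts G \<and> j \<in> pverts G} \<and>
    (\<forall>(B :: 'c cstar) v. cstar_algebra B \<longrightarrow> qut_relations G B v \<longrightarrow>
      (\<exists>\<phi>\<in>star_hom A B. \<forall>i\<in>pverts G. \<forall>j\<in>pverts G. \<phi> (u i j) = v i j))"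

text \<open>For the same reason \<open>C(Qut(G))\<close> has a copy in every type \<open>'c\<close> of at least that cardinality.\<close>

definition no_quantum_symmetry :: "'c itself \<Rightarrow> 'v pair_pre_digraph \<Rightarrow> bool" where
  "no_quantum_symmetry TYPE('c) G \<longleftrightarrow>
    (\<exists>(A :: 'c cstar) u. is_C_Qut G A u \<and>
      (\<forall>x\<in>carrier A. \<forall>y\<in>carrier A. x \<otimes>\<^bsub>A\<^esub> y = y \<otimes>\<^bsub>A\<^esub> x))"


section \<open>Correlations and the isomorphism game\<close>

text \<open>
  A correlation \<open>p(h, h' | g, g')\<close> is written \<open>p h h' g g'\<close>; only its values at questions in \<open>V\<close> and
  answers in \<open>W\<close> are meaningful.
\<close>

type_synonym ('a, 'b) corr = "'b \<Rightarrow> 'b \<Rightarrow> 'a \<Rightarrow> 'a \<Rightarrow> real"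

definition correlation :: "'a set \<Rightarrow> 'b set \<Rightarrow> ('a, 'b) corr \<Rightarrow> bool" where
  "correlation V W p \<longleftrightarrow>
    (\<forall>g\<in>V. \<forall>g'\<in>V.
      (\<forall>h\<in>W. \<forall>h'\<in>W. 0 \<le> p h h' g g' \<and> p h h' g g' \<le> 1) \<and>
      (\<Sum>h\<in>W. \<Sum>h'\<in>W. p h h' g g') = 1)"

definition povm :: "'h hilbert \<Rightarrow> 'b set \<Rightarrow> ('b \<Rightarrow> 'h \<Rightarrow> 'h) \<Rightarrow> bool" where
  "povm H W M \<longleftrightarrow>
    (\<forall>h\<in>W. psd_operator H (M h)) \<and> (\<forall>x\<in>carrier H. (\<Oplus>\<^bsub>H\<^esub>h\<in>W. M h x) = x)"

text \<open>
  The Hilbert space ranges over all those with carrier in \<open>'h\<close>. If \<open>'h\<close> has at least the cardinality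
  of the continuum (and \<open>V\<close>, \<open>W\<close> are finite), every quantum correlation is of this form, since one may
  pass to the separable closed subspace generated from the unit vector by the operators.
\<close>

definition quantum_correlation :: "'h itself \<Rightarrow> 'a set \<Rightarrow> 'b set \<Rightarrow> ('a, 'b) corr \<Rightarrow> bool" where
  "quantum_correlation TYPE('h) V W p \<longleftrightarrow>
    correlation V W p \<and>
    (\<exists>(H :: 'h hilbert) \<psi> M N.
      hilbert_space H \<and> \<psi> \<in> carrier H \<and> hilbert_norm H \<psi> = 1 \<and>
      (\<forall>g\<in>V. povm H W (M g)) \<and> (\<forall>g\<in>V. povm H W (N g)) \<and>
      (\<forall>g\<in>V. \<forall>h\<in>W. \<forall>g'\<in>V. \<forall>h'\<in>W. \<forall>x\<in>carrier H.
        M g h (N g' h' x) = N g' h' (M g h x)) \<and>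
      (\<forall>g\<in>V. \<forall>h\<in>W. \<forall>g'\<in>V. \<forall>h'\<in>W.
        complex_of_real (p h h' g g') = inner_prod H \<psi> (M g h (N g' h' \<psi>))))"

definition winning :: "'a pair_pre_digraph \<Rightarrow> 'b pair_pre_digraph \<Rightarrow> ('a, 'b) corr \<Rightarrow> bool" where
  "winning G H p \<longleftrightarrow>
    (\<forall>g\<in>pverts G. \<forall>g'\<in>pverts G. \<forall>h\<in>pverts H. \<forall>h'\<in>pverts H.
      rel G g g' \<noteq> rel H h h' \<longrightarrow> p h h' g g' = 0)"

definition quantum_isomorphic ::
    "'h itself \<Rightarrow> 'a pair_pre_digraph \<Rightarrow> 'b pair_pre_digraph \<Rightarrow> bool" where
  "quantum_isomorphic TYPE('h) G H \<longleftrightarrow>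
    card (pverts G) = card (pverts H) \<and>
    (\<exists>p. quantum_correlation TYPE('h) (pverts G) (pverts H) p \<and> winning G H p)"

definition automorphism_correlation :: "('a \<Rightarrow> 'a) \<Rightarrow> ('a, 'a) corr" where
  "automorphism_correlation \<pi> l k i j = (if l = \<pi> i \<and> k = \<pi> j then 1 else 0)"

text \<open>
  The winning classical correlations of the automorphism game: the convex combinations of the
  deterministic correlations given by automorphisms. Since \<^const>\<open>graph_automorphisms\<close> consists of
  permutations fixing everything outside the vertex set, it is finite for a finite graph.
\<close>

definition winning_classical :: "'a pair_pre_digraph \<Rightarrow> ('a, 'a) corr \<Rightarrow> bool" where
  "winning_classical G p \<longleftrightarrow>
    (\<exists>c :: ('a \<Rightarrow> 'a) \<Rightarrow> real.
      (\<forall>\<pi>\<in>graph_automorphisms G. 0 \<le> c \<pi>) \<and> (\<Sum>\<pi>\<in>graph_automorphisms G. c \<pi>) = 1 \<and>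
      (\<forall>i\<in>pverts G. \<forall>j\<in>pverts G. \<forall>l\<in>pverts G. \<forall>k\<in>pverts G.
        p l k i j = (\<Sum>\<pi>\<in>graph_automorphisms G. c \<pi> * automorphism_correlation \<pi> l k i j)))"

definition nonlocal_symmetry :: "'h itself \<Rightarrow> 'a pair_pre_digraph \<Rightarrow> bool" where
  "nonlocal_symmetry TYPE('h) G \<longleftrightarrow>
    (\<exists>p. quantum_correlation TYPE('h) (pverts G) (pverts G) p \<and> winning G G p \<and>
      \<not> winning_classical G p)"

text \<open>
  A type of exactly the cardinality of the continuum, which by the above suffices for
  \<^const>\<open>quantum_isomorphic\<close> and \<^const>\<open>no_quantum_symmetry\<close> to have their unrestricted
  meaning.
\<close>

type_synonym continuum = "nat \<Rightarrow> complex"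

end

theory Submission
  imports Defs "HOL-Library.Countable_Set" "HOL-Library.Function_Algebras"
begin

text \<open>
  Restricting a winning quantum correlation to the subspace generated from its vector \<open>\<psi>\<close> by the
  measurement operators yields projections \<open>u\<^sub>i\<^sub>l\<close> that form a magic unitary commuting with the
  adjacency matrix, and \<open>\<langle>\<psi>, _ \<psi>\<rangle>\<close> becomes a trace on the algebra generated by them. For \<open>i\<close> in
  \<open>G\<^sub>1\<close> the projection \<open>p = \<Sum>\<^sub>l u\<^sub>i\<^sub>l\<close>, \<open>l\<close> running over \<open>G\<^sub>2\<close>, does not change along edges, hence by
  connectedness does not depend on \<open>i\<close>. If \<open>p \<psi>\<close> is not \<open>0\<close>, then normalizing it gives a state in which
  the \<open>u\<^sub>i\<^sub>l\<close> win the \<open>(G\<^sub>1, G\<^sub>2)\<close>-isomorphism game. So \<open>u\<close> is block diagonal, and since neither graph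
  has quantum symmetry the entries of each block commute with each other. The blocks need not commute,
  but they have joint spectral resolutions \<open>(E\<^sub>\<pi>)\<close> and \<open>(F\<^sub>\<sigma>)\<close> indexed by the automorphisms of \<open>G\<^sub>1\<close> and
  \<open>G\<^sub>2\<close>, and a correlation only sees products of two entries. It is therefore the convex
  combination of the automorphisms \<open>\<pi> \<union> \<sigma>\<close> with weights \<open>\<langle>\<psi>, E\<^sub>\<pi> F\<^sub>\<sigma> \<psi>\<rangle>\<close>, which are
  nonnegative because \<open>\<langle>\<psi>, _ \<psi>\<rangle>\<close> is a trace.
\<close>

section \<open>Hilbert spaces\<close>

text \<open>The hypotheses on \<open>G1\<close> and \<open>G2\<close> concern spaces and algebras
  carried by \<open>continuum\<close>, whereas the correlation lives on a space in an arbitrary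
  type. The cyclic subspace is separable, so its vectors can be coded by their inner products with a
  sequence, and operators on it by their matrices; this makes them admissible in the universal
  property of \<open>is_C_Qut\<close>. All bounded operators with an adjoint are taken there, so the
  algebra generated by the projections is never formed. The second family of measurements acts like
  right multiplication: \<open>N i l \<psi> = M i l \<psi>\<close>, and each \<open>N\<close>
  commutes with each \<open>M\<close>. Hence \<psi> is cyclic for the \<open>N\<close> alone, and a
  relation between products of \<open>M\<close> that holds at \<psi> holds on the whole space. This
  is how statements about probabilities become operator identities. The assumption
  \<open>not_qi\<close> is directed from \<open>G1\<close> to \<open>G2\<close>. It removes the
  block of entries leading from \<open>G1\<close> to \<open>G2\<close>; the opposite block then
  vanishes by counting rows and columns.\<close>

lemma complex_ring_simps [simp]:
  "carrier complex_ring = UNIV"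
  "a \<oplus>\<^bsub>complex_ring\<^esub> b = a + b"
  "a \<otimes>\<^bsub>complex_ring\<^esub> b = a * b"
  "\<zero>\<^bsub>complex_ring\<^esub> = 0"
  "\<one>\<^bsub>complex_ring\<^esub> = 1"
  by (simp_all add: ring_of_type_algebra_def)

context hilbert_space
begin

abbreviation ip :: "'h \<Rightarrow> 'h \<Rightarrow> complex" where "ip \<equiv> inner_prod H"

lemma smult_in_carrier [simp, intro]: "x \<in> carrier H \<Longrightarrow> c \<odot> x \<in> carrier H"
  by simp

lemma ip_add_left:
  assumes "x \<in> carrier H" "y \<in> carrier H" "z \<in> carrier H"
  shows "ip (x \<oplus> y) z = ip x z + ip y z"
proof -
  have "ip (x \<oplus> y) z = cnj (ip z (x \<oplus> y))"
    using assms by (intro inner_prod_cnj) auto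
  then show ?thesis
    using assms inner_prod_cnj[of z x] inner_prod_cnj[of z y] by (simp add: inner_prod_add)
qed

lemma ip_smult_left:
  assumes "x \<in> carrier H" "y \<in> carrier H"
  shows "ip (c \<odot> x) y = cnj c * ip x y"
  by (metis assms complex_cnj_mult inner_prod_cnj inner_prod_smult smult_in_carrier)

lemma ip_zero_right [simp]: "x \<in> carrier H \<Longrightarrow> ip x \<zero> = 0"
  using inner_prod_add[of x \<zero> \<zero>] by simp

lemma ip_zero_left [simp]: "x \<in> carrier H \<Longrightarrow> ip \<zero> x = 0"
  using ip_add_left[of \<zero> \<zero> x] by simp

lemma ip_minus_right:
  assumes "x \<in> carrier H" "y \<in> carrier H" "z \<in> carrier H"
  shows "ip x (y \<ominus> z) = ip x y - ip x z"
proof -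
  have "ip x ((y \<ominus> z) \<oplus> z) = ip x (y \<ominus> z) + ip x z"
    using assms by (intro inner_prod_add) auto
  moreover have "(y \<ominus> z) \<oplus> z = y"
    using assms by (simp add: M.minus_eq M.a_assoc M.l_neg)
  ultimately show ?thesis by simp
qed

lemma ip_minus_left:
  assumes "x \<in> carrier H" "y \<in> carrier H" "z \<in> carrier H"
  shows "ip (y \<ominus> z) x = ip y x - ip z x"
  by (metis assms complex_cnj_diff inner_prod_cnj ip_minus_right M.minus_closed)

lemma ip_self: "x \<in> carrier H \<Longrightarrow> ip x x = of_real (Re (ip x x))"
  by (metis Reals_cnj_iff inner_prod_cnj of_real_Re)

lemma ip_self_nonneg: "x \<in> carrier H \<Longrightarrow> 0 \<le> Re (ip x x)"
  by (metis inner_prod_pos ip_zero_right less_eq_real_def zero_complex.sel(1))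

lemma ip_self_eq_0: "x \<in> carrier H \<Longrightarrow> ip x x = 0 \<longleftrightarrow> x = \<zero>"
  by (metis inner_prod_pos ip_zero_right less_irrefl zero_complex.sel(1))

lemma hilbert_norm_power2: "x \<in> carrier H \<Longrightarrow> (hilbert_norm H x)\<^sup>2 = Re (ip x x)"
  by (simp add: hilbert_norm_def ip_self_nonneg)

lemma hilbert_norm_nonneg: "x \<in> carrier H \<Longrightarrow> 0 \<le> hilbert_norm H x"
  by (simp add: hilbert_norm_def ip_self_nonneg)

lemma ip_self_norm: "x \<in> carrier H \<Longrightarrow> ip x x = of_real ((hilbert_norm H x)\<^sup>2)"
  by (metis hilbert_norm_power2 ip_self)

section \<open>Linear operators and the semi-inner products of positive ones\<close>

definition linear_op :: "('h \<Rightarrow> 'h) \<Rightarrow> bool" where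
  "linear_op T \<longleftrightarrow> T \<in> carrier H \<rightarrow> carrier H \<and>
    (\<forall>x\<in>carrier H. \<forall>y\<in>carrier H. T (x \<oplus> y) = T x \<oplus> T y) \<and>
    (\<forall>c. \<forall>x\<in>carrier H. T (c \<odot> x) = c \<odot> T x)"

lemma psd_imp_linear_op: "psd_operator H T \<Longrightarrow> linear_op T"
  by (simp add: psd_operator_def bounded_operator_def linear_op_def)

lemma linear_op_closed: "linear_op T \<Longrightarrow> x \<in> carrier H \<Longrightarrow> T x \<in> carrier H"
  by (auto simp: linear_op_def)

lemma linear_op_minus:
  assumes "linear_op T" "x \<in> carrier H" "y \<in> carrier H"
  shows "T (x \<ominus> y) = T x \<ominus> T y"
proof -
  have cl: "T x \<in> carrier H" "T y \<in> carrier H" "T (x \<ominus> y) \<in> carrier H"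
    using assms by (auto simp: linear_op_closed)
  have "T ((x \<ominus> y) \<oplus> y) = T (x \<ominus> y) \<oplus> T y"
    using assms by (simp add: linear_op_def)
  moreover have "(x \<ominus> y) \<oplus> y = x"
    using assms by (simp add: M.minus_eq M.a_assoc M.l_neg)
  ultimately show ?thesis
    using cl by (simp add: M.add.inv_solve_right M.minus_eq)
qed

text \<open>Polarization: \<open>psd_operator\<close> only constrains the quadratic form, but over
  the complex numbers a form that is real on the diagonal is Hermitian. The vector
  \<open>x + y\<close> compares the imaginary parts and \<open>x + i y\<close> the real
  parts.\<close>

lemma psd_hermitian:
  assumes T: "psd_operator H T" and x: "x \<in> carrier H" and y: "y \<in> carrier H"
  shows "ip (T x) y = ip x (T y)"
proof -
  have lin: "linear_op T" using T by (rule psd_imp_linear_op)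
  note cl = linear_op_closed[OF lin]
  have real: "Im (ip z (T z)) = 0" if "z \<in> carrier H" for z
    using T that by (auto simp: psd_operator_def complex_nonneg_Reals_iff)
  have "ip (x \<oplus> y) (T (x \<oplus> y)) = ip x (T x) + ip x (T y) + ip y (T x) + ip y (T y)"
    using lin x y cl by (simp add: linear_op_def ip_add_left inner_prod_add)
  then have 1: "Im (ip x (T y)) + Im (ip y (T x)) = 0"
    using real[of "x \<oplus> y"] real x y by simp
  have "ip (x \<oplus> \<i> \<odot> y) (T (x \<oplus> \<i> \<odot> y))
      = ip x (T x) + \<i> * ip x (T y) - \<i> * ip y (T x) + ip y (T y)"
    using lin x y cl
    by (simp add: linear_op_def ip_add_left inner_prod_add ip_smult_left inner_prod_smult algebra_simps)
  then have 2: "Re (ip x (T y)) - Re (ip y (T x)) = 0"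
    using real[of "x \<oplus> \<i> \<odot> y"] real x y by simp
  have "ip (T x) y = cnj (ip y (T x))" using x y cl by (metis inner_prod_cnj)
  then show ?thesis using 1 2 by (simp add: complex_eq_iff)
qed

text \<open>Discriminant argument for the semidefinite form given by \<open>T\<close>. The quadratic
  expression in \<open>t\<close> is minimized at \<open>t = - cnj b / c\<close>. The identity
  operator gives the usual inequality.\<close>

lemma psd_cauchy_schwarz:
  assumes T: "psd_operator H T" and x: "x \<in> carrier H" and y: "y \<in> carrier H"
  shows "(cmod (ip x (T y)))\<^sup>2 \<le> Re (ip x (T x)) * Re (ip y (T y))"
proof -
  have lin: "linear_op T" using T by (rule psd_imp_linear_op)
  note cl = linear_op_closed[OF lin]
  define a b c where "a = Re (ip x (T x))" and "b = ip x (T y)" and "c = Re (ip y (T y))"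
  have nn: "0 \<le> Re (ip z (T z))" if "z \<in> carrier H" for z
    using T that by (auto simp: psd_operator_def complex_nonneg_Reals_iff)
  have yx: "ip y (T x) = cnj b"
    unfolding b_def by (metis T cl inner_prod_cnj psd_hermitian x y)
  have q: "0 \<le> a + 2 * Re (t * b) + (cmod t)\<^sup>2 * c" for t
  proof -
    have "ip (x \<oplus> t \<odot> y) (T (x \<oplus> t \<odot> y))
      = ip x (T x) + t * b + cnj (t * b) + (t * cnj t) * ip y (T y)"
      using lin x y cl yx
      by (simp add: linear_op_def ip_add_left inner_prod_add ip_smult_left inner_prod_smult
        b_def[symmetric] algebra_simps)
    then have "Re (ip (x \<oplus> t \<odot> y) (T (x \<oplus> t \<odot> y))) = a + 2 * Re (t * b) + (cmod t)\<^sup>2 * c"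
      by (simp add: a_def c_def complex_norm_square[symmetric])
    then show ?thesis using nn[of "x \<oplus> t \<odot> y"] x y by simp
  qed
  show ?thesis
  proof (cases "c = 0")
    case True
    have "2 * s * (cmod b)\<^sup>2 \<le> a" for s :: real
      using q[of "- of_real s * cnj b"] True
      by (simp add: complex_norm_square[symmetric] mult.assoc mult.commute[of "cnj b"])
    \<comment> \<open>For \<open>c = 0\<close> the bound is linear in \<open>s\<close>. If
      \<open>b\<close> were nonzero, this value of \<open>s\<close> would turn it into
      \<open>a + 1 \<le> a\<close>.\<close>
    from this[of "(a + 1) / (2 * (cmod b)\<^sup>2)"] have "b = 0"
      by (cases "b = 0") (auto simp: field_simps)
    then show ?thesis using True by (simp add: b_def[symmetric] c_def[symmetric])
  next
    case False
    then have c: "c > 0" using nn[OF y] by (simp add: c_def)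
    have "0 \<le> a - (cmod b)\<^sup>2 / c"
      using q[of "- cnj b / of_real c"] c
      by (simp add: complex_norm_square[symmetric] mult.commute[of "cnj b"] norm_divide power_divide
        power2_eq_square[of c])
    then show ?thesis
      using c by (simp add: a_def[symmetric] b_def[symmetric] c_def[symmetric] field_simps)
  qed
qed

lemma psd_id: "psd_operator H (\<lambda>x. x)"
  unfolding psd_operator_def bounded_operator_def
  by (auto simp: complex_nonneg_Reals_iff ip_self_nonneg intro!: exI[of _ 1]) (metis ip_self Im_complex_of_real)

lemma cauchy_schwarz:
  assumes x: "x \<in> carrier H" and y: "y \<in> carrier H"
  shows "cmod (ip x y) \<le> hilbert_norm H x * hilbert_norm H y"
  using psd_cauchy_schwarz[OF psd_id x y]
  by (simp add: hilbert_norm_def real_le_rsqrt real_sqrt_mult[symmetric])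

text \<open>Cauchy-Schwarz for the form of \<open>T\<close>, with \<open>T x\<close> against
  \<open>x\<close>, bounds the inner product of \<open>T x\<close> with itself by a multiple of the
  vanishing one.\<close>

lemma psd_ip_eq_0:
  assumes T: "psd_operator H T" and x: "x \<in> carrier H" and "ip x (T x) = 0"
  shows "T x = \<zero>"
proof -
  have c: "T x \<in> carrier H" using T x linear_op_closed psd_imp_linear_op by blast
  have "ip (T x) (T x) = 0"
    using psd_cauchy_schwarz[OF T c x] assms(3) by simp
  then show ?thesis using c ip_self_eq_0 by blast
qed

end

section \<open>Separable Hilbert spaces in the type of the continuum\<close>

definition cscale :: "complex \<Rightarrow> continuum \<Rightarrow> continuum" where
  "cscale c f = (\<lambda>n. c * f n)"

text \<open>With the pointwise operations of the function type as vector operations,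
  \<open>+\<close>, \<open>-\<close> and \<open>sum\<close> replace the record operations in all
  later calculations.\<close>

locale continuum_hilbert = hilbert_space H for H :: "continuum hilbert" (structure) +
  assumes zero_H: "\<zero> = 0" and add_H: "add H = (+)" and smult_H: "Module.smult H = cscale"

text \<open>Vectors are their own coefficients with respect to \<open>d\<close>, and \<open>d\<close> runs through the words in the
  \<open>M\<close> and \<open>N\<close> applied to \<open>\<psi>\<close>.\<close>

locale cyclic_model = continuum_hilbert H for H :: "continuum hilbert" (structure) +
  fixes V :: "'a set" and W :: "'b set" and \<psi> :: continuum
    and M N :: "'a \<Rightarrow> 'b \<Rightarrow> continuum \<Rightarrow> continuum" and d :: "nat \<Rightarrow> continuum"
  assumes finite_V: "finite V" and finite_W: "finite W"
    and psi_closed: "\<psi> \<in> carrier H" and psi_norm: "hilbert_norm H \<psi> = 1"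
    and povm_M: "g \<in> V \<Longrightarrow> povm H W (M g)" and povm_N: "g \<in> V \<Longrightarrow> povm H W (N g)"
    and MN_commute: "\<lbrakk>g \<in> V; h \<in> W; g' \<in> V; h' \<in> W; x \<in> carrier H\<rbrakk> \<Longrightarrow>
      M g h (N g' h' x) = N g' h' (M g h x)"
    and d_closed: "d n \<in> carrier H"
    and reproducing: "x \<in> carrier H \<Longrightarrow> ip (d n) x = x n"
    and cyclic: "\<lbrakk>P \<psi>;
      \<And>g h x. \<lbrakk>g \<in> V; h \<in> W; x \<in> carrier H; P x\<rbrakk> \<Longrightarrow> P (M g h x);
      \<And>g h x. \<lbrakk>g \<in> V; h \<in> W; x \<in> carrier H; P x\<rbrakk> \<Longrightarrow> P (N g h x)\<rbrakk> \<Longrightarrow> P (d n)"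

section \<open>Coordinates with respect to a sequence of vectors\<close>

locale vector_sequence = hilbert_space H for H :: "'h hilbert" (structure) +
  fixes d :: "nat \<Rightarrow> 'h"
  assumes d_in_carrier: "d n \<in> carrier H"
begin

text \<open>The double orthogonal complement replaces the closed linear span of the sequence.\<close>

definition biperp :: "'h set" where
  "biperp = {x \<in> carrier H. \<forall>y\<in>carrier H. (\<forall>n. ip (d n) y = 0) \<longrightarrow> ip y x = 0}"

definition coord :: "'h \<Rightarrow> continuum" where
  "coord x = (\<lambda>n. ip (d n) x)"

definition of_coord :: "continuum \<Rightarrow> 'h" where
  "of_coord = inv_into biperp coord"

text \<open>The inner product is carried over through \<open>of_coord\<close> and not computed from
  the coordinates: \<open>d\<close> is an arbitrary sequence and not orthonormal, so no formula in
  the coordinates is at hand.\<close>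

definition model :: "continuum hilbert" where
  "model = \<lparr>carrier = coord ` biperp, monoid.mult = (\<lambda>x y. x), one = 0, zero = 0, add = (+),
    module.smult = cscale, inner_prod = (\<lambda>x y. ip (of_coord x) (of_coord y))\<rparr>"

lemma model_simps [simp]:
  "carrier model = coord ` biperp" "\<zero>\<^bsub>model\<^esub> = 0" "add model = (+)" "Module.smult model = cscale"
  by (simp_all add: model_def)

lemma biperp_carrier: "x \<in> biperp \<Longrightarrow> x \<in> carrier H"
  by (simp add: biperp_def)

lemma biperp_add: "x \<in> biperp \<Longrightarrow> y \<in> biperp \<Longrightarrow> x \<oplus> y \<in> biperp"
  by (auto simp: biperp_def inner_prod_add)

lemma biperp_minus: "x \<in> biperp \<Longrightarrow> y \<in> biperp \<Longrightarrow> x \<ominus> y \<in> biperp"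
  by (auto simp: biperp_def ip_minus_right)

lemma biperp_smult: "x \<in> biperp \<Longrightarrow> c \<odot> x \<in> biperp"
  by (auto simp: biperp_def inner_prod_smult)

lemma biperp_zero: "\<zero> \<in> biperp"
  by (auto simp: biperp_def)

lemma biperp_d: "d n \<in> biperp"
  using d_in_carrier by (auto simp: biperp_def) (metis complex_cnj_zero inner_prod_cnj)

lemma coord_add: "x \<in> carrier H \<Longrightarrow> y \<in> carrier H \<Longrightarrow> coord (x \<oplus> y) = coord x + coord y"
  using d_in_carrier by (simp add: coord_def inner_prod_add fun_eq_iff)

lemma coord_minus: "x \<in> carrier H \<Longrightarrow> y \<in> carrier H \<Longrightarrow> coord (x \<ominus> y) = coord x - coord y"
  using d_in_carrier by (simp add: coord_def ip_minus_right fun_eq_iff)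

lemma coord_smult: "x \<in> carrier H \<Longrightarrow> coord (c \<odot> x) = cscale c (coord x)"
  using d_in_carrier by (simp add: coord_def inner_prod_smult fun_eq_iff cscale_def)

lemma coord_zero: "coord \<zero> = 0"
  using d_in_carrier by (simp add: coord_def fun_eq_iff)

text \<open>The difference of two vectors with equal coordinates is orthogonal to the sequence and
  lies in its double complement, hence is orthogonal to itself.\<close>

lemma inj_on_coord: "inj_on coord biperp"
proof (rule inj_onI)
  fix x y assume x: "x \<in> biperp" and y: "y \<in> biperp" and eq: "coord x = coord y"
  have c: "x \<ominus> y \<in> biperp" "x \<ominus> y \<in> carrier H"
    using x y by (auto simp: biperp_minus biperp_carrier)
  have "ip (d n) (x \<ominus> y) = 0" for n
    using eq x y coord_minus[of x y]
    by (simp add: biperp_carrier coord_def fun_eq_iff ip_minus_right d_in_carrier)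
  then have "ip (x \<ominus> y) (x \<ominus> y) = 0"
    using c by (auto simp: biperp_def)
  then have "x \<ominus> y = \<zero>"
    using c(2) ip_self_eq_0 by blast
  moreover have "x = (x \<ominus> y) \<oplus> y"
    using x y by (simp add: biperp_carrier M.minus_eq M.a_assoc M.l_neg)
  ultimately show "x = y"
    using y by (simp add: biperp_carrier)
qed

lemma of_coord_coord [simp]: "x \<in> biperp \<Longrightarrow> of_coord (coord x) = x"
  by (simp add: of_coord_def inj_on_coord)

lemma ip_model [simp]: "x \<in> biperp \<Longrightarrow> y \<in> biperp \<Longrightarrow> inner_prod model (coord x) (coord y) = ip x y"
  by (simp add: model_def)

lemma norm_model [simp]: "x \<in> biperp \<Longrightarrow> hilbert_norm model (coord x) = hilbert_norm H x"
  by (simp add: hilbert_norm_def)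

lemma abelian_group_model: "abelian_group model"
proof (rule abelian_groupI)
  show "\<exists>y\<in>carrier model. y \<oplus>\<^bsub>model\<^esub> x = \<zero>\<^bsub>model\<^esub>" if x: "x \<in> carrier model" for x
  proof -
    obtain x' where x': "x = coord x'" "x' \<in> biperp" using x by auto
    have "coord (\<zero> \<ominus> x') + x = 0"
      using x' by (simp add: coord_minus biperp_carrier coord_zero)
    moreover have "coord (\<zero> \<ominus> x') \<in> carrier model"
      using x' by (simp add: biperp_minus biperp_zero)
    ultimately show ?thesis by auto
  qed
  show "x \<oplus>\<^bsub>model\<^esub> y \<in> carrier model" if "x \<in> carrier model" "y \<in> carrier model" for x y
    using that by (auto simp: coord_add[symmetric] biperp_carrier intro!: imageI biperp_add)
  show "\<zero>\<^bsub>model\<^esub> \<in> carrier model"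
    using coord_zero biperp_zero by (metis imageI model_simps(1,2))
qed (simp_all add: algebra_simps)

lemma minus_model:
  assumes "x \<in> biperp" "y \<in> biperp"
  shows "coord x \<ominus>\<^bsub>model\<^esub> coord y = coord (x \<ominus> y)"
proof -
  interpret m: abelian_group model by (rule abelian_group_model)
  have "coord (x \<ominus> y) \<oplus>\<^bsub>model\<^esub> coord y = coord x"
    using assms by (simp add: coord_minus biperp_carrier)
  moreover have "coord (x \<ominus> y) \<in> carrier model" "coord x \<in> carrier model" "coord y \<in> carrier model"
    using assms biperp_minus by auto
  ultimately show ?thesis
    by (metis m.add.inv_solve_right m.minus_eq)
qed

lemma module_model: "Module.module complex_ring model"
proof (rule moduleI)
  show "cring complex_ring" ..
  show "abelian_group model" by (rule abelian_group_model)
  show "a \<odot>\<^bsub>model\<^esub> x \<in> carrier model" if "x \<in> carrier model" for a x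
    using that by (auto simp: coord_smult[symmetric] biperp_carrier intro!: imageI biperp_smult)
qed (simp_all add: cscale_def fun_eq_iff algebra_simps)

text \<open>\<open>biperp\<close> is cut out by equations \<open>ip y x = 0\<close>, which pass to
  norm limits by Cauchy-Schwarz. Completeness of \<open>model\<close> rests on this.\<close>

lemma biperp_closed:
  assumes s: "\<And>n. s n \<in> biperp" and x: "x \<in> carrier H"
    and lim: "(\<lambda>n. hilbert_norm H (s n \<ominus> x)) \<longlonglongrightarrow> 0"
  shows "x \<in> biperp"
  unfolding biperp_def
proof (safe intro!: x)
  fix y assume y: "y \<in> carrier H" and 0: "\<forall>n. ip (d n) y = 0"
  have bound: "cmod (ip y x) \<le> hilbert_norm H y * hilbert_norm H (s n \<ominus> x)" for n
  proof -
    have "ip y (s n) = 0" using s y 0 by (auto simp: biperp_def)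
    then have "cmod (ip y x) = cmod (ip y (s n \<ominus> x))"
      using x y s biperp_carrier by (simp add: ip_minus_right)
    also have "\<dots> \<le> hilbert_norm H y * hilbert_norm H (s n \<ominus> x)"
      using x y s biperp_carrier by (intro cauchy_schwarz) auto
    finally show ?thesis .
  qed
  have "(\<lambda>n. hilbert_norm H y * hilbert_norm H (s n \<ominus> x)) \<longlonglongrightarrow> hilbert_norm H y * 0"
    by (intro tendsto_intros lim)
  then have "cmod (ip y x) \<le> hilbert_norm H y * 0"
    by (rule LIMSEQ_le_const) (use bound in auto)
  then show "ip y x = 0" by simp
qed

lemma complete_model: "complete_wrt (carrier model) (\<lambda>x y. hilbert_norm model (x \<ominus>\<^bsub>model\<^esub> y))"
  unfolding complete_wrt_def
proof (intro allI impI)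
  fix s :: "nat \<Rightarrow> continuum"
  assume ran: "range s \<subseteq> carrier model"
    and cau: "\<forall>e>0. \<exists>K. \<forall>m\<ge>K. \<forall>n\<ge>K. hilbert_norm model (s m \<ominus>\<^bsub>model\<^esub> s n) < e"
  define t where "t n = of_coord (s n)" for n
  have t: "t n \<in> biperp \<and> s n = coord (t n)" for n
  proof -
    have "s n \<in> coord ` biperp" using ran by auto
    then show ?thesis by (auto simp: t_def)
  qed
  have "\<forall>e>0. \<exists>K. \<forall>m\<ge>K. \<forall>n\<ge>K. hilbert_norm H (t m \<ominus> t n) < e"
    using cau t by (simp add: minus_model biperp_minus)
  moreover have "range t \<subseteq> carrier H" using t biperp_carrier by auto
  ultimately obtain x where x: "x \<in> carrier H" "(\<lambda>n. hilbert_norm H (t n \<ominus> x)) \<longlonglongrightarrow> 0"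
    using hilbert_complete unfolding complete_wrt_def by blast
  have "x \<in> biperp" using biperp_closed t x by blast
  then show "\<exists>x\<in>carrier model. (\<lambda>n. hilbert_norm model (s n \<ominus>\<^bsub>model\<^esub> x)) \<longlonglongrightarrow> 0"
    using x t by (intro bexI[of _ "coord x"]) (simp_all add: minus_model biperp_minus)
qed

lemma hilbert_space_model: "hilbert_space model"
proof (intro hilbert_space.intro hilbert_space_axioms.intro module_model complete_model)
  fix x y z c
  assume "x \<in> carrier model"
  then obtain x' where x: "x = coord x'" "x' \<in> biperp" by auto
  show "0 < Re (inner_prod model x x)" if "x \<noteq> \<zero>\<^bsub>model\<^esub>"
    using that x by (auto simp: biperp_carrier coord_zero intro!: inner_prod_pos)
  assume "y \<in> carrier model"
  then obtain y' where y: "y = coord y'" "y' \<in> biperp" by auto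
  show "inner_prod model x (c \<odot>\<^bsub>model\<^esub> y) = c * inner_prod model x y"
    using x y by (simp add: coord_smult[symmetric] biperp_carrier biperp_smult inner_prod_smult)
  show "inner_prod model y x = cnj (inner_prod model x y)"
    using x y by (simp add: biperp_carrier inner_prod_cnj[of x' y'])
  assume "z \<in> carrier model"
  then obtain z' where z: "z = coord z'" "z' \<in> biperp" by auto
  show "inner_prod model x (y \<oplus>\<^bsub>model\<^esub> z) = inner_prod model x y + inner_prod model x z"
    using x y z by (simp add: coord_add[symmetric] biperp_carrier biperp_add inner_prod_add)
qed

lemma continuum_hilbert_model: "continuum_hilbert model"
  by (intro continuum_hilbert.intro continuum_hilbert_axioms.intro hilbert_space_model) simp_all

definition compress :: "('h \<Rightarrow> 'h) \<Rightarrow> continuum \<Rightarrow> continuum" where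
  "compress T x = coord (T (of_coord x))"

text \<open>A Hermitian operator that maps the sequence into itself preserves the orthogonal
  complement of the sequence, hence also the double complement. On \<open>biperp\<close> the
  operator \<open>compress T\<close> is therefore a restriction of \<open>T\<close>.\<close>

lemma psd_biperp:
  assumes T: "psd_operator H T" and inv: "\<And>n. \<exists>m. T (d n) = d m" and x: "x \<in> biperp"
  shows "T x \<in> biperp"
  unfolding biperp_def
proof (safe)
  note lin = psd_imp_linear_op[OF T]
  show "T x \<in> carrier H" using lin x biperp_carrier linear_op_closed by blast
  fix y assume y: "y \<in> carrier H" and 0: "\<forall>n. ip (d n) y = 0"
  have "ip (d n) (T y) = 0" for n
    using inv[of n] 0 y psd_hermitian[OF T d_in_carrier y, of n] by auto
  then have "ip (T y) x = 0"
    using x linear_op_closed[OF lin y] unfolding biperp_def by blast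
  then show "ip y (T x) = 0"
    using psd_hermitian[OF T y] x biperp_carrier by auto
qed

lemma compress_coord [simp]: "x \<in> biperp \<Longrightarrow> compress T (coord x) = coord (T x)"
  by (simp add: compress_def)

lemma psd_compress:
  assumes T: "psd_operator H T" and inv: "\<And>n. \<exists>m. T (d n) = d m"
  shows "psd_operator model (compress T)"
proof -
  note h = psd_biperp[OF T inv]
  obtain B where B: "\<And>x. x \<in> carrier H \<Longrightarrow> hilbert_norm H (T x) \<le> B * hilbert_norm H x"
    using T unfolding psd_operator_def bounded_operator_def by blast
  note lin = psd_imp_linear_op[OF T]
  have 1: "compress T \<in> carrier model \<rightarrow> carrier model" using h by auto
  have 2: "\<forall>x\<in>carrier model. \<forall>y\<in>carrier model.
      compress T (x \<oplus>\<^bsub>model\<^esub> y) = compress T x \<oplus>\<^bsub>model\<^esub> compress T y"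
    using lin by (auto simp: coord_add[symmetric] biperp_add biperp_carrier h linear_op_def Pi_iff)
  have 3: "\<forall>c. \<forall>x\<in>carrier model. compress T (c \<odot>\<^bsub>model\<^esub> x) = c \<odot>\<^bsub>model\<^esub> compress T x"
    using lin by (auto simp: coord_smult[symmetric] biperp_smult biperp_carrier h linear_op_def Pi_iff)
  have 4: "\<forall>x\<in>carrier model. hilbert_norm model (compress T x) \<le> B * hilbert_norm model x"
    using B by (auto simp: h biperp_carrier)
  have 5: "\<forall>x\<in>carrier model. inner_prod model x (compress T x) \<in> \<real>\<^sub>\<ge>\<^sub>0"
    using T by (auto simp: h biperp_carrier psd_operator_def)
  show ?thesis
    unfolding psd_operator_def bounded_operator_def using 1 2 3 4 5 by blast
qed

lemma finsum_coord:
  assumes "finite S" "\<And>i. i \<in> S \<Longrightarrow> f i \<in> biperp"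
  shows "finsum model (\<lambda>i. coord (f i)) S = coord (finsum H f S) \<and> finsum H f S \<in> biperp"
  using assms
proof (induction S rule: finite_induct)
  interpret m: abelian_group model by (rule abelian_group_model)
  {
    case empty
    then show ?case by (simp add: coord_zero biperp_zero)
  next
    case (insert i S)
    then have f: "f \<in> S \<rightarrow> carrier H" "f i \<in> carrier H" "(\<lambda>i. coord (f i)) \<in> S \<rightarrow> carrier model"
       "coord (f i) \<in> carrier model"
      by (auto simp: biperp_carrier)
    have "finsum H f (insert i S) = f i \<oplus> finsum H f S"
      using insert f by simp
    moreover have "finsum model (\<lambda>i. coord (f i)) (insert i S) = coord (f i) + coord (finsum H f S)"
      using insert f by (subst m.finsum_insert) auto
    ultimately show ?case using insert f by (auto simp: coord_add biperp_add biperp_carrier)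
  }
qed

lemma povm_compress:
  assumes M: "povm H W M" and inv: "\<And>h n. h \<in> W \<Longrightarrow> \<exists>m. M h (d n) = d m" and W: "finite W"
  shows "povm model W (\<lambda>h. compress (M h))"
  unfolding povm_def
proof (intro conjI ballI)
  show "psd_operator model (compress (M h))" if "h \<in> W" for h
    using M that by (intro psd_compress inv) (simp_all add: povm_def)
  fix x assume "x \<in> carrier model"
  then obtain x' where x: "x = coord x'" "x' \<in> biperp" by auto
  have biperp: "M h x' \<in> biperp" if "h \<in> W" for h
    using M that x(2) by (intro psd_biperp[of "M h" x'] inv) (simp_all add: povm_def)
  have "finsum model (\<lambda>h. compress (M h) x) W = finsum model (\<lambda>h. coord (M h x')) W"
    using x by simp
  also have "\<dots> = coord (finsum H (\<lambda>h. M h x') W)"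
    using finsum_coord[OF W biperp] by simp
  also have "\<dots> = x" using M x biperp_carrier by (simp add: povm_def)
  finally show "finsum model (\<lambda>h. compress (M h) x) W = x" .
qed

end

section \<open>Words in the measurement operators and the cyclic model\<close>

fun word_op :: "('i \<Rightarrow> 'h \<Rightarrow> 'h) \<Rightarrow> 'i list \<Rightarrow> 'h \<Rightarrow> 'h" where
  "word_op T [] x = x"
| "word_op T (i # is) x = T i (word_op T is x)"

text \<open>Finitely many operators have only countably many words. The images of \<psi> under these
  words form a sequence that contains \<psi> and is invariant under every measurement operator, so
  the whole configuration restricts to its \<open>biperp\<close>.\<close>

lemma (in hilbert_space) cyclic_model_exists:
  fixes V :: "'a set" and W :: "'b set"
  assumes V: "finite V" and W: "finite W"
    and psi: "\<psi> \<in> carrier H" "hilbert_norm H \<psi> = 1"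
    and M: "\<And>g. g \<in> V \<Longrightarrow> povm H W (M g)" and N: "\<And>g. g \<in> V \<Longrightarrow> povm H W (N g)"
    and comm: "\<And>g h g' h' x. \<lbrakk>g \<in> V; h \<in> W; g' \<in> V; h' \<in> W; x \<in> carrier H\<rbrakk> \<Longrightarrow>
      M g h (N g' h' x) = N g' h' (M g h x)"
  obtains H' :: "continuum hilbert" and \<psi>' M' N' d'
  where "cyclic_model H' V W \<psi>' M' N' d'"
    and "\<And>g h g' h'. \<lbrakk>g \<in> V; h \<in> W; g' \<in> V; h' \<in> W\<rbrakk> \<Longrightarrow>
      inner_prod H' \<psi>' (M' g h (N' g' h' \<psi>')) = ip \<psi> (M g h (N g' h' \<psi>))"
proof -
  \<comment> \<open>The Boolean tag unites both families, so that one word can mix \<open>M\<close>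
    and \<open>N\<close>.\<close>
  define T where "T = (\<lambda>(b, g, h). if b then M g h else N g h)"
  define I where "I = (UNIV :: bool set) \<times> V \<times> W"
  define D where "D = (\<lambda>w. word_op T w \<psi>) ` lists I"
  define d where "d = from_nat_into D"
  have psdM: "psd_operator H (M g h)" and psdN: "psd_operator H (N g h)" if "g \<in> V" "h \<in> W" for g h
    using M N that by (auto simp: povm_def)
  have psdT: "psd_operator H (T i)" if "i \<in> I" for i
    using that psdM psdN by (auto simp: T_def I_def)
  have Icount: "countable (lists I)"
    using V W by (intro countable_lists countable_finite) (auto simp: I_def)
  have D: "countable D" "D \<noteq> {}"
    using Icount by (auto simp: D_def)
  then have ranged: "range d = D" by (simp add: d_def)
  have word_closed: "word_op T w \<psi> \<in> carrier H" if "w \<in> lists I" for w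
    using that by (induction w) (auto simp: psi intro: linear_op_closed psd_imp_linear_op psdT)
  have psi_D: "\<psi> \<in> D" unfolding D_def by (rule image_eqI[of _ _ "[]"]) auto
  have T_D: "T i x \<in> D" if i: "i \<in> I" and x: "x \<in> D" for i x
  proof -
    obtain w where "x = word_op T w \<psi>" "w \<in> lists I" using x unfolding D_def by blast
    then show ?thesis using i unfolding D_def by (intro image_eqI[of _ _ "i # w"]) auto
  qed
  have D_carrier: "D \<subseteq> carrier H" using word_closed by (auto simp: D_def)
  interpret vs: vector_sequence H d
    by unfold_locales (use ranged D_carrier in auto)
  have invT: "\<exists>m. T i (d n) = d m" if "i \<in> I" for i n
    using T_D[OF that, of "d n"] ranged by auto
  have invM: "\<exists>m. M g h (d n) = d m" and invN: "\<exists>m. N g h (d n) = d m" if "g \<in> V" "h \<in> W" for g h n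
    using invT[of "(True, g, h)" n] invT[of "(False, g, h)" n] that by (auto simp: T_def I_def)
  have psi_biperp: "\<psi> \<in> vs.biperp" using psi_D vs.biperp_d unfolding ranged[symmetric] by auto
  have M_biperp: "M g h x \<in> vs.biperp" and N_biperp: "N g h x \<in> vs.biperp"
    if "g \<in> V" "h \<in> W" "x \<in> vs.biperp" for g h x
    using vs.psd_biperp[OF psdM[OF that(1,2)] invM[OF that(1,2)] that(3)]
      vs.psd_biperp[OF psdN[OF that(1,2)] invN[OF that(1,2)] that(3)] by simp_all
  define M' where "M' g h = vs.compress (M g h)" for g h
  define N' where "N' g h = vs.compress (N g h)" for g h
  interpret m: continuum_hilbert vs.model by (rule vs.continuum_hilbert_model)
  have "cyclic_model vs.model V W (vs.coord \<psi>) M' N' (\<lambda>n. vs.coord (d n))"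
  proof unfold_locales
    show "povm vs.model W (M' g)" if "g \<in> V" for g
      using vs.povm_compress[OF M[OF that] invM[OF that] W] by (simp add: M'_def[abs_def])
    show "povm vs.model W (N' g)" if "g \<in> V" for g
      using vs.povm_compress[OF N[OF that] invN[OF that] W] by (simp add: N'_def[abs_def])
    show "M' g h (N' g' h' x) = N' g' h' (M' g h x)"
      if "g \<in> V" "h \<in> W" "g' \<in> V" "h' \<in> W" "x \<in> carrier vs.model" for g h g' h' x
      using that by (auto simp: M'_def N'_def comm M_biperp N_biperp vs.biperp_carrier)
    show "inner_prod vs.model (vs.coord (d n)) x = x n" if x: "x \<in> carrier vs.model" for x n
    proof -
      obtain x' where "x = vs.coord x'" "x' \<in> vs.biperp" using x by auto
      then show ?thesis by (simp add: vs.biperp_d) (simp add: vs.coord_def)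
    qed
    show "P (vs.coord (d n))" if P: "P (vs.coord \<psi>)"
      "\<And>g h x. \<lbrakk>g \<in> V; h \<in> W; x \<in> carrier vs.model; P x\<rbrakk> \<Longrightarrow> P (M' g h x)"
      "\<And>g h x. \<lbrakk>g \<in> V; h \<in> W; x \<in> carrier vs.model; P x\<rbrakk> \<Longrightarrow> P (N' g h x)" for P n
    proof -
      \<comment> \<open>Membership in \<open>biperp\<close> is carried along because
        \<open>compress\<close> acts as the original operator only on coordinates of such
        vectors.\<close>
      have "word_op T w \<psi> \<in> vs.biperp \<and> P (vs.coord (word_op T w \<psi>))" if "w \<in> lists I" for w
        using that
      proof (induction w)
        case Nil
        show ?case using psi_biperp P by simp
      next
        case (Cons i w)
        obtain b g h where i: "i = (b, g, h)" "g \<in> V" "h \<in> W" using Cons by (auto simp: I_def)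
        then show ?case
          using Cons M_biperp[OF i(2,3), of "word_op T w \<psi>"] N_biperp[OF i(2,3), of "word_op T w \<psi>"]
            P(2)[OF i(2,3), of "vs.coord (word_op T w \<psi>)"]
            P(3)[OF i(2,3), of "vs.coord (word_op T w \<psi>)"]
          by (auto simp: T_def M'_def N'_def)
      qed
      moreover obtain w where "w \<in> lists I" "d n = word_op T w \<psi>"
        using ranged unfolding D_def by blast
      ultimately show ?thesis by simp
    qed
  qed (use V W psi psi_biperp vs.biperp_d in auto)
  moreover have "inner_prod vs.model (vs.coord \<psi>) (M' g h (N' g' h' (vs.coord \<psi>)))
      = ip \<psi> (M g h (N g' h' \<psi>))" if "g \<in> V" "h \<in> W" "g' \<in> V" "h' \<in> W" for g h g' h'
    using that by (simp add: M'_def N'_def psi_biperp M_biperp N_biperp)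
  ultimately show thesis by (rule that)
qed

section \<open>Synchronous correlations\<close>

context continuum_hilbert
begin

lemma zero_in [simp]: "0 \<in> carrier H"
  using M.zero_closed by (simp add: zero_H)

lemma add_in [simp]: "x \<in> carrier H \<Longrightarrow> y \<in> carrier H \<Longrightarrow> x + y \<in> carrier H"
  using M.a_closed[of x y] by (simp add: add_H)

lemma cscale_in [simp]: "x \<in> carrier H \<Longrightarrow> cscale c x \<in> carrier H"
  using smult_in_carrier[of x c] by (simp add: smult_H)

lemma minus_eq_diff: "x \<in> carrier H \<Longrightarrow> y \<in> carrier H \<Longrightarrow> x \<ominus> y = x - y"
proof -
  assume a: "x \<in> carrier H" "y \<in> carrier H"
  then have "(x \<ominus> y) \<oplus> y = x" by (simp add: M.minus_eq M.a_assoc M.l_neg)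
  then have "(x \<ominus> y) + y = x" by (simp add: add_H)
  then show ?thesis by (metis add_diff_cancel_right')
qed

lemma diff_in [simp]: "x \<in> carrier H \<Longrightarrow> y \<in> carrier H \<Longrightarrow> x - y \<in> carrier H"
  using M.minus_closed[of x y] by (simp add: minus_eq_diff)

lemma sum_in [simp]: "(\<And>i. i \<in> S \<Longrightarrow> f i \<in> carrier H) \<Longrightarrow> sum f S \<in> carrier H"
  by (induction S rule: infinite_finite_induct) auto

lemma finsum_eq_sum:
  "finite S \<Longrightarrow> (\<And>i. i \<in> S \<Longrightarrow> f i \<in> carrier H) \<Longrightarrow> finsum H f S = sum f S"
proof (induction S rule: finite_induct)
  case empty
  show ?case by (simp add: zero_H)
next
  case (insert i S)
  then have "finsum H f (insert i S) = f i \<oplus> finsum H f S"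
    by (intro M.finsum_insert) auto
  then show ?case using insert by (simp add: add_H)
qed

lemma ip_add [simp]:
  "\<lbrakk>x \<in> carrier H; y \<in> carrier H; z \<in> carrier H\<rbrakk> \<Longrightarrow> ip x (y + z) = ip x y + ip x z"
  "\<lbrakk>x \<in> carrier H; y \<in> carrier H; z \<in> carrier H\<rbrakk> \<Longrightarrow> ip (x + y) z = ip x z + ip y z"
  using inner_prod_add[of x y z] ip_add_left[of x y z] by (simp_all add: add_H)

lemma ip_diff [simp]:
  "\<lbrakk>x \<in> carrier H; y \<in> carrier H; z \<in> carrier H\<rbrakk> \<Longrightarrow> ip x (y - z) = ip x y - ip x z"
  "\<lbrakk>x \<in> carrier H; y \<in> carrier H; z \<in> carrier H\<rbrakk> \<Longrightarrow> ip (x - y) z = ip x z - ip y z"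
  using ip_minus_right[of x y z] ip_minus_left[of z x y] by (simp_all add: minus_eq_diff)

lemma ip_cscale [simp]:
  "\<lbrakk>x \<in> carrier H; y \<in> carrier H\<rbrakk> \<Longrightarrow> ip x (cscale c y) = c * ip x y"
  "\<lbrakk>x \<in> carrier H; y \<in> carrier H\<rbrakk> \<Longrightarrow> ip (cscale c x) y = cnj c * ip x y"
  using inner_prod_smult[of x y c] ip_smult_left[of x y c] by (simp_all add: smult_H)

lemma ip_zero [simp]:
  "x \<in> carrier H \<Longrightarrow> ip x 0 = 0" "x \<in> carrier H \<Longrightarrow> ip 0 x = 0"
  using ip_zero_right[of x] ip_zero_left[of x] by (simp_all add: zero_H)

lemma ip_sum_right:
  "x \<in> carrier H \<Longrightarrow> (\<And>i. i \<in> S \<Longrightarrow> f i \<in> carrier H) \<Longrightarrow> ip x (sum f S) = (\<Sum>i\<in>S. ip x (f i))"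
  by (induction S rule: infinite_finite_induct) auto

lemma ip_sum_left:
  "x \<in> carrier H \<Longrightarrow> (\<And>i. i \<in> S \<Longrightarrow> f i \<in> carrier H) \<Longrightarrow> ip (sum f S) x = (\<Sum>i\<in>S. ip (f i) x)"
  by (induction S rule: infinite_finite_induct) auto

lemma ip_self_zero: "x \<in> carrier H \<Longrightarrow> ip x x = 0 \<Longrightarrow> x = 0"
  using ip_self_eq_0 by (simp add: zero_H)

lemma ip_self_le_zero: "x \<in> carrier H \<Longrightarrow> Re (ip x x) \<le> 0 \<Longrightarrow> x = 0"
  using inner_prod_pos by (fastforce simp: zero_H)

lemma linear_opD:
  assumes "linear_op T"
  shows "x \<in> carrier H \<Longrightarrow> T x \<in> carrier H"
    and "x \<in> carrier H \<Longrightarrow> y \<in> carrier H \<Longrightarrow> T (x + y) = T x + T y"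
    and "x \<in> carrier H \<Longrightarrow> y \<in> carrier H \<Longrightarrow> T (x - y) = T x - T y"
    and "x \<in> carrier H \<Longrightarrow> T (cscale c x) = cscale c (T x)"
    and "T 0 = 0"
proof -
  show in': "x \<in> carrier H \<Longrightarrow> T x \<in> carrier H" for x
    by (rule linear_op_closed[OF assms])
  show "x \<in> carrier H \<Longrightarrow> y \<in> carrier H \<Longrightarrow> T (x + y) = T x + T y"
    using assms by (simp add: linear_op_def add_H)
  show diff: "x \<in> carrier H \<Longrightarrow> y \<in> carrier H \<Longrightarrow> T (x - y) = T x - T y" for x y
    using linear_op_minus[OF assms, of x y] in' by (simp add: minus_eq_diff)
  show "x \<in> carrier H \<Longrightarrow> T (cscale c x) = cscale c (T x)"
    using assms by (simp add: linear_op_def smult_H)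
  show "T 0 = 0" using diff[of 0 0] by simp
qed

lemma linear_op_sum:
  assumes "linear_op T" "\<And>i. i \<in> S \<Longrightarrow> f i \<in> carrier H"
  shows "T (sum f S) = (\<Sum>i\<in>S. T (f i))"
  using assms(2)
  by (induction S rule: infinite_finite_induct) (auto simp: linear_opD[OF assms(1)])

lemma psd_ip_nonneg: "psd_operator H T \<Longrightarrow> x \<in> carrier H \<Longrightarrow> 0 \<le> Re (ip x (T x))"
  by (auto simp: psd_operator_def complex_nonneg_Reals_iff)

lemma psd_ip_zero: "psd_operator H T \<Longrightarrow> x \<in> carrier H \<Longrightarrow> ip x (T x) = 0 \<Longrightarrow> T x = 0"
  using psd_ip_eq_0 by (simp add: zero_H)

section \<open>Estimates for a single measurement\<close>

context
  fixes W :: "'b set" and P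
  assumes W: "finite W" and P: "povm H W P"
begin

lemma povm_psd: "h \<in> W \<Longrightarrow> psd_operator H (P h)"
  using P by (simp add: povm_def)

lemma povm_linear: "h \<in> W \<Longrightarrow> linear_op (P h)"
  using povm_psd psd_imp_linear_op by blast

lemma povm_in: "h \<in> W \<Longrightarrow> x \<in> carrier H \<Longrightarrow> P h x \<in> carrier H"
  using povm_linear linear_opD by blast

lemma povm_sum: "x \<in> carrier H \<Longrightarrow> (\<Sum>h\<in>W. P h x) = x"
  using P W povm_in finsum_eq_sum[of W "\<lambda>h. P h x"] by (simp add: povm_def)

lemma povm_herm: "\<lbrakk>h \<in> W; x \<in> carrier H; y \<in> carrier H\<rbrakk> \<Longrightarrow> ip (P h x) y = ip x (P h y)"
  using psd_hermitian povm_psd by blast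

lemma povm_le:
  assumes "h \<in> W" "x \<in> carrier H"
  shows "Re (ip x (P h x)) \<le> Re (ip x x)"
proof -
  have "Re (ip x (P h x)) \<le> (\<Sum>h\<in>W. Re (ip x (P h x)))"
    using W assms by (intro member_le_sum) (auto intro: psd_ip_nonneg povm_psd)
  also have "\<dots> = Re (ip x (\<Sum>h\<in>W. P h x))"
    using assms by (simp add: ip_sum_right povm_in)
  finally show ?thesis using assms by (simp add: povm_sum)
qed

text \<open>An operator between 0 and 1 dominates its square: Cauchy-Schwarz for the form of
  \<open>P h\<close> with \<open>y = P h x\<close> against \<open>x\<close>, followed by
  \<open>povm_le\<close> at \<open>y\<close>, leaves one factor \<open>ip y y\<close> to
  cancel.\<close>

lemma povm_contraction:
  assumes h: "h \<in> W" and x: "x \<in> carrier H"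
  shows "Re (ip (P h x) (P h x)) \<le> Re (ip x (P h x))"
proof -
  let ?y = "P h x"
  have y: "?y \<in> carrier H" using h x povm_in by blast
  have "(cmod (ip ?y (P h x)))\<^sup>2 \<le> Re (ip ?y (P h ?y)) * Re (ip x (P h x))"
    using psd_cauchy_schwarz[OF povm_psd[OF h] y x] .
  also have "\<dots> \<le> Re (ip ?y ?y) * Re (ip x (P h x))"
    using povm_le[OF h y] psd_ip_nonneg[OF povm_psd[OF h] x] by (intro mult_right_mono)
  finally have "(Re (ip ?y ?y))\<^sup>2 \<le> Re (ip ?y ?y) * Re (ip x (P h x))"
    by (subst (asm) ip_self[OF y]) (simp add: power2_eq_square)
  then show ?thesis
    using ip_self_nonneg[OF y] psd_ip_nonneg[OF povm_psd[OF h] x]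
    by (cases "Re (ip ?y ?y) = 0") (auto simp: power2_eq_square)
qed

text \<open>In the case of equality the form of \<open>P h\<close> at \<open>y = x - P h x\<close>
  is at most 0, since its last term is bounded by \<open>povm_le\<close>. Positivity then forces
  \<open>P h y = 0\<close>.\<close>

lemma povm_idem:
  assumes h: "h \<in> W" and x: "x \<in> carrier H"
    and eq: "Re (ip (P h x) (P h x)) = Re (ip x (P h x))"
  shows "P h (P h x) = P h x"
proof -
  let ?y = "x - P h x"
  note lin = linear_opD[OF povm_linear[OF h]]
  have in': "P h x \<in> carrier H" "P h (P h x) \<in> carrier H" using h x povm_in by auto
  have "ip ?y (P h ?y) = ip x (P h x) - 2 * ip (P h x) (P h x) + ip (P h x) (P h (P h x))"
    using in' x h by (simp add: lin povm_herm)
  then have "Re (ip ?y (P h ?y)) \<le> 0"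
    using eq povm_le[OF h in'(1)] by simp
  moreover have y: "?y \<in> carrier H" using in' x by simp
  then have "ip ?y (P h ?y) \<in> \<real>\<^sub>\<ge>\<^sub>0"
    using povm_psd[OF h] unfolding psd_operator_def by blast
  ultimately have "ip ?y (P h ?y) = 0" by (auto simp: complex_nonneg_Reals_iff complex_eq_iff)
  then have "P h ?y = 0" using psd_ip_zero[OF povm_psd[OF h] y] by blast
  then show ?thesis using x in' by (simp add: lin)
qed

end

end

section \<open>Cyclic, separating and tracial vectors\<close>

locale synchronous_model = cyclic_model H V V \<psi> M N d
  for H :: "continuum hilbert" (structure) and V :: "'a set" and \<psi> M N d +
  assumes synchronous: "\<lbrakk>i \<in> V; l \<in> V; k \<in> V; l \<noteq> k\<rbrakk> \<Longrightarrow> ip \<psi> (M i l (N i k \<psi>)) = 0"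
begin

lemmas M_psd = povm_psd[OF finite_V povm_M]
  and M_linear = povm_linear[OF finite_V povm_M]
  and M_in [simp] = povm_in[OF finite_V povm_M]
  and M_herm = povm_herm[OF finite_V povm_M]
  and M_row = povm_sum[OF finite_V povm_M]
  and N_in [simp] = povm_in[OF finite_V povm_N]
  and N_herm = povm_herm[OF finite_V povm_N]
  and N_linear = povm_linear[OF finite_V povm_N]

lemmas M_lin [simp] = linear_opD(2-)[OF M_linear]
lemmas N_lin [simp] = linear_opD(2-)[OF N_linear]

declare psi_closed [simp]

text \<open>Equality in \<open>\<parallel>M \<psi>\<parallel>\<^sup>2 \<le> \<langle>\<psi>, M \<psi>\<rangle> = \<langle>M \<psi>, N \<psi>\<rangle>\<close> forces both claims.\<close>

lemma
  assumes i: "i \<in> V" and l: "l \<in> V"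
  shows N_psi: "N i l \<psi> = M i l \<psi>"
    and M_idem_psi: "M i l (M i l \<psi>) = M i l \<psi>"
proof -
  have orth: "ip (M i l' \<psi>) (N i k \<psi>) = 0" if "l' \<in> V" "k \<in> V" "l' \<noteq> k" for l' k
    using synchronous[OF i that] i that by (simp add: M_herm)
  let ?m = "M i l \<psi>" and ?n = "N i l \<psi>"
  have "ip ?m ?n = (\<Sum>k\<in>V. ip ?m (N i k \<psi>))"
    using finite_V l orth by (subst sum.remove[of _ l]) (auto intro!: sum.neutral)
  also have "\<dots> = ip ?m \<psi>"
    using i l by (simp add: ip_sum_right[symmetric] povm_sum[OF finite_V povm_N])
  finally have 1: "ip ?m ?n = ip \<psi> ?m" using i l by (simp add: M_herm)
  have "ip ?m ?n = (\<Sum>k\<in>V. ip (M i k \<psi>) ?n)"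
    using finite_V l orth by (subst sum.remove[of _ l]) (auto intro!: sum.neutral)
  also have "\<dots> = ip \<psi> ?n"
    using i l by (simp add: ip_sum_left[symmetric] M_row)
  finally have 2: "ip ?m ?n = ip \<psi> ?n" .
  have 3: "ip ?n ?m = ip ?m ?n"
    using i l by (simp add: N_herm M_herm MN_commute)
  have m: "Re (ip ?m ?m) \<le> Re (ip \<psi> ?m)" and n: "Re (ip ?n ?n) \<le> Re (ip \<psi> ?n)"
    using i l by (auto intro!: povm_contraction[OF finite_V] povm_M povm_N)
  have "ip (?n - ?m) (?n - ?m) = ip ?n ?n + ip ?m ?m - 2 * ip ?m ?n"
    using i l 3 by simp
  then have e: "Re (ip (?n - ?m) (?n - ?m)) = Re (ip ?n ?n) + Re (ip ?m ?m) - 2 * Re (ip ?m ?n)"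
    by simp
  then have "Re (ip (?n - ?m) (?n - ?m)) \<le> 0"
    using m n 1 2 by simp
  then have "?n - ?m = 0" using i l by (intro ip_self_le_zero) auto
  then show nm: "?n = ?m" by simp
  then have "Re (ip ?m ?m) = Re (ip \<psi> ?m)" using 1 by simp
  then show "M i l ?m = ?m" using i l by (intro povm_idem[OF finite_V povm_M]) auto
qed

text \<open>An \<open>M\<close> in front of a word in the \<open>N\<close> can be moved through to
  \<psi>, where it becomes an \<open>N\<close>. So words in the \<open>N\<close> alone reach every
  \<open>d n\<close>.\<close>

lemma N_cyclic:
  assumes psi: "P \<psi>" and N: "\<And>i l x. \<lbrakk>i \<in> V; l \<in> V; x \<in> carrier H; P x\<rbrakk> \<Longrightarrow> P (N i l x)"
  shows "P (d n)"
proof -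
  define T where "T = (\<lambda>(i, l). N i l)"
  have in': "word_op T w x \<in> carrier H" if "w \<in> lists (V \<times> V)" "x \<in> carrier H" for w x
    using that by (induction w) (auto simp: T_def)
  have M_word: "M i l (word_op T w x) = word_op T w (M i l x)"
    if "w \<in> lists (V \<times> V)" "x \<in> carrier H" "i \<in> V" "l \<in> V" for i l w x
    using that
  proof (induction w)
    case (Cons a w)
    then show ?case using MN_commute in' by (cases a) (auto simp: T_def)
  qed simp
  have app: "word_op T (w @ w') x = word_op T w (word_op T w' x)" for w w' and x :: continuum
    by (induction w) auto
  have "\<exists>w\<in>lists (V \<times> V). d n = word_op T w \<psi>"
  proof (rule cyclic[where P = "\<lambda>x. \<exists>w\<in>lists (V \<times> V). x = word_op T w \<psi>"])
    show "\<exists>w\<in>lists (V \<times> V). \<psi> = word_op T w \<psi>" by (rule bexI[of _ "[]"]) auto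
    fix i l x assume il: "i \<in> V" "l \<in> V" and "\<exists>w\<in>lists (V \<times> V). x = word_op T w \<psi>"
    then obtain w where w: "w \<in> lists (V \<times> V)" "x = word_op T w \<psi>" by blast
    have "M i l x = word_op T (w @ [(i, l)]) \<psi>"
      using il w by (simp add: M_word N_psi[symmetric] app) (simp add: T_def)
    then show "\<exists>w\<in>lists (V \<times> V). M i l x = word_op T w \<psi>"
      using il w by (intro bexI[of _ "w @ [(i, l)]"]) auto
    have "N i l x = word_op T ((i, l) # w) \<psi>" using w by (simp add: T_def)
    then show "\<exists>w\<in>lists (V \<times> V). N i l x = word_op T w \<psi>"
      using il w by (intro bexI[of _ "(i, l) # w"]) auto
  qed
  then obtain w where w: "w \<in> lists (V \<times> V)" "d n = word_op T w \<psi>" by blast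
  have "P (word_op T w \<psi>)" using w(1)
    by (induction w) (auto simp: psi T_def intro!: N in'[unfolded T_def])
  then show ?thesis using w by simp
qed

text \<open>A vector that is cyclic for a family separates the operators commuting with that family:
  \<open>S\<close> vanishes at each \<open>d n\<close>, and the coordinates of \<open>T x\<close>
  are its inner products with the \<open>d n\<close>. The adjoint pair is needed because products of
  several \<open>M\<close> are in general not self-adjoint.\<close>

lemma separating:
  assumes T: "\<And>x. x \<in> carrier H \<Longrightarrow> T x \<in> carrier H"
    and adj: "\<And>x y. x \<in> carrier H \<Longrightarrow> y \<in> carrier H \<Longrightarrow> ip (S x) y = ip x (T y)"
    and S: "S \<psi> = 0"
    and comm: "\<And>i l x. \<lbrakk>i \<in> V; l \<in> V; x \<in> carrier H\<rbrakk> \<Longrightarrow> S (N i l x) = N i l (S x)"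
    and x: "x \<in> carrier H"
  shows "T x = 0"
proof
  fix n
  have "S (d n) = 0"
    by (rule N_cyclic[where P = "\<lambda>x. S x = 0"]) (simp_all add: S comm)
  then have "ip (d n) (T x) = 0" using adj[OF d_closed x, of n] x by simp
  then show "T x n = 0 n" using reproducing T x by simp
qed

lemma M_idem:
  assumes il: "i \<in> V" "l \<in> V" and x: "x \<in> carrier H"
  shows "M i l (M i l x) = M i l x"
proof -
  have "M i l x - M i l (M i l x) = 0"
    by (rule separating[where S = "\<lambda>x. M i l x - M i l (M i l x)"
        and T = "\<lambda>x. M i l x - M i l (M i l x)"])
      (use il x in \<open>auto simp: M_herm M_idem_psi MN_commute\<close>)
  then show ?thesis by simp
qed

text \<open>At \<psi> the operator \<open>M i l\<close> can be replaced by \<open>N i l\<close>,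
  which passes \<open>T\<close>, moves to the left argument and becomes an \<open>M\<close> again.
  For \<open>T\<close> a product of \<open>M\<close> this is the trace property of the vector
  state.\<close>

lemma trace_M:
  assumes T: "T \<psi> \<in> carrier H" and il: "i \<in> V" "l \<in> V" and comm: "T (N i l \<psi>) = N i l (T \<psi>)"
  shows "ip \<psi> (T (M i l \<psi>)) = ip \<psi> (M i l (T \<psi>))"
proof -
  have "ip \<psi> (T (M i l \<psi>)) = ip (N i l \<psi>) (T \<psi>)"
    using assms by (simp add: N_psi[symmetric] N_herm)
  also have "\<dots> = ip \<psi> (M i l (T \<psi>))"
    using il T by (simp add: N_psi M_herm)
  finally show ?thesis .
qed

text \<open>By the trace property and idempotency the squared norm of
  \<open>M i l (M j k \<psi>)\<close> is the vanishing probability. The factors of the conclusion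
  appear in reverse order because \<open>separating\<close> kills the adjoint of the product that
  vanishes at \<psi>.\<close>

lemma M_orth:
  assumes V: "i \<in> V" "l \<in> V" "j \<in> V" "k \<in> V" and 0: "ip \<psi> (M i l (N j k \<psi>)) = 0"
    and x: "x \<in> carrier H"
  shows "M j k (M i l x) = 0"
proof (rule separating[where S = "\<lambda>x. M i l (M j k x)" and T = "\<lambda>x. M j k (M i l x)"])
  let ?y = "M i l (M j k \<psi>)"
  have "ip ?y ?y = ip \<psi> (M j k ?y)"
    using V by (simp add: M_herm M_idem)
  also have "\<dots> = ip \<psi> (M i l (M j k (M j k \<psi>)))"
    using V trace_M[of "\<lambda>x. M i l (M j k x)" j k] by (simp add: MN_commute)
  also have "\<dots> = 0" using V 0 by (simp add: M_idem N_psi)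
  finally show "?y = 0" using V by (intro ip_self_zero) auto
qed (use V x in \<open>auto simp: M_herm MN_commute\<close>)

lemma M_row_orth:
  assumes "i \<in> V" "l \<in> V" "k \<in> V" "l \<noteq> k" "x \<in> carrier H"
  shows "M i k (M i l x) = 0"
  using assms synchronous by (intro M_orth) auto

end

section \<open>Column sums\<close>

locale bisynchronous_model = synchronous_model +
  assumes bisynchronous: "\<lbrakk>i \<in> V; j \<in> V; l \<in> V; i \<noteq> j\<rbrakk> \<Longrightarrow> ip \<psi> (M i l (N j l \<psi>)) = 0"
begin

lemma M_col_orth:
  assumes "i \<in> V" "j \<in> V" "l \<in> V" "i \<noteq> j" "x \<in> carrier H"
  shows "M j l (M i l x) = 0"
  using assms bisynchronous by (intro M_orth) auto

text \<open>Column orthogonality makes each defect \<open>y l\<close> the image of \<open>x\<close>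
  under a projection. As the matrix is square and its rows sum to 1, the defects add up to 0; so do
  the nonnegative numbers \<open>ip x (y l) = ip (y l) (y l)\<close>, which must all vanish.\<close>

lemma M_col:
  assumes x: "x \<in> carrier H" and l: "l \<in> V"
  shows "(\<Sum>i\<in>V. M i l x) = x"
proof -
  define y where "y l = x - (\<Sum>i\<in>V. M i l x)" for l
  have y: "y l \<in> carrier H" if "l \<in> V" for l using x that by (simp add: y_def)
  have "(\<Sum>l\<in>V. \<Sum>i\<in>V. M i l x) = (\<Sum>i\<in>V. x)"
    by (subst sum.swap) (simp add: M_row x)
  then have sum0: "(\<Sum>l\<in>V. y l) = 0" by (simp add: y_def sum_subtractf)
  have My: "M j l (y l) = 0" if "j \<in> V" "l \<in> V" for j l
  proof -
    have "M j l (\<Sum>i\<in>V. M i l x) = (\<Sum>i\<in>V. M j l (M i l x))"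
      using that x by (intro linear_op_sum M_linear) auto
    also have "\<dots> = (\<Sum>i\<in>V. if i = j then M j l x else 0)"
      using that x by (intro sum.cong) (auto simp: M_idem M_col_orth)
    also have "\<dots> = M j l x" using finite_V that by simp
    finally show ?thesis using that x by (simp add: y_def)
  qed
  have yy: "ip x (y l) = ip (y l) (y l)" if l: "l \<in> V" for l
  proof -
    have "ip (\<Sum>i\<in>V. M i l x) (y l) = 0"
      using l x y My by (simp add: ip_sum_left M_herm)
    moreover have "x = y l + (\<Sum>i\<in>V. M i l x)" by (simp add: y_def)
    then have "ip x (y l) = ip (y l + (\<Sum>i\<in>V. M i l x)) (y l)" by simp
    ultimately show ?thesis using l x y by simp
  qed
  have "(\<Sum>l\<in>V. Re (ip (y l) (y l))) = Re (ip x (\<Sum>l\<in>V. y l))"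
    using x y by (simp add: ip_sum_right yy)
  also have "\<dots> = 0" using x by (simp add: sum0)
  finally have "\<forall>l\<in>V. Re (ip (y l) (y l)) = 0"
    using finite_V y ip_self_nonneg by (subst (asm) sum_nonneg_eq_0_iff) auto
  then have "y l = 0" using y l by (intro ip_self_le_zero) auto
  then show ?thesis by (simp add: y_def)
qed

end

section \<open>Transport of C*-algebras\<close>

text \<open>The universal property in \<open>is_C_Qut\<close> only tests algebras in the type of the
  universal algebra, here \<open>continuum\<close>. Operators are functions on that type, so their
  algebra must first be moved along an injection.\<close>

locale cstar_transport = cstar_algebra A for A :: "'c cstar" (structure) +
  fixes f :: "'c \<Rightarrow> 'd"
  assumes inj_f: "inj_on f (carrier A)"
begin

lemma ring_A: "ring A"
  using cstar_algebra_axioms by (rule cstar_algebra.axioms)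

text \<open>The complex ring shadows the unqualified names of the ring facts of \<open>A\<close>.\<close>

lemmas ring_simprules_A = ring.ring_simprules[OF ring_A]

definition f_inv :: "'d \<Rightarrow> 'c" where "f_inv = inv_into (carrier A) f"

definition transported :: "'d cstar" where
  "transported = \<lparr>carrier = f ` carrier A, monoid.mult = (\<lambda>x y. f (f_inv x \<otimes> f_inv y)),
    one = f \<one>, zero = f \<zero>, add = (\<lambda>x y. f (f_inv x \<oplus> f_inv y)),
    module.smult = (\<lambda>c x. f (c \<odot> f_inv x)), star = (\<lambda>x. f (star A (f_inv x))),
    cnorm = (\<lambda>x. cnorm A (f_inv x))\<rparr>"

lemma f_inv_f [simp]: "x \<in> carrier A \<Longrightarrow> f_inv (f x) = x"
  by (simp add: f_inv_def inj_f)

declare star_closed [simp]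

lemma transported_simps [simp]:
  "carrier transported = f ` carrier A"
  "\<one>\<^bsub>transported\<^esub> = f \<one>" "\<zero>\<^bsub>transported\<^esub> = f \<zero>"
  "\<lbrakk>x \<in> carrier A; y \<in> carrier A\<rbrakk> \<Longrightarrow> f x \<otimes>\<^bsub>transported\<^esub> f y = f (x \<otimes> y)"
  "\<lbrakk>x \<in> carrier A; y \<in> carrier A\<rbrakk> \<Longrightarrow> f x \<oplus>\<^bsub>transported\<^esub> f y = f (x \<oplus> y)"
  "x \<in> carrier A \<Longrightarrow> c \<odot>\<^bsub>transported\<^esub> f x = f (c \<odot> x)"
  "x \<in> carrier A \<Longrightarrow> star transported (f x) = f (star A x)"
  "x \<in> carrier A \<Longrightarrow> cnorm transported (f x) = cnorm A x"
  by (simp_all add: transported_def)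

lemma abelian_group_transported: "abelian_group transported"
proof (rule abelian_groupI)
  show "\<exists>y\<in>carrier transported. y \<oplus>\<^bsub>transported\<^esub> x = \<zero>\<^bsub>transported\<^esub>"
    if x: "x \<in> carrier transported" for x
  proof -
    obtain x' where x': "x = f x'" "x' \<in> carrier A" using x by auto
    then show ?thesis by (intro bexI[of _ "f (\<ominus> x')"]) (auto simp: ring_simprules_A)
  qed
qed (auto simp: ring_simprules_A)

lemma ring_transported: "ring transported"
proof (rule ringI)
  show "abelian_group transported" by (rule abelian_group_transported)
  show "monoid transported"
    by (rule monoidI) (auto simp: ring_simprules_A)
qed (auto simp: ring_simprules_A)

lemma minus_transported:
  assumes "x \<in> carrier A" "y \<in> carrier A"
  shows "f x \<ominus>\<^bsub>transported\<^esub> f y = f (x \<ominus> y)"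
proof -
  interpret t: ring transported by (rule ring_transported)
  have "f x = f (x \<ominus> y) \<oplus>\<^bsub>transported\<^esub> f y"
    using assms by (simp add: ring_simprules_A)
  moreover have "f (x \<ominus> y) \<in> carrier transported" "f x \<in> carrier transported" "f y \<in> carrier transported"
    using assms by auto
  ultimately show ?thesis
    by (simp add: t.minus_eq t.a_assoc t.r_neg del: transported_simps)
qed

lemma module_transported: "Module.module complex_ring transported"
proof (rule moduleI)
  show "cring complex_ring" ..
  show "abelian_group transported" by (rule abelian_group_transported)
qed (auto simp: smult_l_distr[simplified] smult_r_distr[simplified] smult_assoc1[simplified]
    smult_one[simplified])

lemma complete_transported:
  "complete_wrt (carrier transported) (\<lambda>x y. cnorm transported (x \<ominus>\<^bsub>transported\<^esub> y))"
  unfolding complete_wrt_def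
proof (intro allI impI)
  fix s :: "nat \<Rightarrow> 'd"
  assume ran: "range s \<subseteq> carrier transported"
    and cau: "\<forall>e>0. \<exists>K. \<forall>m\<ge>K. \<forall>n\<ge>K. cnorm transported (s m \<ominus>\<^bsub>transported\<^esub> s n) < e"
  define t where "t n = f_inv (s n)" for n
  have t: "t n \<in> carrier A \<and> s n = f (t n)" for n
  proof -
    have "s n \<in> f ` carrier A" using ran by auto
    then show ?thesis by (auto simp: t_def)
  qed
  have "\<forall>e>0. \<exists>K. \<forall>m\<ge>K. \<forall>n\<ge>K. cnorm A (t m \<ominus> t n) < e"
    using cau t by (simp add: minus_transported)
  moreover have "range t \<subseteq> carrier A" using t by auto
  ultimately obtain x where x: "x \<in> carrier A" "(\<lambda>n. cnorm A (t n \<ominus> x)) \<longlonglongrightarrow> 0"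
    using cstar_complete unfolding complete_wrt_def by blast
  then show "\<exists>x\<in>carrier transported. (\<lambda>n. cnorm transported (s n \<ominus>\<^bsub>transported\<^esub> x)) \<longlonglongrightarrow> 0"
    using t by (intro bexI[of _ "f x"]) (simp_all add: minus_transported)
qed

lemma cstar_algebra_transported: "cstar_algebra transported"
  by (intro cstar_algebra.intro cstar_algebra_axioms.intro ring_transported module_transported
      complete_transported)
    (auto simp: smult_mult_left smult_mult_right star_star star_add star_smult star_mult
      cnorm_nonneg cnorm_eq_zero cnorm_triangle cnorm_smult cnorm_mult cnorm_cstar
      inj_on_eq_iff[OF inj_f])

lemma finsum_transported:
  assumes "finite S" "\<And>i. i \<in> S \<Longrightarrow> h i \<in> carrier A"
  shows "finsum transported (\<lambda>i. f (h i)) S = f (finsum A h S)"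
  using assms
proof (induction S rule: finite_induct)
  interpret t: ring transported by (rule ring_transported)
  {
    case empty
    then show ?case by simp
  next
    case (insert i S)
    then have h: "h \<in> S \<rightarrow> carrier A" "h i \<in> carrier A" "(\<lambda>i. f (h i)) \<in> S \<rightarrow> carrier transported"
       "f (h i) \<in> carrier transported"
      by auto
    have "finsum A h (insert i S) = h i \<oplus> finsum A h S"
      using insert h by simp
    moreover have "finsum transported (\<lambda>i. f (h i)) (insert i S)
        = f (h i) \<oplus>\<^bsub>transported\<^esub> finsum transported (\<lambda>i. f (h i)) S"
      using insert h by (intro t.finsum_insert) auto
    moreover have "finsum A h S \<in> carrier A" using h by auto
    ultimately show ?case using insert h by simp
  }
qed

end

section \<open>The C*-algebra of bounded operators\<close>

context continuum_hilbert
begin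

abbreviation nrm :: "continuum \<Rightarrow> real" where "nrm \<equiv> hilbert_norm H"

lemma nrm_nonneg [simp]: "x \<in> carrier H \<Longrightarrow> 0 \<le> nrm x"
  by (rule hilbert_norm_nonneg)

lemma nrm_zero [simp]: "nrm 0 = 0"
  by (simp add: hilbert_norm_def)

lemma nrm_eq_zero: "x \<in> carrier H \<Longrightarrow> nrm x = 0 \<longleftrightarrow> x = 0"
  using ip_self_norm[of x] ip_self_zero[of x] by auto

lemma nrm_cscale: "x \<in> carrier H \<Longrightarrow> nrm (cscale c x) = cmod c * nrm x"
proof -
  assume x: "x \<in> carrier H"
  have "ip (cscale c x) (cscale c x) = of_real ((cmod c)\<^sup>2) * ip x x"
    using x by (simp add: complex_norm_square mult.commute del: of_real_power)
  then have "Re (ip (cscale c x) (cscale c x)) = (cmod c)\<^sup>2 * Re (ip x x)" by simp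
  then show ?thesis by (simp add: hilbert_norm_def real_sqrt_mult)
qed

lemma nrm_triangle: "x \<in> carrier H \<Longrightarrow> y \<in> carrier H \<Longrightarrow> nrm (x + y) \<le> nrm x + nrm y"
proof (rule power2_le_imp_le)
  assume x: "x \<in> carrier H" and y: "y \<in> carrier H"
  have "(nrm (x + y))\<^sup>2 = (nrm x)\<^sup>2 + (nrm y)\<^sup>2 + Re (ip x y) + Re (ip y x)"
    using x y by (simp add: hilbert_norm_power2)
  moreover have "Re (ip x y) \<le> nrm x * nrm y"
    using complex_Re_le_cmod cauchy_schwarz[OF x y] by (rule order_trans)
  moreover have "Re (ip y x) \<le> nrm y * nrm x"
    using complex_Re_le_cmod cauchy_schwarz[OF y x] by (rule order_trans)
  ultimately show "(nrm (x + y))\<^sup>2 \<le> (nrm x + nrm y)\<^sup>2"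
    by (simp add: power2_sum mult.commute[of "nrm y"])
qed auto

lemma nrm_minus_commute: "x \<in> carrier H \<Longrightarrow> y \<in> carrier H \<Longrightarrow> nrm (x - y) = nrm (y - x)"
proof -
  assume x: "x \<in> carrier H" and y: "y \<in> carrier H"
  have "x - y = cscale (-1) (y - x)" by (simp add: cscale_def fun_eq_iff)
  then show ?thesis using nrm_cscale[of "y - x" "-1"] x y by simp
qed

lemma nrm_triangle_diff:
  "\<lbrakk>x \<in> carrier H; y \<in> carrier H; z \<in> carrier H\<rbrakk> \<Longrightarrow> nrm (x - z) \<le> nrm (x - y) + nrm (y - z)"
  using nrm_triangle[of "x - y" "y - z"] by simp

lemma complete:
  assumes s: "\<And>n. s n \<in> carrier H"
    and cau: "\<And>e. e > 0 \<Longrightarrow> \<exists>K::nat. \<forall>m\<ge>K. \<forall>n\<ge>K. nrm (s m - s n) < e"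
  obtains x where "x \<in> carrier H" "\<And>e. e > 0 \<Longrightarrow> \<exists>K. \<forall>n\<ge>K. nrm (s n - x) < e"
proof -
  have "range s \<subseteq> carrier H" using s by auto
  moreover have "\<forall>e>0. \<exists>K. \<forall>m\<ge>K. \<forall>n\<ge>K. nrm (s m \<ominus> s n) < e"
    using s cau by (simp add: minus_eq_diff)
  ultimately obtain x where x: "x \<in> carrier H" "(\<lambda>n. nrm (s n \<ominus> x)) \<longlonglongrightarrow> 0"
    using hilbert_complete unfolding complete_wrt_def by blast
  have "\<exists>K. \<forall>n\<ge>K. nrm (s n - x) < e" if "e > 0" for e
    using LIMSEQ_D[OF x(2) that] s x(1) by (simp add: minus_eq_diff)
  then show thesis using that x by blast
qed

lemma ip_ext:
  assumes "x \<in> carrier H" "y \<in> carrier H" "\<And>z. z \<in> carrier H \<Longrightarrow> ip z x = ip z y"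
  shows "x = y"
proof -
  have "ip (x - y) (x - y) = 0" using assms by simp
  then show ?thesis using ip_self_zero[of "x - y"] assms by simp
qed

text \<open>Having an adjoint is demanded of an operator instead of being derived from boundedness,
  which dispenses with the Riesz representation theorem. Measurement operators are their own
  adjoints.\<close>

definition adjoint_pair :: "(continuum \<Rightarrow> continuum) \<Rightarrow> (continuum \<Rightarrow> continuum) \<Rightarrow> bool" where
  "adjoint_pair S T \<longleftrightarrow> (\<forall>x\<in>carrier H. S x \<in> carrier H \<and> T x \<in> carrier H) \<and>
    (\<forall>x\<in>carrier H. \<forall>y\<in>carrier H. ip (S x) y = ip x (T y))"

text \<open>Operators are extended by \<open>0\<close> outside the Hilbert space, so that they are determined by their
  values on it. Linearity follows from the existence of an adjoint.\<close>

definition bops :: "(continuum \<Rightarrow> continuum) set" where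
  "bops = {T. (\<forall>x. x \<notin> carrier H \<longrightarrow> T x = 0) \<and> (\<exists>S. adjoint_pair S T) \<and>
    (\<exists>B\<ge>0. \<forall>x\<in>carrier H. nrm (T x) \<le> B * nrm x)}"

definition adj :: "(continuum \<Rightarrow> continuum) \<Rightarrow> continuum \<Rightarrow> continuum" where
  "adj T x = (if x \<in> carrier H then (SOME S. adjoint_pair S T) x else 0)"

text \<open>As an infimum of admissible bounds the norm makes sense on the zero space too, where
  there are no unit vectors.\<close>

definition opnorm :: "(continuum \<Rightarrow> continuum) \<Rightarrow> real" where
  "opnorm T = Inf {B. 0 \<le> B \<and> (\<forall>x\<in>carrier H. nrm (T x) \<le> B * nrm x)}"

definition op_alg :: "(continuum \<Rightarrow> continuum) cstar" where
  "op_alg = \<lparr>carrier = bops, monoid.mult = (\<circ>), one = (\<lambda>x. if x \<in> carrier H then x else 0),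
    zero = 0, add = (+), module.smult = (\<lambda>c T x. cscale c (T x)), star = adj, cnorm = opnorm\<rparr>"

lemma adjoint_pair_sym: "adjoint_pair S T \<Longrightarrow> adjoint_pair T S"
  unfolding adjoint_pair_def by (metis inner_prod_cnj)

lemma adjoint_pairD:
  assumes "adjoint_pair S T"
  shows "x \<in> carrier H \<Longrightarrow> S x \<in> carrier H" "x \<in> carrier H \<Longrightarrow> T x \<in> carrier H"
    "x \<in> carrier H \<Longrightarrow> y \<in> carrier H \<Longrightarrow> ip (S x) y = ip x (T y)"
  using assms by (auto simp: adjoint_pair_def)

lemma adjoint_pair_linear:
  assumes "adjoint_pair S T" "x \<in> carrier H" "y \<in> carrier H"
  shows "T (x + y) = T x + T y" "T (cscale c x) = cscale c (T x)"
proof -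
  note p = adjoint_pairD[OF assms(1)]
  show "T (x + y) = T x + T y"
  proof (rule ip_ext)
    show "ip z (T (x + y)) = ip z (T x + T y)" if z: "z \<in> carrier H" for z
      using assms z p(1)[OF z] p(2) p(3)[OF z, of x] p(3)[OF z, of y] p(3)[OF z, of "x + y"] by simp
  qed (use assms p in auto)
  show "T (cscale c x) = cscale c (T x)"
  proof (rule ip_ext)
    show "ip z (T (cscale c x)) = ip z (cscale c (T x))" if z: "z \<in> carrier H" for z
      using assms z p(1)[OF z] p(2) p(3)[OF z, of x] p(3)[OF z, of "cscale c x"] by simp
  qed (use assms p in auto)
qed

lemma adjoint_pair_unique:
  assumes "adjoint_pair S T" "adjoint_pair S T'" "x \<in> carrier H"
  shows "T x = T' x"
  using assms by (intro ip_ext) (auto simp: adjoint_pair_def)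

lemma bops_zero: "T \<in> bops \<Longrightarrow> x \<notin> carrier H \<Longrightarrow> T x = 0"
  by (simp add: bops_def)

lemma bops_adj: "T \<in> bops \<Longrightarrow> adjoint_pair (adj T) T"
proof -
  assume "T \<in> bops"
  then have "adjoint_pair (SOME S. adjoint_pair S T) T"
    unfolding bops_def by (blast intro: someI_ex[of "\<lambda>S. adjoint_pair S T"])
  then obtain S where S: "adjoint_pair S T" "S = (SOME S. adjoint_pair S T)" by blast
  then have "adj T x = S x" if "x \<in> carrier H" for x
    using that by (simp add: adj_def)
  then show ?thesis using S(1) by (simp add: adjoint_pair_def)
qed

lemma bops_in [simp]: "T \<in> bops \<Longrightarrow> T x \<in> carrier H"
  using bops_zero[of T x] adjoint_pairD(2)[OF bops_adj, of T x] by (cases "x \<in> carrier H") auto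

lemma adj_outside [simp]: "x \<notin> carrier H \<Longrightarrow> adj T x = 0"
  by (simp add: adj_def)

lemma bops_linear:
  assumes "T \<in> bops"
  shows "\<lbrakk>x \<in> carrier H; y \<in> carrier H\<rbrakk> \<Longrightarrow> T (x + y) = T x + T y"
    and "x \<in> carrier H \<Longrightarrow> T (cscale c x) = cscale c (T x)" and "T 0 = 0"
  using adjoint_pair_linear[OF bops_adj[OF assms]] adjoint_pair_linear(1)[OF bops_adj[OF assms], of 0 0]
  by auto

lemma adj_eqI:
  assumes "T \<in> bops" "adjoint_pair S T" "\<And>x. x \<notin> carrier H \<Longrightarrow> S x = 0"
  shows "adj T = S"
proof
  fix x show "adj T x = S x"
    using adjoint_pair_unique[OF adjoint_pair_sym[OF bops_adj] adjoint_pair_sym, of T S x] assms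
    by (cases "x \<in> carrier H") auto
qed

lemma opnorm_le: "0 \<le> B \<Longrightarrow> (\<And>x. x \<in> carrier H \<Longrightarrow> nrm (T x) \<le> B * nrm x) \<Longrightarrow> opnorm T \<le> B"
  unfolding opnorm_def by (rule cInf_lower) (auto intro!: bdd_belowI[of _ 0])

lemma bops_bounded: "T \<in> bops \<Longrightarrow> {B. 0 \<le> B \<and> (\<forall>x\<in>carrier H. nrm (T x) \<le> B * nrm x)} \<noteq> {}"
  by (auto simp: bops_def)

lemma opnorm_nonneg: "T \<in> bops \<Longrightarrow> 0 \<le> opnorm T"
  unfolding opnorm_def by (rule cInf_greatest[OF bops_bounded]) auto

lemma opnorm_bound: "T \<in> bops \<Longrightarrow> x \<in> carrier H \<Longrightarrow> nrm (T x) \<le> opnorm T * nrm x"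
proof -
  assume T: "T \<in> bops" and x: "x \<in> carrier H"
  show ?thesis
  proof (cases "nrm x = 0")
    case True
    then have "x = 0" using x nrm_eq_zero by blast
    then show ?thesis using bops_linear(3)[OF T] by simp
  next
    case False
    then have pos: "nrm x > 0" using x nrm_nonneg[of x] by linarith
    have "nrm (T x) / nrm x \<le> opnorm T"
      unfolding opnorm_def using pos x
      by (intro cInf_greatest[OF bops_bounded[OF T]]) (auto simp: divide_le_eq)
    then show ?thesis using pos by (simp add: divide_le_eq)
  qed
qed

lemma bopsI:
  assumes "\<And>x. x \<notin> carrier H \<Longrightarrow> T x = 0" "adjoint_pair S T"
    "0 \<le> B" "\<And>x. x \<in> carrier H \<Longrightarrow> nrm (T x) \<le> B * nrm x"
  shows "T \<in> bops"
  using assms by (auto simp: bops_def)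

text \<open>The squared norm of \<open>adj T x\<close> equals \<open>ip x (T (adj T x))\<close>;
  Cauchy-Schwarz leaves one factor to cancel. The reverse inequality between the norms comes from
  applying the result to \<open>adj T\<close>.\<close>

lemma bops_adj_norm:
  assumes T: "T \<in> bops"
  shows "adj T \<in> bops \<and> opnorm (adj T) \<le> opnorm T"
proof -
  note p = adjoint_pairD[OF bops_adj[OF T]]
  have b: "nrm (adj T x) \<le> opnorm T * nrm x" if x: "x \<in> carrier H" for x
  proof -
    let ?y = "adj T x"
    have y: "?y \<in> carrier H" using p x by blast
    have "(nrm ?y)\<^sup>2 = Re (ip x (T ?y))"
      using p(3)[OF x y] y by (simp add: hilbert_norm_power2)
    also have "\<dots> \<le> nrm x * nrm (T ?y)"
      using complex_Re_le_cmod cauchy_schwarz[OF x] T by (meson bops_in order_trans)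
    also have "\<dots> \<le> nrm x * (opnorm T * nrm ?y)"
      using x y T by (intro mult_left_mono opnorm_bound) auto
    finally have "nrm ?y * nrm ?y \<le> (opnorm T * nrm x) * nrm ?y"
      by (simp add: power2_eq_square ac_simps)
    then show ?thesis
      using y x opnorm_nonneg[OF T] nrm_nonneg[OF y] by (cases "nrm ?y = 0") auto
  qed
  have "adj T \<in> bops"
    by (rule bopsI[OF _ adjoint_pair_sym[OF bops_adj[OF T]] opnorm_nonneg[OF T] b]) auto
  then show ?thesis using opnorm_le[OF opnorm_nonneg[OF T] b] by blast
qed

lemma adj_bops [simp]: "T \<in> bops \<Longrightarrow> adj T \<in> bops"
  using bops_adj_norm by blast

lemma adj_adj: "T \<in> bops \<Longrightarrow> adj (adj T) = T"
  by (intro adj_eqI adj_bops adjoint_pair_sym[OF bops_adj]) (auto simp: bops_zero)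

lemma opnorm_adj: "T \<in> bops \<Longrightarrow> opnorm (adj T) = opnorm T"
  using bops_adj_norm[of T] bops_adj_norm[of "adj T"] by (simp add: adj_adj)

lemma bops_add:
  assumes S: "S \<in> bops" and T: "T \<in> bops"
  shows "S + T \<in> bops \<and> adj (S + T) = adj S + adj T \<and> opnorm (S + T) \<le> opnorm S + opnorm T"
proof -
  have pair: "adjoint_pair (adj S + adj T) (S + T)"
    using adjoint_pairD[OF bops_adj[OF S]] adjoint_pairD[OF bops_adj[OF T]]
    by (simp add: adjoint_pair_def)
  have b: "nrm ((S + T) x) \<le> (opnorm S + opnorm T) * nrm x" if "x \<in> carrier H" for x
    using nrm_triangle[of "S x" "T x"] opnorm_bound[OF S that] opnorm_bound[OF T that] S T
    by (simp add: distrib_right)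
  have nn: "0 \<le> opnorm S + opnorm T" using S T opnorm_nonneg by simp
  have st: "S + T \<in> bops" using S T by (intro bopsI[OF _ pair nn b]) (auto simp: bops_zero)
  show ?thesis
    by (intro conjI st adj_eqI[OF st pair] opnorm_le[OF nn b]) auto
qed

lemma bops_scale:
  assumes T: "T \<in> bops"
  shows "(\<lambda>x. cscale c (T x)) \<in> bops \<and> adj (\<lambda>x. cscale c (T x)) = (\<lambda>x. cscale (cnj c) (adj T x)) \<and>
    opnorm (\<lambda>x. cscale c (T x)) \<le> cmod c * opnorm T"
proof -
  have z: "cscale a 0 = 0" for a by (simp add: cscale_def fun_eq_iff)
  have pair: "adjoint_pair (\<lambda>x. cscale (cnj c) (adj T x)) (\<lambda>x. cscale c (T x))"
    using adjoint_pairD[OF bops_adj[OF T]] by (simp add: adjoint_pair_def)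
  have b: "nrm (cscale c (T x)) \<le> (cmod c * opnorm T) * nrm x" if "x \<in> carrier H" for x
    using opnorm_bound[OF T that] T by (simp add: nrm_cscale mult.assoc mult_left_mono)
  have nn: "0 \<le> cmod c * opnorm T" using T opnorm_nonneg by simp
  have st: "(\<lambda>x. cscale c (T x)) \<in> bops"
    using T by (intro bopsI[OF _ pair nn b]) (auto simp: bops_zero[OF T] z)
  show ?thesis
    by (intro conjI st adj_eqI[OF st pair] opnorm_le[OF nn b]) (auto simp: z)
qed

lemma bops_comp:
  assumes S: "S \<in> bops" and T: "T \<in> bops"
  shows "S \<circ> T \<in> bops \<and> adj (S \<circ> T) = adj T \<circ> adj S \<and> opnorm (S \<circ> T) \<le> opnorm S * opnorm T"
proof -
  have pair: "adjoint_pair (adj T \<circ> adj S) (S \<circ> T)"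
    using adjoint_pairD[OF bops_adj[OF S]] adjoint_pairD[OF bops_adj[OF T]]
    by (simp add: adjoint_pair_def)
  have b: "nrm ((S \<circ> T) x) \<le> (opnorm S * opnorm T) * nrm x" if "x \<in> carrier H" for x
  proof -
    have "nrm (S (T x)) \<le> opnorm S * nrm (T x)" using S T by (simp add: opnorm_bound)
    also have "\<dots> \<le> opnorm S * (opnorm T * nrm x)"
      using S T that by (intro mult_left_mono opnorm_bound opnorm_nonneg) auto
    finally show ?thesis by simp
  qed
  have nn: "0 \<le> opnorm S * opnorm T" using S T opnorm_nonneg by simp
  have st: "S \<circ> T \<in> bops"
    using S T by (intro bopsI[OF _ pair nn b]) (auto simp: bops_zero[OF T] bops_linear(3)[OF S])
  show ?thesis
    by (intro conjI st adj_eqI[OF st pair] opnorm_le[OF nn b])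
      (auto simp: bops_linear(3)[OF adj_bops[OF T]])
qed

lemma one_bops: "(\<lambda>x. if x \<in> carrier H then x else 0) \<in> bops"
  by (rule bopsI[of _ "\<lambda>x. x" 1]) (auto simp: adjoint_pair_def)

lemma zero_bops: "0 \<in> bops"
  by (rule bopsI[of _ 0 0]) (auto simp: adjoint_pair_def)

lemma bops_ext: "S \<in> bops \<Longrightarrow> T \<in> bops \<Longrightarrow> (\<And>x. x \<in> carrier H \<Longrightarrow> S x = T x) \<Longrightarrow> S = T"
  by (rule ext) (metis bops_zero)

lemma cscale_simps:
  "cscale (a + b) x = cscale a x + cscale b x" "cscale a (x + y) = cscale a x + cscale a y"
  "cscale (a * b) x = cscale a (cscale b x)" "cscale 1 x = x" "cscale (-1) x = - x"
  "cscale a 0 = 0" "cscale 0 x = 0"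
  by (simp_all add: cscale_def fun_eq_iff algebra_simps)

lemma op_alg_simps [simp]:
  "carrier op_alg = bops" "S \<otimes>\<^bsub>op_alg\<^esub> T = S \<circ> T" "\<zero>\<^bsub>op_alg\<^esub> = 0"
  "\<one>\<^bsub>op_alg\<^esub> = (\<lambda>x. if x \<in> carrier H then x else 0)" "S \<oplus>\<^bsub>op_alg\<^esub> T = S + T"
  "c \<odot>\<^bsub>op_alg\<^esub> T = (\<lambda>x. cscale c (T x))" "star op_alg = adj" "cnorm op_alg = opnorm"
  by (simp_all add: op_alg_def)

lemma uminus_bops: "T \<in> bops \<Longrightarrow> - T \<in> bops"
  using bops_scale[of T "-1"] by (simp add: cscale_simps fun_Compl_def)

lemma abelian_group_op_alg: "abelian_group op_alg"
proof (rule abelian_groupI)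
  show "\<exists>y\<in>carrier op_alg. y \<oplus>\<^bsub>op_alg\<^esub> T = \<zero>\<^bsub>op_alg\<^esub>" if "T \<in> carrier op_alg" for T
    using that uminus_bops by (intro bexI[of _ "- T"]) auto
qed (auto simp: bops_add zero_bops algebra_simps)

lemma ring_op_alg: "ring op_alg"
proof (rule ringI)
  show "abelian_group op_alg" by (rule abelian_group_op_alg)
  show "monoid op_alg"
    by (rule monoidI)
      (auto simp: bops_comp one_bops fun_eq_iff bops_zero bops_linear)
qed (auto simp: fun_eq_iff bops_linear)

lemma module_op_alg: "Module.module complex_ring op_alg"
proof (rule moduleI)
  show "cring complex_ring" ..
  show "abelian_group op_alg" by (rule abelian_group_op_alg)
qed (auto simp: bops_scale cscale_simps fun_eq_iff)

lemma minus_op_alg: "S \<in> bops \<Longrightarrow> T \<in> bops \<Longrightarrow> S \<ominus>\<^bsub>op_alg\<^esub> T = S - T"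
proof -
  interpret r: ring op_alg by (rule ring_op_alg)
  assume a: "S \<in> bops" "T \<in> bops"
  then have "S \<in> carrier op_alg" "T \<in> carrier op_alg" by simp_all
  then have "(S \<ominus>\<^bsub>op_alg\<^esub> T) \<oplus>\<^bsub>op_alg\<^esub> T = S"
    by (simp add: r.minus_eq r.a_assoc r.l_neg del: op_alg_simps)
  then have "(S \<ominus>\<^bsub>op_alg\<^esub> T) + T = S" by simp
  then show ?thesis by (metis add_diff_cancel_right')
qed

lemma diff_bops: "S \<in> bops \<Longrightarrow> T \<in> bops \<Longrightarrow> S - T \<in> bops"
  using bops_add[of S "- T"] uminus_bops by simp

lemma adj_diff: "S \<in> bops \<Longrightarrow> T \<in> bops \<Longrightarrow> adj (S - T) = adj S - adj T"
  using bops_add[of "S - T" T] diff_bops[of S T] by (metis add_diff_cancel_right' diff_add_cancel)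

text \<open>The limit is produced as a bare map with uniform convergence on bounded sets. Whether it
  has an adjoint can only be decided once the adjoint sequence has a limit as well.\<close>

lemma cauchy_pointwise_limit:
  fixes s :: "nat \<Rightarrow> continuum \<Rightarrow> continuum"
  assumes s: "\<And>n. s n \<in> bops"
    and cau: "\<And>e. e > 0 \<Longrightarrow> \<exists>K. \<forall>m\<ge>K. \<forall>n\<ge>K. opnorm (s m - s n) < e"
  obtains L where "\<And>x. x \<in> carrier H \<Longrightarrow> L x \<in> carrier H" "\<And>x. x \<notin> carrier H \<Longrightarrow> L x = 0"
    "\<And>e. e > 0 \<Longrightarrow> \<exists>K. \<forall>n\<ge>K. \<forall>x\<in>carrier H. nrm (s n x - L x) \<le> e * nrm x"
proof -
  have diff: "nrm (s m x - s n x) \<le> opnorm (s m - s n) * nrm x" if "x \<in> carrier H" for m n x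
    using opnorm_bound[OF diff_bops[OF s s] that] by simp
  have "\<exists>y\<in>carrier H. \<forall>e>0. \<exists>K. \<forall>n\<ge>K. nrm (s n x - y) < e" if x: "x \<in> carrier H" for x
  proof (rule complete[of "\<lambda>n. s n x"])
    show "s n x \<in> carrier H" for n using s by simp
    fix e :: real assume e: "e > 0"
    \<comment> \<open>The summand 1 keeps the divisor positive when \<open>x\<close> is 0.\<close>
    have p: "nrm x + 1 > 0" using nrm_nonneg[OF x] by linarith
    then obtain K where K: "\<forall>m\<ge>K. \<forall>n\<ge>K. opnorm (s m - s n) < e / (nrm x + 1)"
      using cau[of "e / (nrm x + 1)"] e by auto
    have "nrm (s m x - s n x) < e" if "m \<ge> K" "n \<ge> K" for m n
    proof -
      have "nrm (s m x - s n x) \<le> opnorm (s m - s n) * nrm x" by (rule diff[OF x])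
      also have "\<dots> \<le> e / (nrm x + 1) * nrm x"
        using K that x by (intro mult_right_mono) (auto intro: less_imp_le)
      also have "\<dots> < e" using e p by (simp add: field_simps)
      finally show ?thesis .
    qed
    then show "\<exists>K. \<forall>m\<ge>K. \<forall>n\<ge>K. nrm (s m x - s n x) < e" by blast
  qed blast
  then obtain L0 where L0: "\<And>x. x \<in> carrier H \<Longrightarrow> L0 x \<in> carrier H"
    "\<And>x e. x \<in> carrier H \<Longrightarrow> e > 0 \<Longrightarrow> \<exists>K. \<forall>n\<ge>K. nrm (s n x - L0 x) < e"
    by metis
  define L where "L x = (if x \<in> carrier H then L0 x else 0)" for x
  have "\<exists>K. \<forall>n\<ge>K. \<forall>x\<in>carrier H. nrm (s n x - L x) \<le> e * nrm x" if e: "e > 0" for e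
  proof -
    obtain K where K: "\<And>m n. m \<ge> K \<Longrightarrow> n \<ge> K \<Longrightarrow> opnorm (s m - s n) < e"
      using cau[OF e] by blast
    have "nrm (s n x - L x) \<le> e * nrm x" if n: "n \<ge> K" and x: "x \<in> carrier H" for n x
    proof (rule field_le_epsilon)
      fix \<epsilon> :: real assume "\<epsilon> > 0"
      then obtain K' where K': "\<And>m. m \<ge> K' \<Longrightarrow> nrm (s m x - L0 x) < \<epsilon>"
        using L0(2)[OF x] by blast
      \<comment> \<open>\<open>K'\<close> depends on \<open>x\<close> while \<open>K\<close> does
        not. The auxiliary index exceeds both, and the dependence on \<open>x\<close> disappears
        together with the arbitrary \<epsilon>.\<close>
      let ?m = "max K K'"
      have "nrm (s n x - L0 x) \<le> nrm (s n x - s ?m x) + nrm (s ?m x - L0 x)"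
        using L0(1)[OF x] s by (intro nrm_triangle_diff) auto
      also have "nrm (s n x - s ?m x) \<le> opnorm (s n - s ?m) * nrm x" by (rule diff[OF x])
      also have "opnorm (s n - s ?m) * nrm x \<le> e * nrm x"
        using K[OF n, of ?m] x by (intro mult_right_mono) auto
      also have "nrm (s ?m x - L0 x) \<le> \<epsilon>" using K'[of ?m] by simp
      finally show "nrm (s n x - L x) \<le> e * nrm x + \<epsilon>" using x by (simp add: L_def)
    qed
    then show ?thesis by blast
  qed
  then show thesis by (rule that[of L, rotated 2]) (auto simp: L_def L0)
qed

text \<open>The operators and their adjoints form two Cauchy sequences. By continuity of the inner
  product their limits \<open>L\<close> and \<open>R\<close> are adjoint to each other, and this
  makes \<open>L\<close> linear.\<close>

lemma complete_op_alg: "complete_wrt (carrier op_alg) (\<lambda>x y. cnorm op_alg (x \<ominus>\<^bsub>op_alg\<^esub> y))"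
  unfolding complete_wrt_def
proof (intro allI impI)
  fix s :: "nat \<Rightarrow> continuum \<Rightarrow> continuum"
  assume "range s \<subseteq> carrier op_alg"
    and cau': "\<forall>e>0. \<exists>K. \<forall>m\<ge>K. \<forall>n\<ge>K. cnorm op_alg (s m \<ominus>\<^bsub>op_alg\<^esub> s n) < e"
  then have s: "s n \<in> bops" for n by auto
  have cau: "\<exists>K. \<forall>m\<ge>K. \<forall>n\<ge>K. opnorm (s m - s n) < e" if "e > 0" for e
    using cau' s that by (simp add: minus_op_alg)
  have cau_adj: "\<exists>K. \<forall>m\<ge>K. \<forall>n\<ge>K. opnorm (adj (s m) - adj (s n)) < e" if "e > 0" for e
    using cau[OF that] s by (simp add: adj_diff[symmetric] opnorm_adj diff_bops)
  obtain L where L: "\<And>x. x \<in> carrier H \<Longrightarrow> L x \<in> carrier H" "\<And>x. x \<notin> carrier H \<Longrightarrow> L x = 0"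
    "\<And>e. e > 0 \<Longrightarrow> \<exists>K. \<forall>n\<ge>K. \<forall>x\<in>carrier H. nrm (s n x - L x) \<le> e * nrm x"
    using cauchy_pointwise_limit[OF s cau] by metis
  obtain R where R: "\<And>x. x \<in> carrier H \<Longrightarrow> R x \<in> carrier H" "\<And>x. x \<notin> carrier H \<Longrightarrow> R x = 0"
    "\<And>e. e > 0 \<Longrightarrow> \<exists>K. \<forall>n\<ge>K. \<forall>x\<in>carrier H. nrm (adj (s n) x - R x) \<le> e * nrm x"
    using cauchy_pointwise_limit[OF adj_bops[OF s] cau_adj] by metis
  have "ip (R x) y = ip x (L y)" if x: "x \<in> carrier H" and y: "y \<in> carrier H" for x y
  proof -
    let ?c = "nrm x * nrm y"
    have "cmod (ip (R x) y - ip x (L y)) \<le> 0"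
    proof (rule field_le_epsilon)
      fix \<epsilon> :: real assume \<epsilon>: "\<epsilon> > 0"
      \<comment> \<open>Two error terms of size \<open>e * ?c\<close> must stay below \<epsilon>;
        the added 1 covers \<open>?c = 0\<close>.\<close>
      define e where "e = \<epsilon> / (2 * (?c + 1))"
      have c: "?c \<ge> 0" using x y by simp
      then have e: "e > 0" using \<epsilon> by (simp add: e_def)
      obtain K1 where K1: "\<And>n x. n \<ge> K1 \<Longrightarrow> x \<in> carrier H \<Longrightarrow> nrm (s n x - L x) \<le> e * nrm x"
        using L(3)[OF e] by blast
      obtain K2 where K2: "\<And>n x. n \<ge> K2 \<Longrightarrow> x \<in> carrier H \<Longrightarrow> nrm (adj (s n) x - R x) \<le> e * nrm x"
        using R(3)[OF e] by blast
      let ?n = "max K1 K2"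
      have 1: "cmod (ip (adj (s ?n) x - R x) y) \<le> e * nrm x * nrm y"
        using cauchy_schwarz[of "adj (s ?n) x - R x" y] K2[of ?n x] x y s R
        by (intro order_trans[OF cauchy_schwarz] mult_right_mono) auto
      have 2: "cmod (ip x (s ?n y - L y)) \<le> nrm x * (e * nrm y)"
        using K1[of ?n y] x y s L
        by (intro order_trans[OF cauchy_schwarz] mult_left_mono) auto
      have "ip (R x) y - ip x (L y) = ip x (s ?n y - L y) - ip (adj (s ?n) x - R x) y"
        using x y s R L adjoint_pairD(3)[OF bops_adj[OF s] x y, of ?n] by simp
      then have "cmod (ip (R x) y - ip x (L y))
          \<le> cmod (ip x (s ?n y - L y)) + cmod (ip (adj (s ?n) x - R x) y)"
        by (simp add: norm_triangle_ineq4)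
      also have "\<dots> \<le> 2 * e * ?c" using 1 2 by (simp add: algebra_simps)
      also have "\<dots> \<le> \<epsilon>" using c \<epsilon> by (simp add: e_def field_simps)
      finally show "cmod (ip (R x) y - ip x (L y)) \<le> 0 + \<epsilon>" by simp
    qed
    then show ?thesis by simp
  qed
  then have pair: "adjoint_pair R L" using L R by (simp add: adjoint_pair_def)
  obtain K where K: "\<And>x. x \<in> carrier H \<Longrightarrow> nrm (s K x - L x) \<le> 1 * nrm x"
    using L(3)[of 1] by auto
  have "nrm (L x) \<le> (1 + opnorm (s K)) * nrm x" if x: "x \<in> carrier H" for x
    using nrm_triangle_diff[of "L x" "s K x" 0] K[OF x] opnorm_bound[OF s x, of K] x L(1)[OF x] s
    by (simp add: nrm_minus_commute[of "L x"] distrib_right)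
  then have Lb: "L \<in> bops"
    using L(2) pair opnorm_nonneg[OF s[of K]] by (intro bopsI[of L R "1 + opnorm (s K)"]) auto
  have "(\<lambda>n. opnorm (s n - L)) \<longlonglongrightarrow> 0"
  proof (rule LIMSEQ_I)
    fix r :: real assume "r > 0"
    then obtain K where K: "\<And>n x. n \<ge> K \<Longrightarrow> x \<in> carrier H \<Longrightarrow> nrm (s n x - L x) \<le> (r / 2) * nrm x"
      using L(3)[of "r / 2"] by auto
    \<comment> \<open>\<open>opnorm_le\<close> gives a weak inequality only; half of
      \<open>r\<close> makes the final one strict.\<close>
    have "opnorm (s n - L) \<le> r / 2" if "n \<ge> K" for n
      using K[OF that] \<open>r > 0\<close> by (intro opnorm_le) auto
    then show "\<exists>K. \<forall>n\<ge>K. norm (opnorm (s n - L) - 0) < r"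
      using \<open>r > 0\<close> opnorm_nonneg[OF diff_bops[OF s Lb]] by (intro exI[of _ K]) fastforce
  qed
  then show "\<exists>x\<in>carrier op_alg. (\<lambda>n. cnorm op_alg (s n \<ominus>\<^bsub>op_alg\<^esub> x)) \<longlonglongrightarrow> 0"
    using Lb s by (intro bexI[of _ L]) (simp_all add: minus_op_alg)
qed

lemma opnorm_cstar:
  assumes T: "T \<in> bops"
  shows "opnorm (adj T \<circ> T) = (opnorm T)\<^sup>2"
proof (rule antisym)
  show "opnorm (adj T \<circ> T) \<le> (opnorm T)\<^sup>2"
    using bops_comp[of "adj T" T] T by (simp add: opnorm_adj power2_eq_square)
  have c: "adj T \<circ> T \<in> bops" using T bops_comp by simp
  have "opnorm T \<le> sqrt (opnorm (adj T \<circ> T))"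
  proof (rule opnorm_le)
    fix x assume x: "x \<in> carrier H"
    have "(nrm (T x))\<^sup>2 = Re (ip (adj T (T x)) x)"
      using T x adjoint_pairD(3)[OF bops_adj[OF T], of "T x" x] by (simp add: hilbert_norm_power2)
    also have "\<dots> \<le> nrm (adj T (T x)) * nrm x"
      using T x by (intro order_trans[OF complex_Re_le_cmod] cauchy_schwarz) auto
    also have "\<dots> \<le> opnorm (adj T \<circ> T) * nrm x * nrm x"
      using opnorm_bound[OF c x] x by (intro mult_right_mono) auto
    also have "\<dots> = (sqrt (opnorm (adj T \<circ> T)) * nrm x)\<^sup>2"
      using opnorm_nonneg[OF c] by (simp add: power_mult_distrib power2_eq_square[of "nrm x"])
    finally show "nrm (T x) \<le> sqrt (opnorm (adj T \<circ> T)) * nrm x"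
      by (rule power2_le_imp_le) (use x opnorm_nonneg[OF c] in simp)
  qed (use opnorm_nonneg[OF c] in simp)
  then have "(opnorm T)\<^sup>2 \<le> (sqrt (opnorm (adj T \<circ> T)))\<^sup>2"
    using T opnorm_nonneg by (intro power_mono) auto
  then show "(opnorm T)\<^sup>2 \<le> opnorm (adj T \<circ> T)" using opnorm_nonneg[OF c] by simp
qed

lemma opnorm_eq_zero: "T \<in> bops \<Longrightarrow> opnorm T = 0 \<longleftrightarrow> T = 0"
proof
  assume T: "T \<in> bops" and 0: "opnorm T = 0"
  have "T x = 0" if "x \<in> carrier H" for x
  proof -
    have "nrm (T x) = 0"
      using opnorm_bound[OF T that] 0 T by (intro antisym) auto
    then show ?thesis using T nrm_eq_zero by simp
  qed
  then show "T = 0" using T zero_bops by (intro bops_ext) auto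
next
  assume "T \<in> bops" "T = 0"
  then show "opnorm T = 0" using opnorm_le[of 0 T] opnorm_nonneg[of T] by simp
qed

lemma opnorm_scale: "T \<in> bops \<Longrightarrow> opnorm (\<lambda>x. cscale c (T x)) = cmod c * opnorm T"
proof (cases "c = 0")
  case True
  then show ?thesis using opnorm_eq_zero[OF zero_bops] by (simp add: cscale_simps zero_fun_def)
next
  case False
  assume T: "T \<in> bops"
  define S where "S = (\<lambda>x. cscale c (T x))"
  have S: "S \<in> bops" "opnorm S \<le> cmod c * opnorm T"
    using bops_scale[OF T, of c] by (auto simp: S_def)
  have "T = (\<lambda>x. cscale (inverse c) (S x))"
    using False by (simp add: S_def fun_eq_iff cscale_def)
  then have "opnorm T \<le> cmod (inverse c) * opnorm S"
    using bops_scale[OF S(1), of "inverse c"] by simp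
  then have "cmod c * opnorm T \<le> opnorm S"
    using False by (simp add: norm_inverse norm_divide field_simps)
  then show ?thesis using S by (simp add: S_def)
qed

lemma cstar_algebra_op_alg: "cstar_algebra op_alg"
  by (intro cstar_algebra.intro cstar_algebra_axioms.intro ring_op_alg module_op_alg complete_op_alg)
    (auto simp: adj_adj bops_add bops_scale bops_comp opnorm_nonneg opnorm_eq_zero
      opnorm_scale opnorm_cstar bops_linear)

lemma finsum_op_alg:
  "finite S \<Longrightarrow> (\<And>i. i \<in> S \<Longrightarrow> h i \<in> bops) \<Longrightarrow> finsum op_alg h S = sum h S \<and> sum h S \<in> bops"
proof (induction S rule: finite_induct)
  interpret r: ring op_alg by (rule ring_op_alg)
  {
    case empty
    show ?case by (simp only: r.finsum_empty sum.empty zero_bops op_alg_simps simp_thms)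
  next
    case (insert i S)
    then have "finsum op_alg h (insert i S) = h i \<oplus>\<^bsub>op_alg\<^esub> finsum op_alg h S"
      by (intro r.finsum_insert) auto
    moreover have "finsum op_alg h S = sum h S" "sum h S \<in> bops" "h i \<in> bops"
      using insert by simp_all
    ultimately show ?case
      using insert(1,2) bops_add by (simp only: sum.insert op_alg_simps simp_thms)
  }
qed

end

section \<open>Magic unitaries and quantum symmetry\<close>

text \<open>The homomorphism from the commutative universal algebra carries generators to the
  \<open>v i j\<close>, so these commute although \<open>B\<close> may be noncommutative.\<close>

lemma no_quantum_symmetry_commute:
  fixes B :: "'c cstar"
  assumes nqs: "no_quantum_symmetry TYPE('c) G" and B: "cstar_algebra B" "qut_relations G B v"
    and V: "i \<in> pverts G" "j \<in> pverts G" "k \<in> pverts G" "l \<in> pverts G"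
  shows "v i j \<otimes>\<^bsub>B\<^esub> v k l = v k l \<otimes>\<^bsub>B\<^esub> v i j"
proof -
  obtain A :: "'c cstar" and u where A: "is_C_Qut G A u"
    and comm: "\<forall>x\<in>carrier A. \<forall>y\<in>carrier A. x \<otimes>\<^bsub>A\<^esub> y = y \<otimes>\<^bsub>A\<^esub> x"
    using nqs unfolding no_quantum_symmetry_def by blast
  obtain \<phi> where \<phi>: "\<phi> \<in> star_hom A B" "\<forall>i\<in>pverts G. \<forall>j\<in>pverts G. \<phi> (u i j) = v i j"
    using A B unfolding is_C_Qut_def by blast
  have u: "u a b \<in> carrier A" if "a \<in> pverts G" "b \<in> pverts G" for a b
    using A that by (auto simp: is_C_Qut_def qut_relations_def)
  have mult: "\<phi> (x \<otimes>\<^bsub>A\<^esub> y) = \<phi> x \<otimes>\<^bsub>B\<^esub> \<phi> y" if "x \<in> carrier A" "y \<in> carrier A" for x y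
    using \<phi>(1) that by (auto simp: star_hom_def ring_hom_def)
  have "\<phi> (u i j \<otimes>\<^bsub>A\<^esub> u k l) = \<phi> (u k l \<otimes>\<^bsub>A\<^esub> u i j)"
    using comm u V by simp
  then show ?thesis using V u \<phi>(2) by (simp add: mult)
qed

context continuum_hilbert
begin

text \<open>Measurement operators are unspecified off the carrier, whereas members of
  \<open>bops\<close> vanish there.\<close>

definition zero_ext :: "(continuum \<Rightarrow> continuum) \<Rightarrow> continuum \<Rightarrow> continuum" where
  "zero_ext T = (\<lambda>x. if x \<in> carrier H then T x else 0)"

lemma zero_ext_in [simp]: "x \<in> carrier H \<Longrightarrow> zero_ext T x = T x"
  and zero_ext_out [simp]: "x \<notin> carrier H \<Longrightarrow> zero_ext T x = 0"
  by (simp_all add: zero_ext_def)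

lemma psd_zero_ext:
  assumes T: "psd_operator H T"
  shows "zero_ext T \<in> bops" "adj (zero_ext T) = zero_ext T"
proof -
  note cl = linear_opD(1)[OF psd_imp_linear_op[OF T]]
  have pair: "adjoint_pair (zero_ext T) (zero_ext T)"
    using psd_hermitian[OF T] cl by (simp add: adjoint_pair_def)
  obtain B where B: "\<And>x. x \<in> carrier H \<Longrightarrow> nrm (T x) \<le> B * nrm x"
    using T unfolding psd_operator_def bounded_operator_def by blast
  have "nrm (zero_ext T x) \<le> max 0 B * nrm x" if "x \<in> carrier H" for x
  proof -
    have "B * nrm x \<le> max 0 B * nrm x" using that by (intro mult_right_mono) auto
    then show ?thesis using B[OF that] that by simp
  qed
  then show 1: "zero_ext T \<in> bops"
    by (intro bopsI[OF _ pair, of "max 0 B"]) auto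
  show "adj (zero_ext T) = zero_ext T"
    by (rule adj_eqI[OF 1 pair]) simp
qed

text \<open>An operator is determined by its matrix with respect to a total sequence, which realizes the
  algebra of operators inside the type \<^typ>\<open>continuum\<close>.\<close>

definition matrix_code :: "(nat \<Rightarrow> continuum) \<Rightarrow> (continuum \<Rightarrow> continuum) \<Rightarrow> continuum" where
  "matrix_code d T = (\<lambda>k. T (d (fst (prod_decode k))) (snd (prod_decode k)))"

text \<open>Operators that agree on the \<open>d n\<close> have adjoints with equal coordinates,
  because the coordinates are inner products with the \<open>d n\<close>. Passing through the
  adjoint avoids any density or continuity argument.\<close>

lemma inj_on_matrix_code:
  assumes d: "\<And>n. d n \<in> carrier H" and rep: "\<And>n x. x \<in> carrier H \<Longrightarrow> ip (d n) x = x n"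
  shows "inj_on (matrix_code d) bops"
proof (rule inj_onI)
  fix S T assume S: "S \<in> bops" and T: "T \<in> bops" and eq: "matrix_code d S = matrix_code d T"
  have ST: "S (d n) = T (d n)" for n
  proof
    fix m show "S (d n) m = T (d n) m"
      using fun_cong[OF eq, of "prod_encode (n, m)"] by (simp add: matrix_code_def)
  qed
  have "adj S x = adj T x" if x: "x \<in> carrier H" for x
  proof
    fix n
    have "ip (adj S x) (d n) = ip (adj T x) (d n)"
      using x d ST adjoint_pairD(3)[OF bops_adj[OF S]] adjoint_pairD(3)[OF bops_adj[OF T]] by simp
    then have "ip (d n) (adj S x) = ip (d n) (adj T x)"
      using x d S T inner_prod_cnj[of "adj S x" "d n"] inner_prod_cnj[of "adj T x" "d n"] by simp
    then show "adj S x n = adj T x n" using rep S T by simp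
  qed
  then have "adj S = adj T" using S T by (intro bops_ext) auto
  then show "S = T" using adj_adj[OF S] adj_adj[OF T] by metis
qed

text \<open>The test algebra is the algebra of all bounded operators, moved into
  \<open>continuum\<close> by \<open>matrix_code\<close>. The hypotheses on \<open>u\<close> become
  \<open>qut_relations\<close> there, and injectivity of the code brings the resulting commutation
  back.\<close>

lemma magic_unitary_commute:
  fixes G :: "'v pair_pre_digraph"
  assumes d: "\<And>n. d n \<in> carrier H" and rep: "\<And>n x. x \<in> carrier H \<Longrightarrow> ip (d n) x = x n"
    and fin: "finite (pverts G)" and nqs: "no_quantum_symmetry TYPE(continuum) G"
    and psd: "\<And>i j. i \<in> pverts G \<Longrightarrow> j \<in> pverts G \<Longrightarrow> psd_operator H (u i j)"
    and idem: "\<And>i j x. \<lbrakk>i \<in> pverts G; j \<in> pverts G; x \<in> carrier H\<rbrakk> \<Longrightarrow> u i j (u i j x) = u i j x"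
    and row: "\<And>i x. \<lbrakk>i \<in> pverts G; x \<in> carrier H\<rbrakk> \<Longrightarrow> (\<Sum>k\<in>pverts G. u i k x) = x"
    and col: "\<And>i x. \<lbrakk>i \<in> pverts G; x \<in> carrier H\<rbrakk> \<Longrightarrow> (\<Sum>k\<in>pverts G. u k i x) = x"
    and inter: "\<And>i j x. \<lbrakk>i \<in> pverts G; j \<in> pverts G; x \<in> carrier H\<rbrakk> \<Longrightarrow>
      (\<Sum>k\<in>pverts G. cscale (adj_matrix G k j) (u i k x)) =
      (\<Sum>k\<in>pverts G. cscale (adj_matrix G i k) (u k j x))"
    and V: "i \<in> pverts G" "j \<in> pverts G" "k \<in> pverts G" "l \<in> pverts G" and x: "x \<in> carrier H"
  shows "u i j (u k l x) = u k l (u i j x)"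
proof -
  let ?V = "pverts G"
  interpret tr: cstar_transport op_alg "matrix_code d"
    using inj_on_matrix_code[OF d rep] cstar_algebra_op_alg
    by (intro cstar_transport.intro cstar_transport_axioms.intro) auto
  interpret t: ring tr.transported by (rule tr.ring_transported)
  let ?f = "matrix_code d"
  define w where "w a b = zero_ext (u a b)" for a b
  define v where "v a b = ?f (w a b)" for a b
  have w: "w a b \<in> bops" "adj (w a b) = w a b" if "a \<in> ?V" "b \<in> ?V" for a b
    using psd_zero_ext[OF psd[OF that]] by (simp_all add: w_def)
  have uin: "u a b y \<in> carrier H" if "a \<in> ?V" "b \<in> ?V" "y \<in> carrier H" for a b y
    using linear_opD(1)[OF psd_imp_linear_op[OF psd[OF that(1,2)]] that(3)] .
  have sum_apply: "sum h ?V y = (\<Sum>a\<in>?V. h a y)" for h :: "'v \<Rightarrow> continuum \<Rightarrow> continuum" and y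
    by (induction rule: infinite_finite_induct) auto
  have finsum_v: "finsum tr.transported (\<lambda>a. ?f (h a)) ?V = ?f (sum h ?V)" "sum h ?V \<in> bops"
    if "\<And>a. a \<in> ?V \<Longrightarrow> h a \<in> bops" for h
    using tr.finsum_transported[OF fin, of h] finsum_op_alg[OF fin, of h] that by simp_all
  have smult_v: "c \<odot>\<^bsub>tr.transported\<^esub> v a b = ?f (\<lambda>x. cscale c (w a b x))"
    if "a \<in> ?V" "b \<in> ?V" for a b c
    using w[OF that] by (simp add: v_def)
  have smult_w: "(\<lambda>x. cscale c (w a b x)) \<in> bops" if "a \<in> ?V" "b \<in> ?V" for a b c
    using w[OF that] bops_scale by blast
  have "qut_relations G tr.transported v"
    unfolding qut_relations_def
  proof (intro conjI ballI)
    fix a b assume ab: "a \<in> ?V" "b \<in> ?V"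
    show "v a b \<in> carrier tr.transported" using w[OF ab] by (simp add: v_def)
    show "star tr.transported (v a b) = v a b" using w[OF ab] by (simp add: v_def)
    have "w a b \<circ> w a b = w a b"
      using ab idem uin linear_opD(5)[OF psd_imp_linear_op[OF psd[OF ab]]]
      by (auto simp: fun_eq_iff w_def zero_ext_def)
    then show "v a b \<otimes>\<^bsub>tr.transported\<^esub> v a b = v a b" using w[OF ab] by (simp add: v_def)
    have "finsum tr.transported (\<lambda>k. adj_matrix G k b \<odot>\<^bsub>tr.transported\<^esub> v a k) ?V
      = finsum tr.transported (\<lambda>k. ?f (\<lambda>x. cscale (adj_matrix G k b) (w a k x))) ?V"
      using ab smult_v smult_w by (intro t.finsum_cong') auto
    also have "\<dots> = ?f (\<Sum>k\<in>?V. (\<lambda>x. cscale (adj_matrix G k b) (w a k x)))"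
      using ab smult_w by (intro finsum_v)
    also have "(\<Sum>k\<in>?V. (\<lambda>x. cscale (adj_matrix G k b) (w a k x)))
      = (\<Sum>k\<in>?V. (\<lambda>x. cscale (adj_matrix G a k) (w k b x)))"
    proof
      fix x
      show "(\<Sum>k\<in>?V. (\<lambda>x. cscale (adj_matrix G k b) (w a k x))) x
        = (\<Sum>k\<in>?V. (\<lambda>x. cscale (adj_matrix G a k) (w k b x))) x"
        unfolding sum_apply using inter[OF ab, of x]
        by (cases "x \<in> carrier H") (simp_all add: w_def cscale_simps)
    qed
    also have "?f \<dots> = finsum tr.transported (\<lambda>k. ?f (\<lambda>x. cscale (adj_matrix G a k) (w k b x))) ?V"
      using ab smult_w by (intro finsum_v(1)[symmetric])
    also have "\<dots> = finsum tr.transported (\<lambda>k. adj_matrix G a k \<odot>\<^bsub>tr.transported\<^esub> v k b) ?V"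
      using ab smult_v smult_w by (intro t.finsum_cong') auto
    finally show "(\<Oplus>\<^bsub>tr.transported\<^esub>k\<in>?V. adj_matrix G k b \<odot>\<^bsub>tr.transported\<^esub> v a k) =
      (\<Oplus>\<^bsub>tr.transported\<^esub>k\<in>?V. adj_matrix G a k \<odot>\<^bsub>tr.transported\<^esub> v k b)" .
  next
    fix a assume a: "a \<in> ?V"
    have "(\<Sum>k\<in>?V. w a k) = \<one>\<^bsub>op_alg\<^esub>" "(\<Sum>k\<in>?V. w k a) = \<one>\<^bsub>op_alg\<^esub>"
      using row[OF a] col[OF a] by (auto simp: fun_eq_iff[of "sum _ _"] sum_apply w_def zero_ext_def)
    then show "(\<Oplus>\<^bsub>tr.transported\<^esub>k\<in>?V. v a k) = \<one>\<^bsub>tr.transported\<^esub>"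
      "(\<Oplus>\<^bsub>tr.transported\<^esub>k\<in>?V. v k a) = \<one>\<^bsub>tr.transported\<^esub>"
      using finsum_v(1)[of "\<lambda>k. w a k"] finsum_v(1)[of "\<lambda>k. w k a"] w a by (simp_all add: v_def)
  qed
  then have "v i j \<otimes>\<^bsub>tr.transported\<^esub> v k l = v k l \<otimes>\<^bsub>tr.transported\<^esub> v i j"
    using no_quantum_symmetry_commute[OF nqs tr.cstar_algebra_transported] V by blast
  then have "?f (w i j \<circ> w k l) = ?f (w k l \<circ> w i j)"
    using w V by (simp add: v_def)
  then have "w i j \<circ> w k l = w k l \<circ> w i j"
    using inj_on_matrix_code[OF d rep] w V bops_comp by (simp add: inj_on_eq_iff)
  then have "(w i j \<circ> w k l) x = (w k l \<circ> w i j) x" by (rule fun_cong)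
  then show ?thesis using x uin V by (simp add: w_def)
qed

end

section \<open>The automorphism game\<close>

lemma pverts_disjoint_union [simp]: "pverts (disjoint_union G H) = pverts G <+> pverts H"
  by (simp add: disjoint_union_def)

lemma rel_disjoint_union [simp]:
  "rel (disjoint_union G H) (Inl a) (Inl b) = rel G a b"
  "rel (disjoint_union G H) (Inr c) (Inr d) = rel H c d"
  "rel (disjoint_union G H) (Inl a) (Inr d) = Distinct_Nonadjacent"
  "rel (disjoint_union G H) (Inr c) (Inl b) = Distinct_Nonadjacent"
  by (auto simp: rel_def disjoint_union_def)

lemma rel_eq_Equal_iff: "rel G a b = Equal \<longleftrightarrow> a = b"
  by (simp add: rel_def)

lemma pair_graph_sym: "pair_graph G \<Longrightarrow> (a, b) \<in> parcs G \<Longrightarrow> (b, a) \<in> parcs G"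
proof -
  assume "pair_graph G" and ab: "(a, b) \<in> parcs G"
  then interpret pair_graph G by simp
  show ?thesis using ab by (rule graph_symmetric)
qed

lemma pair_graph_no_loop: "pair_graph G \<Longrightarrow> (a, a) \<notin> parcs G"
  using pair_loopfree_digraph.pair_no_loops pair_graph.axioms(1) pair_digraph.axioms(2) by fastforce

lemma pair_graph_finite: "pair_graph G \<Longrightarrow> finite (pverts G)"
  using pair_fin_digraph.pair_finite_verts pair_graph.axioms(1) pair_digraph.axioms(1) by blast

lemma pair_graph_arc_verts:
  "pair_graph G \<Longrightarrow> (a, b) \<in> parcs G \<Longrightarrow> a \<in> pverts G \<and> b \<in> pverts G"
proof -
  assume "pair_graph G" and ab: "(a, b) \<in> parcs G"
  then interpret pair_graph G by simp
  show ?thesis using ab wellformed' by blast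
qed

lemma rel_commute: "pair_graph G \<Longrightarrow> rel G a b = rel G b a"
  using pair_graph_sym[of G a b] pair_graph_sym[of G b a] by (auto simp: rel_def)

lemma rel_eq_Adjacent_iff: "pair_graph G \<Longrightarrow> rel G a b = Adjacent \<longleftrightarrow> (a, b) \<in> parcs G"
  using pair_graph_no_loop[of G a] by (auto simp: rel_def)

lemma rel_imp_adj_matrix_eq:
  "pair_graph G \<Longrightarrow> rel G a b = rel G c d \<Longrightarrow> adj_matrix G a b = adj_matrix G c d"
  unfolding adj_matrix_def using rel_eq_Adjacent_iff by metis

lemma connected_constant:
  assumes G: "pair_graph G" and conn: "Digraph_Component.connected (with_proj G)"
    and f: "\<And>a b. (a, b) \<in> parcs G \<Longrightarrow> f a = f b"
    and ab: "a \<in> pverts G" "b \<in> pverts G"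
  shows "f a = f b"
proof -
  let ?S = "with_proj (mk_symmetric (with_proj G))"
  have "a \<rightarrow>\<^sup>*\<^bsub>?S\<^esub> b"
    using conn ab by (auto simp: connected_def strongly_connected_def)
  then have "(a, b) \<in> rtrancl_on (pverts G) (parcs (mk_symmetric (with_proj G)))"
    by (simp add: reachable_def)
  then show ?thesis
  proof (induction rule: rtrancl_on_induct)
    case (step x y)
    then have "(x, y) \<in> parcs (mk_symmetric (with_proj G))" by simp
    \<comment> \<open>Connectedness refers to the symmetrized digraph, so a step may follow an arc
      backwards.\<close>
    then have "(x, y) \<in> parcs G \<or> (y, x) \<in> parcs G"
      by (auto simp: mk_symmetric_def)
    then show ?case using step f by metis
  qed simp
qed

lemma connected_nonempty: "Digraph_Component.connected (with_proj G) \<Longrightarrow> pverts G \<noteq> {}"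
  by (auto simp: connected_def strongly_connected_def)

text \<open>Symmetry of \<open>rel\<close> takes the place of \<open>pair_graph G\<close>; for the
  disjoint union it is inherited directly from the two graphs.\<close>

locale automorphism_model = cyclic_model H "pverts G" "pverts G" \<psi> M N d
  for H :: "continuum hilbert" (structure) and G :: "'v pair_pre_digraph" and \<psi> M N d +
  assumes rel_sym: "rel G a b = rel G b a"
    and win: "\<lbrakk>i \<in> pverts G; j \<in> pverts G; l \<in> pverts G; k \<in> pverts G; rel G i j \<noteq> rel G l k\<rbrakk> \<Longrightarrow>
      ip \<psi> (M i l (N j k \<psi>)) = 0"

text \<open>\<open>rel\<close> distinguishes equal from distinct vertices, on the side of the
  questions as on that of the answers, so both orthogonality conditions are instances of
  \<open>win\<close>.\<close>

sublocale automorphism_model \<subseteq> bisynchronous_model H "pverts G" \<psi> M N d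
  by unfold_locales (metis win rel_eq_Equal_iff)+

context automorphism_model
begin

lemma M_rel:
  assumes "i \<in> pverts G" "j \<in> pverts G" "l \<in> pverts G" "k \<in> pverts G" "rel G i j \<noteq> rel G l k"
    "x \<in> carrier H"
  shows "M i l (M j k x) = 0"
  using assms win[of j i k l] by (intro M_orth) (auto simp: rel_sym[of j i] rel_sym[of k l])

text \<open>Let \<open>p i\<close> be the sum over \<open>B\<close> in row \<open>i\<close>. A
  product of entries from rows \<open>i\<close> and \<open>j\<close> with answers in different
  blocks is 0, since adjacent questions would get nonadjacent answers. Inserting the complete other
  row thus shows that \<open>p i = p i p j = p j\<close>.\<close>

lemma block_adjacent:
  assumes AB: "A \<union> B = pverts G" "A \<inter> B = {}"
    and cross: "\<And>l k. l \<in> B \<Longrightarrow> k \<in> A \<Longrightarrow> rel G l k = Distinct_Nonadjacent"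
    and ij: "i \<in> A" "j \<in> A" "rel G i j = Adjacent" and x: "x \<in> carrier H"
  shows "(\<Sum>l\<in>B. M i l x) = (\<Sum>l\<in>B. M j l x)"
proof -
  have fin: "finite A" "finite B" using finite_V AB(1) by (metis finite_Un)+
  have V: "a \<in> pverts G" if "a \<in> A \<or> a \<in> B" for a using AB that by auto
  have split: "sum h (pverts G) = sum h A + sum h B" for h :: "'v \<Rightarrow> continuum"
    using AB fin sum.union_disjoint[of A B h] by simp
  have z1: "M i l (M j k x) = 0" if "l \<in> B" "k \<in> A" for l k
    using that ij x cross[OF that] V by (intro M_rel) auto
  have z2: "M i l (M j k x) = 0" if "l \<in> A" "k \<in> B" for l k
    using that ij x cross[of k l] V by (intro M_rel) (auto simp: rel_sym[of l k])
  have "(\<Sum>l\<in>B. M i l x) = (\<Sum>l\<in>B. M i l (\<Sum>k\<in>pverts G. M j k x))"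
    using ij V x by (simp add: M_row)
  also have "\<dots> = (\<Sum>l\<in>B. \<Sum>k\<in>pverts G. M i l (M j k x))"
    using ij V x by (intro sum.cong refl linear_op_sum M_linear) auto
  also have "\<dots> = (\<Sum>l\<in>B. \<Sum>k\<in>B. M i l (M j k x))"
    by (simp add: split z1)
  also have "\<dots> = (\<Sum>k\<in>B. \<Sum>l\<in>B. M i l (M j k x))" by (rule sum.swap)
  also have "\<dots> = (\<Sum>k\<in>B. \<Sum>l\<in>pverts G. M i l (M j k x))"
    by (simp add: split z2)
  also have "\<dots> = (\<Sum>k\<in>B. M j k x)"
    using ij V x by (intro sum.cong refl M_row) auto
  finally show ?thesis .
qed

end

section \<open>Sums and coarse-grainings of positive operators; intertwining\<close>

context continuum_hilbert
begin

lemma psd_add: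
  assumes S: "psd_operator H S" and T: "psd_operator H T"
  shows "psd_operator H (\<lambda>x. S x + T x)"
proof -
  note s = linear_opD[OF psd_imp_linear_op[OF S]] and t = linear_opD[OF psd_imp_linear_op[OF T]]
  obtain B where B: "\<And>x. x \<in> carrier H \<Longrightarrow> nrm (S x) \<le> B * nrm x"
    using S unfolding psd_operator_def bounded_operator_def by blast
  obtain C where C: "\<And>x. x \<in> carrier H \<Longrightarrow> nrm (T x) \<le> C * nrm x"
    using T unfolding psd_operator_def bounded_operator_def by blast
  have "nrm (S x + T x) \<le> (B + C) * nrm x" if "x \<in> carrier H" for x
    using nrm_triangle[OF s(1) t(1), OF that that] B[OF that] C[OF that]
    by (simp add: distrib_right)
  moreover have "ip x (S x + T x) \<in> \<real>\<^sub>\<ge>\<^sub>0" if "x \<in> carrier H" for x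
    using S T that s t by (simp add: psd_operator_def)
  ultimately show ?thesis
    unfolding psd_operator_def bounded_operator_def
    using s t by (auto simp: add_H smult_H cscale_simps)
qed

lemma psd_zero: "psd_operator H (\<lambda>x. 0)"
  by (auto simp: psd_operator_def bounded_operator_def add_H smult_H cscale_simps intro!: exI[of _ 0])

lemma psd_sum:
  "(\<And>i. i \<in> S \<Longrightarrow> psd_operator H (F i)) \<Longrightarrow> psd_operator H (\<lambda>x. \<Sum>i\<in>S. F i x)"
  by (induction S rule: infinite_finite_induct) (simp_all add: psd_add psd_zero)

text \<open>Relabelling answers along \<open>f\<close>: this turns measurements with answers in both
  graphs into measurements with answers in \<open>G2\<close> only.\<close>

lemma povm_coarse_graining:
  assumes W: "finite W" and W': "finite W'" and F: "povm H W F" and f: "f ` W \<subseteq> W'"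
  shows "povm H W' (\<lambda>h x. \<Sum>k\<in>{k \<in> W. f k = h}. F k x)"
  unfolding povm_def
proof (intro conjI ballI)
  show "psd_operator H (\<lambda>x. \<Sum>k\<in>{k \<in> W. f k = h}. F k x)" for h
    using povm_psd[OF W F] by (intro psd_sum) auto
  fix x assume x: "x \<in> carrier H"
  have "finsum H (\<lambda>h. \<Sum>k\<in>{k \<in> W. f k = h}. F k x) W' = (\<Sum>h\<in>W'. \<Sum>k\<in>{k \<in> W. f k = h}. F k x)"
    using W' x povm_in[OF W F] by (intro finsum_eq_sum sum_in) auto
  also have "\<dots> = x" using sum.group[OF W W' f, of "\<lambda>k. F k x"] povm_sum[OF W F x] by simp
  finally show "(\<Oplus>h\<in>W'. \<Sum>k\<in>{k \<in> W. f k = h}. F k x) = x" .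
qed

text \<open>The intertwining relation \<open>UA = AU\<close> follows from the vanishing of the products that belong to
  losing answers.\<close>

lemma rel_orthogonal_commute:
  fixes G :: "'v pair_pre_digraph"
  assumes G: "pair_graph G"
    and d: "\<And>n. d n \<in> carrier H" and rep: "\<And>n x. x \<in> carrier H \<Longrightarrow> ip (d n) x = x n"
    and nqs: "no_quantum_symmetry TYPE(continuum) G"
    and psd: "\<And>i j. i \<in> pverts G \<Longrightarrow> j \<in> pverts G \<Longrightarrow> psd_operator H (u i j)"
    and idem: "\<And>i j x. \<lbrakk>i \<in> pverts G; j \<in> pverts G; x \<in> carrier H\<rbrakk> \<Longrightarrow> u i j (u i j x) = u i j x"
    and row: "\<And>i x. \<lbrakk>i \<in> pverts G; x \<in> carrier H\<rbrakk> \<Longrightarrow> (\<Sum>k\<in>pverts G. u i k x) = x"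
    and col: "\<And>i x. \<lbrakk>i \<in> pverts G; x \<in> carrier H\<rbrakk> \<Longrightarrow> (\<Sum>k\<in>pverts G. u k i x) = x"
    and orth: "\<And>i j l k x. \<lbrakk>i \<in> pverts G; j \<in> pverts G; l \<in> pverts G; k \<in> pverts G;
      rel G i j \<noteq> rel G l k; x \<in> carrier H\<rbrakk> \<Longrightarrow> u i l (u j k x) = 0"
    and V: "i \<in> pverts G" "j \<in> pverts G" "k \<in> pverts G" "l \<in> pverts G" and x: "x \<in> carrier H"
  shows "u i j (u k l x) = u k l (u i j x)"
proof (rule magic_unitary_commute[OF d rep pair_graph_finite[OF G] nqs psd idem row col _ V x])
  fix i j x assume ij: "i \<in> pverts G" "j \<in> pverts G" and x: "x \<in> carrier H"
  let ?V = "pverts G" and ?A = "adj_matrix G"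
  have lin: "linear_op (u a b)" if "a \<in> ?V" "b \<in> ?V" for a b
    using psd[OF that] by (rule psd_imp_linear_op)
  have cl: "u a b y \<in> carrier H" if "a \<in> ?V" "b \<in> ?V" "y \<in> carrier H" for a b y
    using lin[OF that(1,2)] that linear_opD(1) by blast
  have csum: "cscale c (sum h S) = (\<Sum>s\<in>S. cscale c (h s))" for c and h :: "'v \<Rightarrow> continuum" and S
    by (induction S rule: infinite_finite_induct)
      (simp_all add: cscale_simps del: zero_fun_apply plus_fun_apply)
  have swap: "cscale (?A k j) (u i k (u m j x)) = cscale (?A i m) (u i k (u m j x))"
    if "k \<in> ?V" "m \<in> ?V" for k m
  proof (cases "rel G i m = rel G k j")
    case True
    then show ?thesis using rel_imp_adj_matrix_eq[OF G True] by simp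
  next
    case False
    then show ?thesis using orth[OF ij(1) that(2,1) ij(2) False x] by (simp add: cscale_simps)
  qed
  have "(\<Sum>k\<in>?V. cscale (?A k j) (u i k x)) = (\<Sum>k\<in>?V. cscale (?A k j) (u i k (\<Sum>m\<in>?V. u m j x)))"
    using ij x by (simp add: col)
  also have "\<dots> = (\<Sum>k\<in>?V. \<Sum>m\<in>?V. cscale (?A k j) (u i k (u m j x)))"
  proof (rule sum.cong[OF refl])
    fix k assume k: "k \<in> ?V"
    show "cscale (?A k j) (u i k (\<Sum>m\<in>?V. u m j x)) = (\<Sum>m\<in>?V. cscale (?A k j) (u i k (u m j x)))"
      using ij x cl linear_op_sum[OF lin[OF ij(1) k], of ?V "\<lambda>m. u m j x"] by (simp add: csum)
  qed
  also have "\<dots> = (\<Sum>k\<in>?V. \<Sum>m\<in>?V. cscale (?A i m) (u i k (u m j x)))"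
    by (intro sum.cong refl swap)
  also have "\<dots> = (\<Sum>m\<in>?V. \<Sum>k\<in>?V. cscale (?A i m) (u i k (u m j x)))" by (rule sum.swap)
  also have "\<dots> = (\<Sum>m\<in>?V. cscale (?A i m) (u m j x))"
    using ij x cl by (simp add: csum[symmetric] row)
  finally show "(\<Sum>k\<in>?V. cscale (?A k j) (u i k x)) = (\<Sum>k\<in>?V. cscale (?A i k) (u k j x))" .
qed

end

section \<open>Block structure for a disjoint union\<close>

lemma Inl_Plus_iff [simp]: "Inl a \<in> A <+> B \<longleftrightarrow> a \<in> A"
  and Inr_Plus_iff [simp]: "Inr b \<in> A <+> B \<longleftrightarrow> b \<in> B"
  by auto

locale union_model = automorphism_model H "disjoint_union G1 G2" \<psi> M N d
  for H :: "continuum hilbert" (structure) and G1 :: "'a pair_pre_digraph"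
    and G2 :: "'b pair_pre_digraph" and \<psi> M N d +
  assumes graph1: "pair_graph G1" and graph2: "pair_graph G2"
    and connected1: "Digraph_Component.connected (with_proj G1)"
    and connected2: "Digraph_Component.connected (with_proj G2)"
    and not_qi: "\<not> quantum_isomorphic TYPE(continuum) G1 G2"
    and nqs1: "no_quantum_symmetry TYPE(continuum) G1"
    and nqs2: "no_quantum_symmetry TYPE(continuum) G2"
begin

abbreviation V1 where "V1 \<equiv> pverts G1"
abbreviation V2 where "V2 \<equiv> pverts G2"

lemma fin1 [simp]: "finite V1" and fin2 [simp]: "finite V2"
  using graph1 graph2 by (auto intro: pair_graph_finite)

lemma sum_verts: "(\<Sum>v\<in>V1 <+> V2. h v) = (\<Sum>a\<in>V1. h (Inl a)) + (\<Sum>b\<in>V2. h (Inr b))"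
  for h :: "'a + 'b \<Rightarrow> 'z::comm_monoid_add"
  by (subst sum.Plus) auto

lemma row_split:
  "\<lbrakk>v \<in> V1 <+> V2; x \<in> carrier H\<rbrakk> \<Longrightarrow> (\<Sum>a\<in>V1. M v (Inl a) x) + (\<Sum>b\<in>V2. M v (Inr b) x) = x"
  using M_row[of v x] by (simp add: sum_verts)

lemma col_split:
  "\<lbrakk>v \<in> V1 <+> V2; x \<in> carrier H\<rbrakk> \<Longrightarrow> (\<Sum>a\<in>V1. M (Inl a) v x) + (\<Sum>b\<in>V2. M (Inr b) v x) = x"
  using M_col[of x v] by (simp add: sum_verts)

lemma to_V2_constant:
  assumes "a \<in> V1" "a' \<in> V1" and x: "x \<in> carrier H"
  shows "(\<Sum>b\<in>V2. M (Inl a) (Inr b) x) = (\<Sum>b\<in>V2. M (Inl a') (Inr b) x)"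
proof (rule connected_constant[OF graph1 connected1 _ assms(1,2)])
  fix u v assume uv: "(u, v) \<in> parcs G1"
  then have "u \<in> V1" "v \<in> V1" "rel G1 u v = Adjacent"
    using graph1 by (auto simp: rel_eq_Adjacent_iff dest: pair_graph_arc_verts)
  then have "(\<Sum>l\<in>Inr ` V2. M (Inl u) l x) = (\<Sum>l\<in>Inr ` V2. M (Inl v) l x)"
    using x by (intro block_adjacent[of "Inl ` V1"]) auto
  then show "(\<Sum>b\<in>V2. M (Inl u) (Inr b) x) = (\<Sum>b\<in>V2. M (Inl v) (Inr b) x)"
    by (simp add: sum.reindex)
qed

lemma to_V1_constant:
  assumes "b \<in> V2" "b' \<in> V2" and x: "x \<in> carrier H"
  shows "(\<Sum>a\<in>V1. M (Inr b) (Inl a) x) = (\<Sum>a\<in>V1. M (Inr b') (Inl a) x)"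
proof (rule connected_constant[OF graph2 connected2 _ assms(1,2)])
  fix u v assume uv: "(u, v) \<in> parcs G2"
  then have "u \<in> V2" "v \<in> V2" "rel G2 u v = Adjacent"
    using graph2 by (auto simp: rel_eq_Adjacent_iff dest: pair_graph_arc_verts)
  then have "(\<Sum>l\<in>Inl ` V1. M (Inr u) l x) = (\<Sum>l\<in>Inl ` V1. M (Inr v) l x)"
    using x by (intro block_adjacent[of "Inr ` V2"]) auto
  then show "(\<Sum>a\<in>V1. M (Inr u) (Inl a) x) = (\<Sum>a\<in>V1. M (Inr v) (Inl a) x)"
    by (simp add: sum.reindex)
qed

lemma sum_orth_right:
  assumes "v \<in> V1 <+> V2" "l \<in> V1 <+> V2" "S \<subseteq> V1 <+> V2" "x \<in> carrier H"
  shows "M v l (\<Sum>k\<in>S. M v k x) = (if l \<in> S then M v l x else 0)"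
proof -
  have "finite S" using assms(3) by (rule finite_subset) simp
  have "M v l (\<Sum>k\<in>S. M v k x) = (\<Sum>k\<in>S. M v l (M v k x))"
    using assms by (intro linear_op_sum M_linear) auto
  also have "\<dots> = (\<Sum>k\<in>S. if k = l then M v l x else 0)"
    using assms by (intro sum.cong) (auto simp: M_idem intro!: M_row_orth)
  finally show ?thesis using \<open>finite S\<close> by simp
qed

lemma M_block_sum:
  assumes "v \<in> V1 <+> V2" "x \<in> carrier H"
  shows "a \<in> V1 \<Longrightarrow> M v (Inl a) (\<Sum>b\<in>V2. M v (Inr b) x) = 0"
    and "b \<in> V2 \<Longrightarrow> M v (Inr b) (\<Sum>b\<in>V2. M v (Inr b) x) = M v (Inr b) x"
    and "a \<in> V1 \<Longrightarrow> M v (Inl a) (\<Sum>a\<in>V1. M v (Inl a) x) = M v (Inl a) x"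
proof -
  have "Inl ` V1 \<subseteq> V1 <+> V2" "Inr ` V2 \<subseteq> V1 <+> V2" by auto
  note s = sum_orth_right[OF assms(1) _ this(1) assms(2)] sum_orth_right[OF assms(1) _ this(2) assms(2)]
  have n: "Inl a \<notin> Inr ` V2" for a :: 'a by auto
  show "a \<in> V1 \<Longrightarrow> M v (Inl a) (\<Sum>b\<in>V2. M v (Inr b) x) = 0"
    using s(2)[of "Inl a"] n by (simp add: sum.reindex)
  show "b \<in> V2 \<Longrightarrow> M v (Inr b) (\<Sum>b\<in>V2. M v (Inr b) x) = M v (Inr b) x"
    using s(2)[of "Inr b"] by (simp add: sum.reindex)
  show "a \<in> V1 \<Longrightarrow> M v (Inl a) (\<Sum>a\<in>V1. M v (Inl a) x) = M v (Inl a) x"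
    using s(1)[of "Inl a"] by (simp add: sum.reindex)
qed

text \<open>A sum of equal vectors simplifies to a product with \<open>of_nat n\<close> in the
  pointwise ring of functions; this rewrites it as a scalar multiple.\<close>

lemma of_nat_mult_eq: "of_nat n * (x :: continuum) = cscale (of_nat n) x"
  by (simp add: fun_eq_iff cscale_def of_nat_fun)

text \<open>The vector \<open>p \<psi>\<close>, where \<open>p\<close> is the part of the unit that maps \<open>G1\<close> to \<open>G2\<close>.\<close>

definition transfer :: continuum where
  "transfer = (\<Sum>b\<in>V2. M (Inl (SOME a. a \<in> V1)) (Inr b) \<psi>)"

lemma transfer_eq: "a \<in> V1 \<Longrightarrow> transfer = (\<Sum>b\<in>V2. M (Inl a) (Inr b) \<psi>)"
  unfolding transfer_def by (rule to_V2_constant) (auto intro: someI)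

lemma transfer_in [simp]: "transfer \<in> carrier H"
proof -
  obtain a where "a \<in> V1" using connected_nonempty[OF connected1] by blast
  then show ?thesis by (auto simp: transfer_eq intro!: sum_in)
qed

lemma M_transfer:
  "a \<in> V1 \<Longrightarrow> a' \<in> V1 \<Longrightarrow> M (Inl a) (Inl a') transfer = 0"
  "a \<in> V1 \<Longrightarrow> b \<in> V2 \<Longrightarrow> M (Inl a) (Inr b) transfer = M (Inl a) (Inr b) \<psi>"
  by (simp_all add: transfer_eq[of a] M_block_sum)

text \<open>\<open>N\<close> passes the \<open>M\<close> in the defining sum and becomes an
  \<open>M\<close> at \<psi>, where row orthogonality selects a single term.\<close>

lemma N_transfer:
  assumes a: "a \<in> V1" and v: "v \<in> V1 <+> V2"
  shows "N (Inl a) v transfer = (case v of Inl _ \<Rightarrow> 0 | Inr b \<Rightarrow> M (Inl a) (Inr b) \<psi>)"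
proof -
  have "N (Inl a) v transfer = (\<Sum>b\<in>V2. N (Inl a) v (M (Inl a) (Inr b) \<psi>))"
    using a v by (simp add: transfer_eq[OF a]) (auto intro!: linear_op_sum N_linear)
  also have "\<dots> = (\<Sum>b\<in>V2. M (Inl a) (Inr b) (M (Inl a) v \<psi>))"
    using a v by (intro sum.cong) (simp_all add: MN_commute[symmetric] N_psi)
  also have "\<dots> = (\<Sum>b\<in>V2. if v = Inr b then M (Inl a) v \<psi> else 0)"
    using a v by (intro sum.cong) (auto simp: M_idem intro!: M_row_orth)
  also have "\<dots> = (case v of Inl _ \<Rightarrow> 0 | Inr b \<Rightarrow> M (Inl a) (Inr b) \<psi>)"
    using v by (cases v) auto
  finally show ?thesis .
qed

text \<open>\<open>quantum_isomorphic\<close> also demands equal cardinalities. Write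
  \<open>x\<close> for \<open>transfer\<close> and add up the entries from \<open>V2\<close> to
  \<open>V1\<close> at \<open>x\<close>. By columns each gives \<open>x\<close>, as the entries
  within \<open>V1\<close> vanish at \<open>x\<close>; by rows each gives \<open>Q x\<close>. So
  \<open>n x = m Q x\<close>. Applying the idempotent \<open>Q\<close> yields
  \<open>Q x = x\<close>, and then \<open>n = m\<close>.\<close>

lemma card_eq_of_transfer:
  assumes nz: "transfer \<noteq> 0"
  shows "card V1 = card V2"
proof -
  let ?x = "transfer" and ?n = "of_nat (card V1) :: complex" and ?m = "of_nat (card V2) :: complex"
  obtain b0 where b0: "b0 \<in> V2" using connected_nonempty[OF connected2] by blast
  define Q where "Q y = (\<Sum>a\<in>V1. M (Inr b0) (Inl a) y)" for y
  have Qin: "Q y \<in> carrier H" if "y \<in> carrier H" for y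
    using that b0 by (auto simp: Q_def intro!: sum_in)
  have Qlin: "linear_op Q"
    using b0 unfolding Q_def[abs_def] by (intro psd_imp_linear_op psd_sum M_psd) auto
  have QQ: "Q (Q y) = Q y" if y: "y \<in> carrier H" for y
    using b0 y M_block_sum(3)[of "Inr b0" y] unfolding Q_def by (intro sum.cong) auto
  have "cscale ?n ?x = (\<Sum>a\<in>V1. ?x)" by (simp add: of_nat_mult_eq)
  also have "\<dots> = (\<Sum>a\<in>V1. \<Sum>b\<in>V2. M (Inr b) (Inl a) ?x)"
  proof (rule sum.cong[OF refl])
    fix a assume a: "a \<in> V1"
    have "(\<Sum>a'\<in>V1. M (Inl a') (Inl a) ?x) = 0"
      using a M_transfer(1) by (intro sum.neutral) auto
    then show "?x = (\<Sum>b\<in>V2. M (Inr b) (Inl a) ?x)" using col_split[of "Inl a" ?x] a by simp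
  qed
  also have "\<dots> = (\<Sum>b\<in>V2. \<Sum>a\<in>V1. M (Inr b) (Inl a) ?x)" by (rule sum.swap)
  also have "\<dots> = (\<Sum>b\<in>V2. Q ?x)"
    unfolding Q_def by (intro sum.cong refl to_V1_constant b0) auto
  also have "\<dots> = cscale ?m (Q ?x)" by (simp add: of_nat_mult_eq)
  finally have 1: "cscale ?n ?x = cscale ?m (Q ?x)" .
  then have "cscale ?n (Q ?x) = cscale ?m (Q (Q ?x))"
    using Qin by (simp add: linear_opD(4)[OF Qlin, symmetric])
  then have "cscale ?n (Q ?x) = cscale ?n ?x" using QQ 1 by simp
  moreover have "?n \<noteq> 0" using connected_nonempty[OF connected1] by simp
  ultimately have "Q ?x = ?x" by (auto simp: cscale_def fun_eq_iff)
  then have 2: "cscale ?n ?x = cscale ?m ?x" using 1 by simp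
  obtain k where "?x k \<noteq> 0" using nz by (auto simp: fun_eq_iff)
  then have "?n = ?m" using fun_cong[OF 2, of k] by (simp add: cscale_def)
  then show ?thesis by simp
qed

lemma transfer_eq_zero: "transfer = 0"
proof (rule ccontr)
  assume nz: "transfer \<noteq> 0"
  define x where "x = transfer"
  obtain b0 where b0: "b0 \<in> V2" using connected_nonempty[OF connected2] by blast
  \<comment> \<open>The rows of \<open>G1\<close> may also answer inside \<open>V1\<close>. Merging
    these answers into \<open>b0\<close> gives complete measurements with answers in
    \<open>V2\<close>. At \<open>transfer\<close> the merged entries are 0, so the choice of
    \<open>b0\<close> does not affect the correlation.\<close>
  define f where "f = case_sum (\<lambda>_::'a. b0) (\<lambda>b::'b. b)"
  define M' where "M' a h y = (\<Sum>v\<in>{v \<in> V1 <+> V2. f v = h}. M (Inl a) v y)" for a h y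
  define N' where "N' a h y = (\<Sum>v\<in>{v \<in> V1 <+> V2. f v = h}. N (Inl a) v y)" for a h y
  define \<phi> where "\<phi> = cscale (1 / nrm x) x"
  \<comment> \<open>Correlations are real-valued by type; \<open>p_complex\<close> shows that taking
    the real part loses nothing.\<close>
  define p where "p h h' g g' = Re (ip \<phi> (M' g h (N' g' h' \<phi>)))" for h h' g g'
  have x: "x \<in> carrier H" "x \<noteq> 0" using nz by (auto simp: x_def)
  then have nx: "nrm x > 0" using nrm_eq_zero[of x] nrm_nonneg[of x] by linarith
  have phi: "\<phi> \<in> carrier H" "nrm \<phi> = 1"
    using x nx by (auto simp: \<phi>_def nrm_cscale norm_divide)
  have f: "f ` (V1 <+> V2) \<subseteq> V2" using b0 by (auto simp: f_def)
  have povm_Inl: "povm H (V1 <+> V2) (M (Inl a))" "povm H (V1 <+> V2) (N (Inl a))" if "a \<in> V1" for a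
    using povm_M[of "Inl a"] povm_N[of "Inl a"] that by simp_all
  have povm_M': "povm H V2 (M' a)" and povm_N': "povm H V2 (N' a)" if "a \<in> V1" for a
    using povm_coarse_graining[OF _ fin2 povm_Inl(1)[OF that] f]
      povm_coarse_graining[OF _ fin2 povm_Inl(2)[OF that] f]
    unfolding M'_def[abs_def] N'_def[abs_def] by auto
  note M'_in = povm_in[OF fin2 povm_M'] and N'_in = povm_in[OF fin2 povm_N']
  have comm1: "M' g h (N (Inl g') v y) = N (Inl g') v (M' g h y)"
    if "g \<in> V1" "h \<in> V2" "g' \<in> V1" "v \<in> V1 <+> V2" "y \<in> carrier H" for g h g' v y
  proof -
    have "N (Inl g') v (M' g h y) = (\<Sum>w\<in>{w \<in> V1 <+> V2. f w = h}. N (Inl g') v (M (Inl g) w y))"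
      unfolding M'_def using that by (intro linear_op_sum N_linear) auto
    also have "\<dots> = M' g h (N (Inl g') v y)"
      unfolding M'_def using that by (intro sum.cong) (auto simp: MN_commute)
    finally show ?thesis by simp
  qed
  have comm: "M' g h (N' g' h' y) = N' g' h' (M' g h y)"
    if "g \<in> V1" "h \<in> V2" "g' \<in> V1" "h' \<in> V2" "y \<in> carrier H" for g h g' h' y
  proof -
    have "M' g h (N' g' h' y) = (\<Sum>v\<in>{v \<in> V1 <+> V2. f v = h'}. M' g h (N (Inl g') v y))"
      unfolding N'_def using that
      by (intro linear_op_sum povm_linear[OF fin2 povm_M']) auto
    also have "\<dots> = N' g' h' (M' g h y)"
      unfolding N'_def using that by (intro sum.cong) (auto simp: comm1)
    finally show ?thesis .
  qed
  have fibre: "(\<Sum>v\<in>{v \<in> V1 <+> V2. f v = h}. F v) = F (Inr h)"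
    if "h \<in> V2" "\<And>a. a \<in> V1 \<Longrightarrow> F (Inl a) = 0" for F :: "'a + 'b \<Rightarrow> continuum" and h
  proof -
    have "(\<Sum>v\<in>{v \<in> V1 <+> V2. f v = h}. F v) = (\<Sum>v\<in>{Inr h}. F v)"
      using that by (intro sum.mono_neutral_right) (auto simp: f_def)
    then show ?thesis by simp
  qed
  have prod_eq: "ip x (M' g h (N' g' h' x)) = ip \<psi> (M (Inl g) (Inr h) (M (Inl g') (Inr h') \<psi>))"
    if V: "g \<in> V1" "h \<in> V2" "g' \<in> V1" "h' \<in> V2" for g h g' h'
  proof -
    have n: "N' g' h' x = M (Inl g') (Inr h') \<psi>"
      unfolding N'_def x_def using V by (subst fibre) (auto simp: N_transfer)
    have m: "M' g h x = M (Inl g) (Inr h) \<psi>"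
      unfolding M'_def x_def using V by (subst fibre) (auto simp: M_transfer)
    have "ip x (M' g h (N' g' h' x)) = ip (M' g h x) (N' g' h' x)"
      using V x N'_in by (simp add: povm_herm[OF fin2 povm_M'])
    also have "\<dots> = ip \<psi> (M (Inl g) (Inr h) (M (Inl g') (Inr h') \<psi>))"
      unfolding n m using V by (simp add: M_herm)
    finally show ?thesis .
  qed
  have scaled: "ip \<phi> (M' g h (N' g' h' \<phi>)) = ip x (M' g h (N' g' h' x)) / (nrm x)\<^sup>2"
    if "g \<in> V1" "h \<in> V2" "g' \<in> V1" "h' \<in> V2" for g h g' h'
    using that x M'_in N'_in linear_opD(4)[OF povm_linear[OF fin2 povm_M']]
      linear_opD(4)[OF povm_linear[OF fin2 povm_N']]
    by (simp add: \<phi>_def power2_eq_square)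
  have nonneg: "ip x (M' g h (N' g' h' x)) \<in> \<real>\<^sub>\<ge>\<^sub>0"
    if V: "g \<in> V1" "h \<in> V2" "g' \<in> V1" "h' \<in> V2" for g h g' h'
  proof -
    let ?y = "M (Inl g) (Inr h) \<psi>"
    \<comment> \<open>Idempotency supplies a second copy of \<open>M (Inl g) (Inr h)\<close> next to
      \<psi>, so that the value becomes a quadratic form of a positive \<open>N\<close>.\<close>
    have "ip x (M' g h (N' g' h' x)) = ip \<psi> (M (Inl g) (Inr h) (N (Inl g') (Inr h') ?y))"
      using V by (simp add: prod_eq N_psi[symmetric] MN_commute[symmetric]) 
        (simp add: N_psi MN_commute[symmetric] M_idem)
    also have "\<dots> = ip ?y (N (Inl g') (Inr h') ?y)" using V by (simp add: M_herm)
    also have "\<dots> \<in> \<real>\<^sub>\<ge>\<^sub>0"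
      using povm_psd[OF _ povm_N, of "Inl g'" "Inr h'"] V unfolding psd_operator_def by simp
    finally show ?thesis .
  qed
  have p_complex: "complex_of_real (p h h' g g') = ip \<phi> (M' g h (N' g' h' \<phi>)) \<and> 0 \<le> p h h' g g'"
    if V: "g \<in> V1" "h \<in> V2" "g' \<in> V1" "h' \<in> V2" for g h g' h'
  proof -
    have "ip \<phi> (M' g h (N' g' h' \<phi>)) \<in> \<real>\<^sub>\<ge>\<^sub>0"
      unfolding scaled[OF V] using nonneg[OF V]
      by (intro nonneg_Reals_divide_I) (simp_all flip: of_real_power)
    then show ?thesis by (simp add: p_def complex_nonneg_Reals_iff complex_eq_iff)
  qed
  have p_sum: "(\<Sum>h\<in>V2. \<Sum>h'\<in>V2. p h h' g g') = 1" if V: "g \<in> V1" "g' \<in> V1" for g g'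
  proof -
    have "(\<Sum>h\<in>V2. \<Sum>h'\<in>V2. ip \<phi> (M' g h (N' g' h' \<phi>))) = (\<Sum>h\<in>V2. ip \<phi> (M' g h \<phi>))"
    proof (rule sum.cong[OF refl])
      fix h assume h: "h \<in> V2"
      have "(\<Sum>h'\<in>V2. M' g h (N' g' h' \<phi>)) = M' g h (\<Sum>h'\<in>V2. N' g' h' \<phi>)"
        using V h phi N'_in by (intro linear_op_sum[symmetric] povm_linear[OF fin2 povm_M'])
      then show "(\<Sum>h'\<in>V2. ip \<phi> (M' g h (N' g' h' \<phi>))) = ip \<phi> (M' g h \<phi>)"
        using V h phi M'_in N'_in povm_sum[OF fin2 povm_N']
        by (subst ip_sum_right[symmetric]) simp_all
    qed
    also have "\<dots> = ip \<phi> \<phi>"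
      using V phi M'_in povm_sum[OF fin2 povm_M'] by (subst ip_sum_right[symmetric]) simp_all
    also have "\<dots> = 1" using phi by (simp add: ip_self_norm)
    finally show ?thesis unfolding p_def by (simp flip: Re_sum)
  qed
  have p_le: "p h h' g g' \<le> 1" if V: "g \<in> V1" "h \<in> V2" "g' \<in> V1" "h' \<in> V2" for g h g' h'
  proof -
    have "p h h' g g' \<le> (\<Sum>h'\<in>V2. p h h' g g')"
      using V p_complex by (intro member_le_sum) auto
    also have "\<dots> \<le> (\<Sum>h\<in>V2. \<Sum>h'\<in>V2. p h h' g g')"
      using V p_complex by (intro member_le_sum sum_nonneg) auto
    finally show ?thesis using p_sum V by simp
  qed
  have "winning G1 G2 p"
    unfolding winning_def
  proof (intro ballI impI)
    fix g g' h h' assume V: "g \<in> V1" "g' \<in> V1" "h \<in> V2" "h' \<in> V2" and r: "rel G1 g g' \<noteq> rel G2 h h'"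
    have "M (Inl g) (Inr h) (M (Inl g') (Inr h') \<psi>) = 0"
      using V r by (intro M_rel) auto
    then show "p h h' g g' = 0" using V by (simp add: p_def scaled prod_eq)
  qed
  moreover have "quantum_correlation TYPE(continuum) V1 V2 p"
    unfolding quantum_correlation_def
  proof (intro conjI exI)
    show "correlation V1 V2 p"
      unfolding correlation_def using p_complex p_le p_sum by blast
    show "hilbert_space H" ..
    show "\<forall>g\<in>V1. \<forall>h\<in>V2. \<forall>g'\<in>V1. \<forall>h'\<in>V2. \<forall>y\<in>carrier H.
        M' g h (N' g' h' y) = N' g' h' (M' g h y)"
      using comm by blast
  qed (use phi povm_M' povm_N' p_complex in blast)+
  ultimately show False
    using not_qi card_eq_of_transfer[OF nz] unfolding quantum_isomorphic_def by blast
qed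

section \<open>Vanishing of the off-diagonal blocks\<close>

lemma M_Inl_Inr:
  assumes ab: "a \<in> V1" "b \<in> V2" and x: "x \<in> carrier H"
  shows "M (Inl a) (Inr b) x = 0"
proof (rule separating[of "M (Inl a) (Inr b)" "M (Inl a) (Inr b)"])
  show "M (Inl a) (Inr b) \<psi> = 0"
    using M_transfer(2)[OF ab] ab by (simp add: transfer_eq_zero)
qed (use ab x in \<open>auto simp: M_herm MN_commute\<close>)

text \<open>The graphs cannot simply be exchanged, since \<open>not_qi\<close> is directed. The rows
  of \<open>G1\<close> already sum to 1 within \<open>V1\<close>, so the columns of the square block
  \<open>V1\<close> leave defects with total 0. These defects are sums of positive operators, hence
  every entry in them vanishes.\<close>

lemma M_Inr_Inl:
  assumes ab: "a \<in> V1" "b \<in> V2" and x: "x \<in> carrier H"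
  shows "M (Inr b) (Inl a) x = 0"
proof -
  have V1: "(\<Sum>a\<in>V1. M (Inl a') (Inl a) x) = x" if "a' \<in> V1" for a'
    using row_split[of "Inl a'" x] that x by (simp add: M_Inl_Inr)
  have col: "(\<Sum>b\<in>V2. M (Inr b) (Inl a) x) = x - (\<Sum>a'\<in>V1. M (Inl a') (Inl a) x)" if "a \<in> V1" for a
    using col_split[of "Inl a" x] that x by (simp add: algebra_simps)
  have "(\<Sum>a\<in>V1. \<Sum>b\<in>V2. M (Inr b) (Inl a) x) = (\<Sum>a\<in>V1. x) - (\<Sum>a\<in>V1. \<Sum>a'\<in>V1. M (Inl a') (Inl a) x)"
    by (simp add: col sum_subtractf)
  also have "(\<Sum>a\<in>V1. \<Sum>a'\<in>V1. M (Inl a') (Inl a) x) = (\<Sum>a'\<in>V1. \<Sum>a\<in>V1. M (Inl a') (Inl a) x)"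
    by (rule sum.swap)
  also have "\<dots> = (\<Sum>a\<in>V1. x)" by (intro sum.cong refl V1)
  finally have 0: "(\<Sum>a\<in>V1. \<Sum>b\<in>V2. M (Inr b) (Inl a) x) = 0" by (simp only: diff_self)
  have nn: "ip x (M (Inr b) (Inl a) x) \<in> \<real>\<^sub>\<ge>\<^sub>0" if "a \<in> V1" "b \<in> V2" for a b
    using M_psd[of "Inr b" "Inl a"] that x unfolding psd_operator_def by simp
  have "(\<Sum>a\<in>V1. \<Sum>b\<in>V2. Re (ip x (M (Inr b) (Inl a) x))) = Re (ip x (\<Sum>a\<in>V1. \<Sum>b\<in>V2. M (Inr b) (Inl a) x))"
    using x by (simp add: ip_sum_right)
  also have "\<dots> = 0" using 0 x by simp
  finally have "\<forall>a\<in>V1. (\<Sum>b\<in>V2. Re (ip x (M (Inr b) (Inl a) x))) = 0"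
    using nn by (subst (asm) sum_nonneg_eq_0_iff) (auto simp: complex_nonneg_Reals_iff intro!: sum_nonneg)
  then have "(\<Sum>b\<in>V2. Re (ip x (M (Inr b) (Inl a) x))) = 0" using ab by blast
  then have "\<forall>b\<in>V2. Re (ip x (M (Inr b) (Inl a) x)) = 0"
    using nn ab by (subst (asm) sum_nonneg_eq_0_iff) (auto simp: complex_nonneg_Reals_iff)
  then have "ip x (M (Inr b) (Inl a) x) = 0"
    using nn ab by (auto simp: complex_nonneg_Reals_iff complex_eq_iff)
  then show ?thesis using ab x by (intro psd_ip_zero M_psd) auto
qed

section \<open>Commutation inside the diagonal blocks\<close>

lemma M_commute_V1:
  assumes V: "i \<in> V1" "j \<in> V1" "l \<in> V1 <+> V2" "k \<in> V1 <+> V2" and x: "x \<in> carrier H"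
  shows "M (Inl i) l (M (Inl j) k x) = M (Inl j) k (M (Inl i) l x)"
proof -
  have "M (Inl i) (Inl a) (M (Inl j) (Inl b) x) = M (Inl j) (Inl b) (M (Inl i) (Inl a) x)"
    if "a \<in> V1" "b \<in> V1" for a b
  proof (rule rel_orthogonal_commute[OF graph1 d_closed reproducing nqs1,
      where u = "\<lambda>i j. M (Inl i) (Inl j)"])
    show "(\<Sum>k\<in>V1. M (Inl i) (Inl k) x) = x" if "i \<in> V1" "x \<in> carrier H" for i x
      using row_split[of "Inl i" x] that by (simp add: M_Inl_Inr)
    show "(\<Sum>k\<in>V1. M (Inl k) (Inl i) x) = x" if "i \<in> V1" "x \<in> carrier H" for i x
      using col_split[of "Inl i" x] that by (simp add: M_Inr_Inl)
    show "M (Inl i) (Inl l) (M (Inl j) (Inl k) x) = 0"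
      if "i \<in> V1" "j \<in> V1" "l \<in> V1" "k \<in> V1" "rel G1 i j \<noteq> rel G1 l k" "x \<in> carrier H" for i j l k x
      using that by (intro M_rel) auto
  qed (use V x that in \<open>auto intro: M_psd M_idem\<close>)
  then show ?thesis using V x by (cases l; cases k) (auto simp: M_Inl_Inr)
qed

lemma M_commute_V2:
  assumes V: "i \<in> V2" "j \<in> V2" "l \<in> V1 <+> V2" "k \<in> V1 <+> V2" and x: "x \<in> carrier H"
  shows "M (Inr i) l (M (Inr j) k x) = M (Inr j) k (M (Inr i) l x)"
proof -
  have "M (Inr i) (Inr a) (M (Inr j) (Inr b) x) = M (Inr j) (Inr b) (M (Inr i) (Inr a) x)"
    if "a \<in> V2" "b \<in> V2" for a b
  proof (rule rel_orthogonal_commute[OF graph2 d_closed reproducing nqs2,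
      where u = "\<lambda>i j. M (Inr i) (Inr j)"])
    show "(\<Sum>k\<in>V2. M (Inr i) (Inr k) x) = x" if "i \<in> V2" "x \<in> carrier H" for i x
      using row_split[of "Inr i" x] that by (simp add: M_Inr_Inl)
    show "(\<Sum>k\<in>V2. M (Inr k) (Inr i) x) = x" if "i \<in> V2" "x \<in> carrier H" for i x
      using col_split[of "Inr i" x] that by (simp add: M_Inl_Inr)
    show "M (Inr i) (Inr l) (M (Inr j) (Inr k) x) = 0"
      if "i \<in> V2" "j \<in> V2" "l \<in> V2" "k \<in> V2" "rel G2 i j \<noteq> rel G2 l k" "x \<in> carrier H" for i j l k x
      using that by (intro M_rel) auto
  qed (use V x that in \<open>auto intro: M_psd M_idem\<close>)
  then show ?thesis using V x by (cases l; cases k) (auto simp: M_Inr_Inl)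
qed

end

section \<open>Joint distribution of two commuting blocks\<close>

context synchronous_model
begin

text \<open>When the rows in the list commute, this is the joint spectral projection for the event
  that each listed \<open>i\<close> receives the answer \<open>f i\<close>.\<close>

abbreviation word :: "('a \<Rightarrow> 'a) \<Rightarrow> 'a list \<Rightarrow> continuum \<Rightarrow> continuum" where
  "word f \<equiv> word_op (\<lambda>i. M i (f i))"

lemma word_append: "word f (xs @ ys) x = word f xs (word f ys x)"
  by (induction xs) auto

lemma word_in [simp]:
  "\<lbrakk>set xs \<subseteq> V; f ` set xs \<subseteq> V; x \<in> carrier H\<rbrakk> \<Longrightarrow> word f xs x \<in> carrier H"
  by (induction xs) auto

lemma word_linear: "\<lbrakk>set xs \<subseteq> V; f ` set xs \<subseteq> V\<rbrakk> \<Longrightarrow> linear_op (word f xs)"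
proof (induction xs)
  case Nil
  show ?case by (auto simp: linear_op_def)
next
  case (Cons i xs)
  then have "linear_op (M i (f i))" "linear_op (word f xs)" by (auto intro: M_linear)
  then show ?case by (auto simp: linear_op_def Pi_iff)
qed

lemma word_N:
  "\<lbrakk>set xs \<subseteq> V; f ` set xs \<subseteq> V; x \<in> carrier H; i \<in> V; l \<in> V\<rbrakk> \<Longrightarrow>
    word f xs (N i l x) = N i l (word f xs x)"
  by (induction xs) (auto simp: MN_commute)

lemma word_cong: "(\<And>i. i \<in> set xs \<Longrightarrow> f i = f' i) \<Longrightarrow> word f xs x = word f' xs x"
  by (induction xs) auto

text \<open>The product of the row sums, each equal to 1, is multiplied out. Distinctness makes the
  answers independent choices, and extensional functions list each choice once.\<close>

lemma sum_word:
  "\<lbrakk>distinct xs; set xs \<subseteq> V; x \<in> carrier H\<rbrakk> \<Longrightarrow> (\<Sum>f\<in>(set xs \<rightarrow>\<^sub>E V). word f xs x) = x"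
proof (induction xs)
  case (Cons i xs)
  let ?P = "set xs \<rightarrow>\<^sub>E V"
  have inP: "f ` set xs \<subseteq> V" if "f \<in> ?P" for f using that by auto
  have i: "i \<notin> set xs" "i \<in> V" using Cons by auto
  have "(\<Sum>f\<in>(set (i # xs) \<rightarrow>\<^sub>E V). word f (i # xs) x)
      = (\<Sum>(l, f)\<in>V \<times> ?P. word (f(i := l)) (i # xs) x)"
    unfolding list.set PiE_insert_eq using inj_combinator[OF i(1), of "\<lambda>_. V"]
    by (subst sum.reindex) (auto simp: case_prod_unfold)
  also have "\<dots> = (\<Sum>(l, f)\<in>V \<times> ?P. M i l (word f xs x))"
  proof (rule sum.cong[OF refl], clarify)
    fix l f
    have "word (f(i := l)) xs x = word f xs x" using i by (intro word_cong) auto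
    then show "word (f(i := l)) (i # xs) x = M i l (word f xs x)" by simp
  qed
  also have "\<dots> = (\<Sum>l\<in>V. \<Sum>f\<in>?P. M i l (word f xs x))"
    by (rule sum.cartesian_product[symmetric])
  also have "\<dots> = (\<Sum>l\<in>V. M i l (\<Sum>f\<in>?P. word f xs x))"
    using i Cons.prems inP by (intro sum.cong refl linear_op_sum[symmetric] M_linear) auto
  also have "\<dots> = x" using Cons i by (simp add: M_row)
  finally show ?case .
qed simp

text \<open>Letters are taken off the right end one at a time by \<open>trace_M\<close>. The map
  \<open>T\<close> is arbitrary because it absorbs the letters already moved to the front.\<close>

lemma trace_word:
  assumes "set xs \<subseteq> V" "f ` set xs \<subseteq> V" "\<And>x. x \<in> carrier H \<Longrightarrow> T x \<in> carrier H"
    "\<And>i l x. \<lbrakk>i \<in> V; l \<in> V; x \<in> carrier H\<rbrakk> \<Longrightarrow> T (N i l x) = N i l (T x)"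
  shows "ip \<psi> (T (word f xs \<psi>)) = ip \<psi> (word f xs (T \<psi>))"
  using assms
proof (induction xs arbitrary: T rule: rev_induct)
  case (snoc i xs)
  then have i: "i \<in> V" "f i \<in> V" and xs: "set xs \<subseteq> V" "f ` set xs \<subseteq> V" by auto
  note T = snoc.prems(3,4)
  have "ip \<psi> (T (word f (xs @ [i]) \<psi>)) = ip \<psi> (T (word f xs (M i (f i) \<psi>)))"
    by (simp add: word_append)
  also have "\<dots> = ip \<psi> (M i (f i) (T (word f xs \<psi>)))"
    using i xs T by (intro trace_M[where T = "\<lambda>x. T (word f xs x)"]) (auto simp: word_N)
  also have "\<dots> = ip \<psi> (word f xs (M i (f i) (T \<psi>)))"
    using i xs T by (intro snoc.IH) (auto simp: MN_commute)
  finally show ?case by (simp add: word_append)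
qed simp

section \<open>Words in commuting rows\<close>

definition commuting_on :: "'a set \<Rightarrow> bool" where
  "commuting_on I \<longleftrightarrow> (\<forall>i\<in>I. \<forall>j\<in>I. \<forall>l\<in>V. \<forall>k\<in>V. \<forall>x\<in>carrier H. M i l (M j k x) = M j k (M i l x))"

lemma commuting_on_subset: "commuting_on J \<Longrightarrow> I \<subseteq> J \<Longrightarrow> commuting_on I"
  unfolding commuting_on_def by blast

lemma commuting_onD:
  "\<lbrakk>commuting_on I; i \<in> I; j \<in> I; l \<in> V; k \<in> V; x \<in> carrier H\<rbrakk> \<Longrightarrow>
    M i l (M j k x) = M j k (M i l x)"
  unfolding commuting_on_def by blast

text \<open>Commuting the new factor to the place where row \<open>i\<close> occurs in the word
  leaves two projections of the same row: idempotency absorbs the factor, or row orthogonality gives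
  0.\<close>

lemma M_word:
  "\<lbrakk>commuting_on (set xs); set xs \<subseteq> V; f ` set xs \<subseteq> V; i \<in> set xs; l \<in> V; x \<in> carrier H\<rbrakk> \<Longrightarrow>
    M i l (word f xs x) = (if l = f i then word f xs x else 0)"
proof (induction xs)
  case (Cons a xs)
  let ?z = "word f xs x"
  have V: "a \<in> V" "f a \<in> V" "i \<in> V" "?z \<in> carrier H" using Cons.prems by auto
  show ?case
  proof (cases "i = a")
    case True
    then show ?thesis using V Cons.prems by (auto simp: M_idem intro!: M_row_orth)
  next
    case False
    moreover have "commuting_on (set xs)"
      by (rule commuting_on_subset[OF Cons.prems(1)]) auto
    ultimately have "M i l ?z = (if l = f i then ?z else 0)"
      using Cons by auto
    moreover have "M i l (M a (f a) ?z) = M a (f a) (M i l ?z)"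
      using Cons.prems V by (intro commuting_onD[OF Cons.prems(1)]) auto
    ultimately show ?thesis using V by simp
  qed
qed simp

lemma M_word_commute:
  "\<lbrakk>commuting_on I; set xs \<subseteq> I; I \<subseteq> V; f ` set xs \<subseteq> V; i \<in> I; l \<in> V; x \<in> carrier H\<rbrakk> \<Longrightarrow>
    M i l (word f xs x) = word f xs (M i l x)"
proof (induction xs)
  case (Cons a xs)
  have "set xs \<subseteq> V" using Cons.prems by auto
  then have "M i l (M a (f a) (word f xs x)) = M a (f a) (M i l (word f xs x))"
    using Cons.prems by (intro commuting_onD[OF Cons.prems(1)]) auto
  then show ?case using Cons by simp
qed simp

lemma word_herm:
  "\<lbrakk>commuting_on (set xs); set xs \<subseteq> V; f ` set xs \<subseteq> V; x \<in> carrier H; y \<in> carrier H\<rbrakk> \<Longrightarrow>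
    ip (word f xs x) y = ip x (word f xs y)"
proof (induction xs arbitrary: y)
  case (Cons a xs)
  have V: "set xs \<subseteq> V" "f ` set xs \<subseteq> V" "a \<in> V" "f a \<in> V" using Cons.prems by auto
  have "ip (word f (a # xs) x) y = ip (word f xs x) (M a (f a) y)"
    using Cons.prems V by (simp add: M_herm)
  also have "\<dots> = ip x (word f xs (M a (f a) y))"
    using Cons.prems V by (intro Cons.IH commuting_on_subset[OF Cons.prems(1)]) auto
  also have "word f xs (M a (f a) y) = M a (f a) (word f xs y)"
    using Cons.prems V by (intro M_word_commute[symmetric, of "set (a # xs)"]) auto
  finally show ?case by simp
qed simp

lemma word_idem:
  assumes "commuting_on (set xs)" "set xs \<subseteq> V" "f ` set xs \<subseteq> V" "x \<in> carrier H"
  shows "word f xs (word f xs x) = word f xs x"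
proof -
  \<comment> \<open>The outer word is generalized to sublists so that the induction leaves the inner
    word intact.\<close>
  have "word f ys (word f xs x) = word f xs x" if "set ys \<subseteq> set xs" for ys
    using that
  proof (induction ys)
    case (Cons a ys)
    then have "a \<in> set xs" "f a \<in> V" using assms by auto
    then show ?case using Cons assms by (simp add: M_word)
  qed simp
  then show ?thesis by simp
qed

text \<open>The second word is idempotent, so that by the trace property
  \<open>\<langle>\<psi>, E F \<psi>\<rangle> = \<langle>\<psi>, F E F \<psi>\<rangle> = \<parallel>E F \<psi>\<parallel>\<^sup>2\<close>.\<close>

lemma word_pair_nonneg:
  assumes xs: "commuting_on (set xs)" "set xs \<subseteq> V" "f ` set xs \<subseteq> V"
    and ys: "commuting_on (set ys)" "set ys \<subseteq> V" "f ` set ys \<subseteq> V"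
  shows "0 \<le> Re (ip \<psi> (word f xs (word f ys \<psi>)))"
proof -
  let ?E = "word f xs" and ?F = "word f ys"
  have "ip \<psi> (?E (?F \<psi>)) = ip \<psi> (?E (?F (?F \<psi>)))"
    using ys by (simp add: word_idem)
  also have "\<dots> = ip \<psi> (?F (?E (?F \<psi>)))"
    using xs ys by (intro trace_word[where T = "\<lambda>x. ?E (?F x)"]) (auto simp: word_N)
  also have "\<dots> = ip (?F \<psi>) (?E (?E (?F \<psi>)))"
    using xs ys by (simp add: word_herm word_idem)
  also have "\<dots> = ip (?E (?F \<psi>)) (?E (?F \<psi>))"
    using xs ys by (simp add: word_herm)
  finally show ?thesis using xs ys by (simp add: ip_self_nonneg)
qed

lemma correlation_symmetric:
  assumes "i \<in> V" "l \<in> V" "j \<in> V" "k \<in> V"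
  shows "ip \<psi> (M i l (N j k \<psi>)) = ip \<psi> (M j k (N i l \<psi>))"
proof -
  have "ip \<psi> (M i l (N j k \<psi>)) = ip (N i l \<psi>) (M j k \<psi>)"
    using assms by (simp add: N_psi M_herm)
  also have "\<dots> = ip \<psi> (M j k (N i l \<psi>))"
    using assms by (simp add: N_herm MN_commute)
  finally show ?thesis .
qed

section \<open>Expansion of correlations over answer functions\<close>

context
  fixes xs ys
  assumes dist: "distinct (xs @ ys)" and cover: "set xs \<union> set ys = V"
    and xs: "commuting_on (set xs)" and ys: "commuting_on (set ys)"
begin

text \<open>The words along \<open>xs @ ys\<close> resolve the identity even if letters from
  different blocks do not commute.\<close>

lemma correlation_expand:
  assumes T: "linear_op T"
  shows "ip \<psi> (T \<psi>) = (\<Sum>f\<in>(V \<rightarrow>\<^sub>E V). ip \<psi> (T (word f xs (word f ys \<psi>))))"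
proof -
  have in': "word f xs (word f ys \<psi>) \<in> carrier H" if "f \<in> V \<rightarrow>\<^sub>E V" for f
    using that cover by (intro word_in) auto
  have "\<psi> = (\<Sum>f\<in>(set (xs @ ys) \<rightarrow>\<^sub>E V). word f (xs @ ys) \<psi>)"
    using dist cover by (intro sum_word[symmetric]) auto
  then have e: "\<psi> = (\<Sum>f\<in>(V \<rightarrow>\<^sub>E V). word f xs (word f ys \<psi>))"
    using cover by (simp add: word_append)
  have "T \<psi> = T (\<Sum>f\<in>(V \<rightarrow>\<^sub>E V). word f xs (word f ys \<psi>))"
    using e by (rule arg_cong)
  also have "\<dots> = (\<Sum>f\<in>(V \<rightarrow>\<^sub>E V). T (word f xs (word f ys \<psi>)))"
    using in' by (intro linear_op_sum T) auto
  finally have "ip \<psi> (T \<psi>) = ip \<psi> (\<Sum>f\<in>(V \<rightarrow>\<^sub>E V). T (word f xs (word f ys \<psi>)))"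
    by (rule arg_cong)
  also have "\<dots> = (\<Sum>f\<in>(V \<rightarrow>\<^sub>E V). ip \<psi> (T (word f xs (word f ys \<psi>))))"
    using in' linear_opD(1)[OF T] by (intro ip_sum_right) auto
  finally show ?thesis .
qed

text \<open>\<open>M i l\<close> meets the outer word and is evaluated there by
  \<open>M_word\<close>. If \<open>j\<close> is in \<open>xs\<close> too, \<open>N j k\<close> is
  first turned into \<open>M j k\<close> at \<psi> and treated alike. If \<open>j\<close> is in
  \<open>ys\<close>, it stays an \<open>N\<close>, slides through both words to \<psi>, becomes an
  \<open>M\<close> there and is evaluated by the inner word. So the two blocks are never
  commuted.\<close>

lemma correlation_left:
  assumes i: "i \<in> set xs" and j: "j \<in> V" and lk: "l \<in> V" "k \<in> V"
  shows "ip \<psi> (M i l (N j k \<psi>)) =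
    (\<Sum>f\<in>(V \<rightarrow>\<^sub>E V). if l = f i \<and> k = f j then ip \<psi> (word f xs (word f ys \<psi>)) else 0)"
proof (cases "j \<in> set xs")
  case True
  have V: "i \<in> V" using i cover by auto
  have "ip \<psi> (M i l (N j k \<psi>)) = ip \<psi> (M i l (M j k \<psi>))"
    using V j lk by (simp add: N_psi)
  also have "\<dots> = (\<Sum>f\<in>(V \<rightarrow>\<^sub>E V). ip \<psi> (M i l (M j k (word f xs (word f ys \<psi>)))))"
    using V j lk M_linear[of i l] M_linear[of j k]
    by (intro correlation_expand) (auto simp: linear_op_def Pi_iff)
  also have "\<dots> = (\<Sum>f\<in>(V \<rightarrow>\<^sub>E V). if l = f i \<and> k = f j then ip \<psi> (word f xs (word f ys \<psi>)) else 0)"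
  proof (rule sum.cong[OF refl])
    fix f assume f: "f \<in> V \<rightarrow>\<^sub>E V"
    then have s: "set xs \<subseteq> V" "f ` set xs \<subseteq> V" "set ys \<subseteq> V" "f ` set ys \<subseteq> V" using cover by auto
    show "ip \<psi> (M i l (M j k (word f xs (word f ys \<psi>)))) =
      (if l = f i \<and> k = f j then ip \<psi> (word f xs (word f ys \<psi>)) else 0)"
      using s xs i True lk V PiE_mem[OF f] j by (simp add: M_word)
  qed
  finally show ?thesis .
next
  case False
  then have jy: "j \<in> set ys" using j cover by auto
  have V: "i \<in> V" using i cover by auto
  have "ip \<psi> (M i l (N j k \<psi>)) = (\<Sum>f\<in>(V \<rightarrow>\<^sub>E V). ip \<psi> (M i l (N j k (word f xs (word f ys \<psi>)))))"
    using V j lk M_linear[of i l] N_linear[of j k]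
    by (intro correlation_expand) (auto simp: linear_op_def Pi_iff)
  also have "\<dots> = (\<Sum>f\<in>(V \<rightarrow>\<^sub>E V). if l = f i \<and> k = f j then ip \<psi> (word f xs (word f ys \<psi>)) else 0)"
  proof (rule sum.cong[OF refl])
    fix f assume f: "f \<in> V \<rightarrow>\<^sub>E V"
    then have s: "set xs \<subseteq> V" "f ` set xs \<subseteq> V" "set ys \<subseteq> V" "f ` set ys \<subseteq> V" using cover by auto
    have "N j k (word f xs (word f ys \<psi>)) = word f xs (word f ys (M j k \<psi>))"
      using s j lk by (simp add: word_N[symmetric] N_psi[symmetric])
    also have "word f ys (M j k \<psi>) = M j k (word f ys \<psi>)"
      using s ys jy lk by (intro M_word_commute[symmetric, of "set ys"]) auto
    also have "\<dots> = (if k = f j then word f ys \<psi> else 0)"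
      using s ys jy lk by (intro M_word) auto
    finally have "N j k (word f xs (word f ys \<psi>)) = (if k = f j then word f xs (word f ys \<psi>) else 0)"
      using linear_opD(5)[OF word_linear[OF s(1,2)]] by (simp del: zero_fun_apply)
    then show "ip \<psi> (M i l (N j k (word f xs (word f ys \<psi>)))) =
      (if l = f i \<and> k = f j then ip \<psi> (word f xs (word f ys \<psi>)) else 0)"
      using s xs i lk V PiE_mem[OF f] by (simp add: M_word)
  qed
  finally show ?thesis .
qed

end

text \<open>The remaining cases reduce to \<open>correlation_left\<close>: one question in
  \<open>xs\<close> suffices by the symmetry of the correlation, and for two questions in
  \<open>ys\<close> the blocks are exchanged, which preserves the weights by the trace
  property.\<close>

lemma correlation_joint:
  assumes dist: "distinct (xs @ ys)" and cover: "set xs \<union> set ys = V"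
    and xs: "commuting_on (set xs)" and ys: "commuting_on (set ys)"
    and V: "i \<in> V" "j \<in> V" "l \<in> V" "k \<in> V"
  shows "ip \<psi> (M i l (N j k \<psi>)) =
    (\<Sum>f\<in>(V \<rightarrow>\<^sub>E V). if l = f i \<and> k = f j then ip \<psi> (word f xs (word f ys \<psi>)) else 0)"
proof -
  consider "i \<in> set xs" | "j \<in> set xs" | "i \<in> set ys" "j \<in> set ys" using V cover by auto
  then show ?thesis
  proof cases
    case 1
    show ?thesis by (rule correlation_left[OF dist cover xs ys 1 V(2-)])
  next
    case 2
    show ?thesis
      using correlation_left[OF dist cover xs ys 2 V(1,4,3)] V
      by (simp add: correlation_symmetric[of i] conj_commute)
  next
    case 3
    have "ip \<psi> (word f ys (word f xs \<psi>)) = ip \<psi> (word f xs (word f ys \<psi>))" if "f \<in> V \<rightarrow>\<^sub>E V" for f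
    proof -
      have "set xs \<subseteq> V" "f ` set xs \<subseteq> V" "set ys \<subseteq> V" "f ` set ys \<subseteq> V" using cover that by auto
      then show ?thesis by (intro trace_word) (auto simp: word_N)
    qed
    moreover have "distinct (ys @ xs)" "set ys \<union> set xs = V" using dist cover by auto
    ultimately show ?thesis
      by (subst correlation_left[OF _ _ ys xs 3(1) V(2-)]) (auto intro!: sum.cong)
  qed
qed

end

section \<open>From weights on answer functions to automorphisms\<close>

context union_model
begin

lemma winning_classical_correlation:
  assumes p: "\<And>i j l k. \<lbrakk>i \<in> V1 <+> V2; j \<in> V1 <+> V2; l \<in> V1 <+> V2; k \<in> V1 <+> V2\<rbrakk> \<Longrightarrow>
    complex_of_real (p l k i j) = ip \<psi> (M i l (N j k \<psi>))"
  shows "winning_classical (disjoint_union G1 G2) p"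
proof -
  let ?G = "disjoint_union G1 G2"
  let ?V = "V1 <+> V2"
  let ?Aut = "graph_automorphisms ?G"
  obtain xs ys :: "('a + 'b) list" where xs: "set xs = Inl ` V1" "distinct xs" and ys: "set ys = Inr ` V2" "distinct ys"
    by (metis fin1 fin2 finite_distinct_list finite_imageI)
  have dist: "distinct (xs @ ys)" using xs ys by auto
  have cover: "set xs \<union> set ys = pverts ?G" using xs ys by auto
  have cxs: "commuting_on (set xs)" and cys: "commuting_on (set ys)"
    unfolding commuting_on_def xs ys using M_commute_V1 M_commute_V2 by auto
  define c where "c f = Re (ip \<psi> (word f xs (word f ys \<psi>)))" for f
  have sub: "set xs \<subseteq> pverts ?G" "set ys \<subseteq> pverts ?G" using cover by auto
  have c_nonneg: "0 \<le> c f" if "f ` ?V \<subseteq> ?V" for f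
    unfolding c_def using that sub by (intro word_pair_nonneg cxs cys) auto
  have p_eq: "p l k i j = (\<Sum>f\<in>(?V \<rightarrow>\<^sub>E ?V). if l = f i \<and> k = f j then c f else 0)"
    if "i \<in> ?V" "j \<in> ?V" "l \<in> ?V" "k \<in> ?V" for i j l k
  proof -
    have "p l k i j = Re (ip \<psi> (M i l (N j k \<psi>)))" using p[OF that] by (metis Re_complex_of_real)
    also have "\<dots> = (\<Sum>f\<in>(?V \<rightarrow>\<^sub>E ?V). if l = f i \<and> k = f j then c f else 0)"
      using that by (subst correlation_joint[OF dist cover cxs cys])
        (auto simp: c_def intro!: sum.cong)
    finally show ?thesis .
  qed
  have c_sum: "(\<Sum>f\<in>(?V \<rightarrow>\<^sub>E ?V). c f) = 1"
  proof -
    have "ip \<psi> \<psi> = (\<Sum>f\<in>(?V \<rightarrow>\<^sub>E ?V). ip \<psi> (word f xs (word f ys \<psi>)))"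
      using correlation_expand[OF dist cover cxs cys, of "\<lambda>x. x"] by (simp add: linear_op_def)
    then show ?thesis
      using psi_norm by (simp add: c_def ip_self_norm flip: Re_sum)
  qed
  \<comment> \<open>A nonzero weight makes \<open>?E\<close> and \<open>?F\<close> nonzero.
    \<open>?E\<close> is fixed by the entries chosen in \<open>xs\<close>, but for \<open>ys\<close>
    the inner vector \<open>?F\<close> has to be used, since the blocks need not commute. A violated
    relation inside a block would contradict \<open>M_rel\<close>; mixed pairs are distinct and
    nonadjacent on both sides because \<open>f\<close> preserves the blocks.\<close>
  have supp: "rel ?G i j = rel ?G (f i) (f j)"
    if f: "f \<in> ?V \<rightarrow>\<^sub>E ?V" and c: "c f \<noteq> 0" and ij: "i \<in> ?V" "j \<in> ?V" for f i j
  proof -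
    have r: "f v \<in> ?V" if "v \<in> ?V" for v using f that by auto
    have im: "f ` set xs \<subseteq> pverts ?G" "f ` set ys \<subseteq> pverts ?G" using r sub by auto
    let ?F = "word f ys \<psi>"
    let ?E = "word f xs ?F"
    have F: "?F \<in> carrier H" "?E \<in> carrier H" using im sub by auto
    have E0: "?E \<noteq> 0" using c by (auto simp: c_def)
    then have F0: "?F \<noteq> 0" using linear_opD(5)[OF word_linear[OF sub(1) im(1)]] by auto
    have fixE: "M v (f v) ?E = ?E" if "v \<in> set xs" for v
      using that sub im F r cover by (subst M_word[OF cxs]) auto
    have fixF: "M v (f v) ?F = ?F" if "v \<in> set ys" for v
      using that sub im F r cover by (subst M_word[OF cys]) auto
    have left: "\<exists>b\<in>V1. f (Inl a) = Inl b" if "a \<in> V1" for a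
      using fixE[of "Inl a"] that E0 F r[of "Inl a"] xs M_Inl_Inr[of a _ ?E]
      by (cases "f (Inl a)") auto
    have right: "\<exists>b\<in>V2. f (Inr a) = Inr b" if "a \<in> V2" for a
      using fixF[of "Inr a"] that F0 F r[of "Inr a"] ys M_Inr_Inl[of _ a ?F]
      by (cases "f (Inr a)") auto
    show ?thesis
    proof (cases i; cases j)
      fix a b assume "i = Inl a" "j = Inl b"
      then show ?thesis
        using fixE[of i] fixE[of j] M_rel[of i j "f i" "f j" ?E] E0 F ij r xs by auto
    next
      fix a b assume "i = Inr a" "j = Inr b"
      then show ?thesis
        using fixF[of i] fixF[of j] M_rel[of i j "f i" "f j" ?F] F0 F ij r ys by auto
    next
      fix a b assume "i = Inl a" "j = Inr b"
      then show ?thesis using left[of a] right[of b] ij by auto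
    next
      fix a b assume "i = Inr a" "j = Inl b"
      then show ?thesis using left[of b] right[of a] ij by auto
    qed
  qed
  \<comment> \<open>Automorphisms are permutations of the whole type that fix everything outside
    \<open>?V\<close>, while answer functions are extensional; restriction matches them.\<close>
  let ?R = "\<lambda>\<pi>. restrict \<pi> ?V"
  have inj: "inj_on ?R ?Aut"
  proof (rule inj_onI)
    fix \<pi> f' assume a: "\<pi> \<in> ?Aut" "f' \<in> ?Aut" and eq: "?R \<pi> = ?R f'"
    show "\<pi> = f'"
    proof
      fix v show "\<pi> v = f' v"
      proof (cases "v \<in> ?V")
        case True
        then show ?thesis using fun_cong[OF eq, of v] by simp
      next
        case False
        then have "\<pi> v = v" "f' v = v"
          using a permutes_not_in[of _ ?V v] by (simp_all add: graph_automorphisms_def)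
        then show ?thesis by simp
      qed
    qed
  qed
  have sub_fun: "?R ` ?Aut \<subseteq> ?V \<rightarrow>\<^sub>E ?V"
    by (auto simp: graph_automorphisms_def permutes_in_image restrict_PiE_iff simp del: Inl_Plus_iff Inr_Plus_iff)
  have outside: "c f = 0" if f: "f \<in> (?V \<rightarrow>\<^sub>E ?V) - ?R ` ?Aut" for f
  proof (rule ccontr)
    assume c: "c f \<noteq> 0"
    note s = supp[OF _ c]
    define \<pi> where "\<pi> v = (if v \<in> ?V then f v else v)" for v
    \<comment> \<open>\<open>rel\<close> records equality of vertices, so preserving it includes
      injectivity; finiteness adds surjectivity.\<close>
    have "inj_on f ?V"
      using s f by (intro inj_onI) (metis DiffD1 rel_eq_Equal_iff)
    moreover have "f ` ?V \<subseteq> ?V" using f by auto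
    ultimately have "bij_betw f ?V ?V"
      by (simp add: bij_betw_def endo_inj_surj)
    then have "bij_betw \<pi> ?V ?V" by (rule bij_betw_cong[THEN iffD1, rotated]) (simp add: \<pi>_def)
    then have "\<pi> permutes ?V" by (rule bij_imp_permutes) (simp add: \<pi>_def)
    moreover have "(\<pi> i, \<pi> j) \<in> parcs ?G \<longleftrightarrow> (i, j) \<in> parcs ?G" if "i \<in> ?V" "j \<in> ?V" for i j
    proof -
      have no_loop: "(v, v) \<notin> parcs ?G" for v
        using pair_graph_no_loop[OF graph1] pair_graph_no_loop[OF graph2] by (auto simp: disjoint_union_def)
      have adj: "(u, v) \<in> parcs ?G \<longleftrightarrow> rel ?G u v = Adjacent" for u v
        using no_loop by (auto simp: rel_def)
      show ?thesis using s[of i j] f that by (simp add: adj \<pi>_def)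
    qed
    ultimately have "\<pi> \<in> ?Aut" by (simp add: graph_automorphisms_def)
    moreover have "?R \<pi> = f" using f by (auto simp: \<pi>_def restrict_def PiE_def extensional_def)
    ultimately show False using f by blast
  qed
  have transfer_sum: "(\<Sum>f\<in>(?V \<rightarrow>\<^sub>E ?V). c f * g f) = (\<Sum>\<pi>\<in>?Aut. c (?R \<pi>) * g (?R \<pi>))" for g
  proof -
    have "(\<Sum>f\<in>(?V \<rightarrow>\<^sub>E ?V). c f * g f) = (\<Sum>f\<in>?R ` ?Aut. c f * g f)"
      using sub_fun outside by (intro sum.mono_neutral_right finite_PiE) auto
    also have "\<dots> = (\<Sum>\<pi>\<in>?Aut. c (?R \<pi>) * g (?R \<pi>))"
      by (simp add: sum.reindex[OF inj])
    finally show ?thesis .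
  qed
  show ?thesis
    unfolding winning_classical_def
  proof (intro exI[of _ "\<lambda>\<pi>. c (?R \<pi>)"] conjI ballI)
    show "0 \<le> c (?R \<pi>)" if "\<pi> \<in> ?Aut" for \<pi>
      using sub_fun that by (intro c_nonneg) blast
    show "(\<Sum>\<pi>\<in>?Aut. c (?R \<pi>)) = 1"
      using transfer_sum[of "\<lambda>_. 1"] c_sum by simp
    fix i j l k assume "i \<in> pverts ?G" "j \<in> pverts ?G" "l \<in> pverts ?G" "k \<in> pverts ?G"
    then have V: "i \<in> ?V" "j \<in> ?V" "l \<in> ?V" "k \<in> ?V" by simp_all
    have "p l k i j = (\<Sum>f\<in>(?V \<rightarrow>\<^sub>E ?V). c f * (if l = f i \<and> k = f j then 1 else 0))"
      unfolding p_eq[OF V] by (intro sum.cong) auto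
    also have "\<dots> = (\<Sum>\<pi>\<in>?Aut. c (?R \<pi>) * (if l = ?R \<pi> i \<and> k = ?R \<pi> j then 1 else 0))"
      by (rule transfer_sum)
    also have "\<dots> = (\<Sum>\<pi>\<in>?Aut. c (?R \<pi>) * automorphism_correlation \<pi> l k i j)"
      using V by (simp add: automorphism_correlation_def)
    finally show "p l k i j = (\<Sum>\<pi>\<in>?Aut. c (?R \<pi>) * automorphism_correlation \<pi> l k i j)" .
  qed
qed

end

theorem proposition5p4:
  fixes G1 :: "'a pair_pre_digraph" and G2 :: "'b pair_pre_digraph"
  assumes "pair_graph G1" and "pair_graph G2"
    and "Digraph_Component.connected (with_proj G1)"
    and "Digraph_Component.connected (with_proj G2)"
    and "\<not> quantum_isomorphic TYPE(continuum) G1 G2"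
    and "no_quantum_symmetry TYPE(continuum) G1"
    and "no_quantum_symmetry TYPE(continuum) G2"
  shows "\<not> nonlocal_symmetry TYPE('h) (disjoint_union G1 G2)"
proof
  let ?G = "disjoint_union G1 G2"
  let ?V = "pverts ?G"
  assume "nonlocal_symmetry TYPE('h) ?G"
  then obtain p where qc: "quantum_correlation TYPE('h) ?V ?V p" and win: "winning ?G ?G p"
    and nc: "\<not> winning_classical ?G p"
    unfolding nonlocal_symmetry_def by blast
  obtain H :: "'h hilbert" and \<psi> M N
    where H: "hilbert_space H" and psi: "\<psi> \<in> carrier H" "hilbert_norm H \<psi> = 1"
      and povms: "\<forall>g\<in>?V. povm H ?V (M g)" "\<forall>g\<in>?V. povm H ?V (N g)"
      and comm: "\<forall>g\<in>?V. \<forall>h\<in>?V. \<forall>g'\<in>?V. \<forall>h'\<in>?V. \<forall>x\<in>carrier H.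
        M g h (N g' h' x) = N g' h' (M g h x)"
      and p: "\<forall>g\<in>?V. \<forall>h\<in>?V. \<forall>g'\<in>?V. \<forall>h'\<in>?V.
        complex_of_real (p h h' g g') = inner_prod H \<psi> (M g h (N g' h' \<psi>))"
    using qc unfolding quantum_correlation_def by (elim conjE exE)
  have fin: "finite ?V" using assms(1,2) by (simp add: pair_graph_finite)
  \<comment> \<open>The correlation is realized anew in \<open>continuum\<close>, the type in which
    the hypotheses on both graphs can be applied.\<close>
  obtain H' :: "continuum hilbert" and \<psi>' M' N' d where cm: "cyclic_model H' ?V ?V \<psi>' M' N' d"
    and eq: "\<And>g h g' h'. \<lbrakk>g \<in> ?V; h \<in> ?V; g' \<in> ?V; h' \<in> ?V\<rbrakk> \<Longrightarrow>
      inner_prod H' \<psi>' (M' g h (N' g' h' \<psi>')) = inner_prod H \<psi> (M g h (N g' h' \<psi>))"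
    using povms comm by (rule_tac hilbert_space.cyclic_model_exists[OF H fin fin psi, of M N]) blast+
  interpret union_model H' G1 G2 \<psi>' M' N' d
  proof (intro union_model.intro automorphism_model.intro automorphism_model_axioms.intro
      union_model_axioms.intro cm assms)
    show "rel ?G a b = rel ?G b a" for a b
      by (cases a; cases b) (simp_all add: rel_commute[OF assms(1)] rel_commute[OF assms(2)])
    show "inner_prod H' \<psi>' (M' i l (N' j k \<psi>')) = 0"
      if "i \<in> ?V" "j \<in> ?V" "l \<in> ?V" "k \<in> ?V" "rel ?G i j \<noteq> rel ?G l k" for i j l k
    proof -
      have "p l k i j = 0" using win that unfolding winning_def by blast
      moreover have "inner_prod H \<psi> (M i l (N j k \<psi>)) = complex_of_real (p l k i j)"
        using p that by simp
      ultimately show ?thesis using eq[OF that(1,3,2,4)] by simp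
    qed
  qed
  have "winning_classical ?G p"
    using p eq by (intro winning_classical_correlation) simp
  then show False using nc by contradiction
qed

end
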